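(* For every $n\ge1$ there exists a constant $\mathfrak{C}_{10}(n)>0$ such that if $\mu$ is a vertical $(2n+1)$-uniform cone on $\mathbb{H}^n$ for which $$\min_{\mathfrak{m}\in\mathbb{S}^{2n-1}}\int_{B_1(0)}\langle\mathfrak{m},z_H\rangle^2\,d\mu(z)\le\mathfrak{C}_{10}(n),$$ then $\mu$ is flat.
   Context: The Heisenberg group $\mathbb{H}^n$ is $\mathbb{R}^{2n}\times\mathbb{R}$, with points $x=(x_H,x_T)$ and product $x*y=(x_H+y_H,\,x_T+y_T+2\langle x_H,Jy_H\rangle)$, where $J=\begin{pmatrix}0&\mathrm{id}_n\\-\mathrm{id}_n&0\end{pmatrix}$. The Koranyi norm is $\|x\|=(|x_H|^4+|x_T|^2)^{1/4}$, the Koranyi distance is $d(x,y)=\|x^{-1}*y\|$, $B_r(x)=\{z: d(z,x)\le r\}$, and $D_\lambda(x)=(\lambda x_H,\lambda^2x_T)$ for $\lambda>0$. $\mathbb{S}^{2n-1}$ is the Euclidean unit sphere of $\mathbb{R}^{2n}$. A Radon measure $\mu$ is $m$-uniform if $0\in\mathrm{supp}(\mu)$ and $\mu(B_r(x))=r^m$ for all $r>0$ and $x\in\mathrm{supp}(\mu)$. It is an $m$-uniform cone if moreover $\lambda^{-m}\mu_{0,\lambda}=\mu$ for every $\lambda>0$, where $\mu_{0,\lambda}(A)=\mu(D_\lambda(A))$. A $(2n+1)$-uniform measure $\mu$ is vertical if there are $b\in\mathbb{R}^{2n}$ and a non-zero real symmetric $2n\times2n$ matrix $\mathcal{Q}$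 with $\mathrm{supp}(\mu)\subseteq\mathbb{K}(b,\mathcal{Q},0):=\{(x,t)\in\mathbb{R}^{2n}\times\mathbb{R}:\langle b,x\rangle+\langle x,\mathcal{Q}x\rangle=0\}$. For $\mathfrak{n}\in\mathbb{R}^{2n}\setminus\{0\}$ let $V(\mathfrak{n})=\{z:\langle\mathfrak{n},z_H\rangle=0\}$. A measure is flat if it equals $\mathcal{C}^{2n+1}\llcorner V(\mathfrak{n})$ for some such $\mathfrak{n}$ (equivalently, it is the Haar measure of the subgroup $V(\mathfrak n)$ giving mass $1$ to $B_1(0)$). Here $\mathcal{C}^{m}(A)=\sup_{E\subseteq A}\mathcal{C}^m_0(E)$, with $\mathcal{C}_0^m(E)=\sup_{\delta>0}\inf\{\sum_jr_j^m: E\subseteq\bigcup_jB_{r_j}(x_j),\ x_j\in E,\ r_j\le\delta\}$. *)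

theory Defs
  imports "HOL-Analysis.Analysis"
begin

text \<open>
  The underlying set of the n-th Heisenberg group, with n the cardinality of \<open>'n\<close>. The index
  \<open>Inl i\<close> addresses the i-th of the first n horizontal coordinates and \<open>Inr i\<close> the i-th of the
  last n. The topology and Borel structure are the Euclidean ones, which are also those of the
  Koranyi distance.
\<close>

type_synonym 'n heis = "(real ^ ('n + 'n)) \<times> real"

definition symplJ :: "real ^ ('n::finite + 'n) ^ ('n + 'n)" where
  "symplJ = (\<chi> i j. case (i, j) of
      (Inl a, Inr b) \<Rightarrow> (if a = b then 1 else 0)
    | (Inr a, Inl b) \<Rightarrow> (if a = b then - 1 else 0)
    | _ \<Rightarrow> 0)"

definition hmult :: "'n::finite heis \<Rightarrow> 'n heis \<Rightarrow> 'n heis" where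
  "hmult x y = (fst x + fst y, snd x + snd y + 2 * (fst x \<bullet> (symplJ *v fst y)))"

definition hinv :: "'n::finite heis \<Rightarrow> 'n heis" where
  "hinv x = (- fst x, - snd x)"

lemma symplJ_skew: "x \<bullet> (symplJ *v y) = - (y \<bullet> (symplJ *v x))"
proof -
  have "transpose symplJ = - (symplJ :: real ^ ('n::finite + 'n) ^ ('n + 'n))"
    by (auto simp: vec_eq_iff transpose_def symplJ_def split: sum.splits)
  moreover have "x \<bullet> (symplJ *v y) = (transpose symplJ *v x) \<bullet> y"
    by (metis dot_lmul_matrix transpose_matrix_vector)
  moreover have "(- symplJ) *v x = - (symplJ *v x)"
    by (simp add: vec_eq_iff matrix_vector_mult_def sum_negf)
  ultimately show ?thesis
    by (metis inner_commute inner_minus_right)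
qed

lemma hinv_inverse: "hmult (hinv x) x = 0" "hmult x (hinv x) = 0"
proof -
  have "fst x \<bullet> (symplJ *v fst x) = 0"
    using symplJ_skew[of "fst x" "fst x"] by linarith
  moreover have "symplJ *v (- fst x) = - (symplJ *v fst x)"
    by (simp add: vec_eq_iff matrix_vector_mult_def sum_negf)
  ultimately show "hmult (hinv x) x = 0" "hmult x (hinv x) = 0"
    by (simp_all add: hmult_def hinv_def prod_eq_iff)
qed

definition koranyi_norm :: "'n::finite heis \<Rightarrow> real" where
  "koranyi_norm x = root 4 (norm (fst x) ^ 4 + \<bar>snd x\<bar> ^ 2)"

definition koranyi_dist :: "'n::finite heis \<Rightarrow> 'n heis \<Rightarrow> real" where
  "koranyi_dist x y = koranyi_norm (hmult (hinv x) y)"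

definition kball :: "real \<Rightarrow> 'n::finite heis \<Rightarrow> 'n heis set" where
  "kball r x = {z. koranyi_dist z x \<le> r}"

definition dil :: "real \<Rightarrow> 'n::finite heis \<Rightarrow> 'n heis" where
  "dil l x = (l *\<^sub>R fst x, l\<^sup>2 * snd x)"

definition radon_measure :: "'a::topological_space measure \<Rightarrow> bool" where
  "radon_measure \<mu> \<longleftrightarrow>
     sets \<mu> = sets borel \<and>
     (\<forall>K. compact K \<longrightarrow> emeasure \<mu> K < \<infinity>) \<and>
     (\<forall>A\<in>sets borel. emeasure \<mu> A = (INF U\<in>{U. open U \<and> A \<subseteq> U}. emeasure \<mu> U)) \<and>
     (\<forall>U. open U \<longrightarrow> emeasure \<mu> U = (SUP K\<in>{K. compact K \<and> K \<subseteq> U}. emeasure \<mu> K))"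

definition msupp :: "'a::topological_space measure \<Rightarrow> 'a set" where
  "msupp \<mu> = {x. \<forall>U. open U \<and> x \<in> U \<longrightarrow> emeasure \<mu> U > 0}"

definition uniform_measure :: "nat \<Rightarrow> 'n::finite heis measure \<Rightarrow> bool" where
  "uniform_measure m \<mu> \<longleftrightarrow>
     radon_measure \<mu> \<and> 0 \<in> msupp \<mu> \<and>
     (\<forall>r>0. \<forall>x\<in>msupp \<mu>. emeasure \<mu> (kball r x) = ennreal (r ^ m))"

definition uniform_cone :: "nat \<Rightarrow> 'n::finite heis measure \<Rightarrow> bool" where
  "uniform_cone m \<mu> \<longleftrightarrow>
     uniform_measure m \<mu> \<and>
     (\<forall>l>0. \<forall>A\<in>sets borel. ennreal (1 / l ^ m) * emeasure \<mu> (dil l ` A) = emeasure \<mu> A)"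

definition quadric :: "real ^ ('n::finite + 'n) \<Rightarrow> real ^ ('n + 'n) ^ ('n + 'n) \<Rightarrow> 'n heis set" where
  "quadric b Q = {(x, t). b \<bullet> x + x \<bullet> (Q *v x) = 0}"

definition vertical :: "'n::finite heis measure \<Rightarrow> bool" where
  "vertical \<mu> \<longleftrightarrow>
     uniform_measure (2 * CARD('n) + 1) \<mu> \<and>
     (\<exists>b Q. Q \<noteq> 0 \<and> transpose Q = Q \<and> msupp \<mu> \<subseteq> quadric b Q)"

text \<open>
  Centred spherical Hausdorff measure. A cover is a finite or countably infinite family indexed by
  a set of naturals; the empty family covers the empty set. The outer supremum over subsets
  restores the monotonicity lost by requiring the centres to lie in the covered set.
\<close>

definition csph_pre :: "nat \<Rightarrow> 'n::finite heis set \<Rightarrow> ennreal" where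
  "csph_pre m E = (SUP \<delta>\<in>{0<..}. Inf {(\<Sum>\<^sub>\<infinity>j\<in>I. ennreal (r j ^ m)) | (I :: nat set) x r.
     E \<subseteq> (\<Union>j\<in>I. kball (r j) (x j)) \<and> (\<forall>j\<in>I. x j \<in> E \<and> 0 < r j \<and> r j \<le> \<delta>)})"

definition csph :: "nat \<Rightarrow> 'n::finite heis set \<Rightarrow> ennreal" where
  "csph m A = (SUP E\<in>Pow A. csph_pre m E)"

definition vplane :: "real ^ ('n::finite + 'n) \<Rightarrow> 'n heis set" where
  "vplane \<nn> = {z. \<nn> \<bullet> fst z = 0}"

definition flat :: "'n::finite heis measure \<Rightarrow> bool" where
  "flat \<mu> \<longleftrightarrow> sets \<mu> = sets borel \<and>
     (\<exists>\<nn>. \<nn> \<noteq> 0 \<and>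
        (\<forall>A\<in>sets borel. emeasure \<mu> A = csph (2 * CARD('n) + 1) (A \<inter> vplane \<nn>)))"

end

theory Submission
  imports Defs "HOL-Complex_Analysis.Cauchy_Integral_Formula" "HOL-Real_Asymp.Real_Asymp"
begin

text \<open>
  Let \<open>S\<close> be the support of a vertical uniform cone \<open>\<mu>\<close>, let \<open>N = 2n\<close> be the horizontal dimension and
  \<open>d = N - 1\<close>. By a Vitali covering argument a uniform measure is the restriction of the centred
  spherical measure to its support (\<open>csph_eq_emeasure\<close>). Hence flatness is a statement about \<open>S\<close>
  alone: one has to find a hyperplane \<open>V(m)\<close> containing \<open>S\<close>. It is then equal to \<open>S\<close>, by comparison
  of \<open>\<mu>\<close> with the Haar measure of \<open>V(m)\<close> (\<open>flat_of_msupp_subset_vplane\<close>).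

  The first step is that \<open>S\<close>, unless it already lies in such a hyperplane, is a union of vertical
  lines. For a point \<open>p = (x, t)\<close> the Laplace transforms \<open>\<integral> exp (- s d(p, z)\<^sup>4) d\<mu>(z)\<close>, \<open>s > 0\<close>,
  characterise membership in \<open>S\<close>; as functions of \<open>t\<close> they are entire up to a Gaussian factor. So
  the fibre of \<open>S\<close> over \<open>x\<close> is a whole line as soon as it has an accumulation point
  (\<open>fibre_full_of_accumulation\<close>). The points with discrete fibres lie on the quadric and form, away
  from its singular set, a graph-like set whose sweep in a transversal direction has volume zero;
  counting balls shows that \<open>\<mu>\<close> does not charge them (\<open>null_of_transversal\<close>).

  The second step reduces the problem to Euclidean space. If \<open>S\<close> is vertically invariant then so is
  \<open>\<mu>\<close>, say \<open>\<mu> = \<nu> \<times> dt\<close>. Integration over \<open>t\<close> removes the symplectic form from the Koranyi distance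
  and leaves the transforms of \<open>|y - x|\<^sup>4\<close> with respect to \<open>\<nu>\<close>. A Gaussian is a mixture of these
  (\<open>nn_integral_subordination\<close>), so \<open>\<integral> exp (- s |y - x|\<^sup>2) d\<nu>(y) = K s\<^bsup>-d/2\<^esup>\<close> for all \<open>x\<close> in the
  support of \<open>\<nu>\<close>. As in the work of Kowalski and Preiss, an expansion in \<open>x\<close> along the cone gives
  \<open>\<integral> \<langle>x,y\<rangle>\<^sup>2 d\<rho>(y) = |x|\<^sup>2 / 2\<close> and \<open>\<integral> \<langle>x,y\<rangle>\<^sup>4 d\<rho>(y) = 3 |x|\<^sup>4 / 4\<close> for such \<open>x\<close>, where \<open>\<rho>\<close> is the
  normalised Gaussian weight on \<open>\<nu>\<close>.

  The last step is a rigidity statement about \<open>\<rho>\<close> (\<open>hyperplane_of_small_moment\<close>). Let \<open>m\<close> minimise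
  the second moment over unit vectors, put \<open>\<epsilon> = 2 \<integral> \<langle>m,y\<rangle>\<^sup>2 d\<rho>\<close>, and let \<open>R\<close> be the identity minus
  \<open>m \<otimes> m\<close> minus twice the matrix of second moments. The identities above say that \<open>R\<close> has Frobenius
  norm \<open>\<surd>(2\<epsilon>)\<close> and that \<open>R(y) = - \<langle>m,y\<rangle>\<^sup>2\<close> on the support. They also give the tensor of fourth moments the
  norm that it has for the hyperplane orthogonal to \<open>m\<close>, and its inner product with the latter
  is almost maximal; so the two tensors are close, whence \<open>\<integral> R(y)\<^sup>2 d\<rho> \<ge> c \<epsilon>\<close>. But \<open>R(y)\<^sup>2 = \<langle>m,y\<rangle>\<^sup>4\<close> has
  an integral of smaller order than \<open>\<epsilon>\<close>. For small \<open>\<epsilon>\<close> this forces \<open>\<epsilon> = 0\<close>, that is, \<open>\<langle>m,y\<rangle> = 0\<close> on the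
  support.
\<close>

section \<open>The Koranyi distance\<close>

lemma symplJ_component:
  "(symplJ *v x) $ Inl a = x $ Inr a" "(symplJ *v x) $ Inr a = - (x $ Inl a)"
proof -
  have U: "(UNIV::('n+'n) set) = range Inl \<union> range Inr" by (auto simp: UNIV_sum)
  have *: "(\<Sum>j\<in>UNIV. f j) = (\<Sum>b\<in>UNIV. f (Inl b)) + (\<Sum>b\<in>UNIV. f (Inr b))" for f :: "'n::finite+'n \<Rightarrow> real"
    unfolding U by (subst sum.union_disjoint) (auto simp: sum.reindex inj_def)
  show "(symplJ *v x) $ Inl a = x $ Inr a" "(symplJ *v x) $ Inr a = - (x $ Inl a)"
    by (simp_all add: matrix_vector_mult_def symplJ_def * if_distrib if_distribR sum.delta cong: if_cong)
qed

lemma inner_plus_sum: "x \<bullet> y = (\<Sum>a\<in>UNIV. x $ Inl a * y $ Inl a) + (\<Sum>a\<in>UNIV. x $ Inr a * y $ Inr a)"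
  for x y :: "real ^ ('n::finite + 'n)"
proof -
  have U: "(UNIV::('n+'n) set) = range Inl \<union> range Inr" by (auto simp: UNIV_sum)
  show ?thesis unfolding inner_vec_def U by (subst sum.union_disjoint) (auto simp: sum.reindex inj_def)
qed

lemma norm_symplJ: "norm (symplJ *v x) = norm x"
  by (simp add: norm_eq_sqrt_inner inner_plus_sum symplJ_component)

lemma symplJ_self [simp]: "x \<bullet> (symplJ *v x) = 0"
  using symplJ_skew[of x x] by linarith

lemma symplJ_add: "symplJ *v (x + y) = symplJ *v x + symplJ *v y"
  by (rule matrix_vector_right_distrib)

lemma symplJ_minus: "symplJ *v (- x) = - (symplJ *v x)"
  by (simp add: matrix_vector_mult_def vec_eq_iff sum_negf)

lemma symplJ_diff: "symplJ *v (x - y) = symplJ *v x - symplJ *v y"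
  by (rule matrix_vector_mult_diff_distrib)

lemma symplJ_scale: "symplJ *v (c *\<^sub>R x) = c *\<^sub>R (symplJ *v x)"
  by (rule matrix_vector_mult_scaleR)

lemmas symplJ_lin = symplJ_add symplJ_minus symplJ_diff symplJ_scale

text \<open>
  The fourth power of the Koranyi distance. It is a polynomial in the coordinates, and it is the
  function whose Laplace transform is integrated below.
\<close>

definition kdist4 :: "'n::finite heis \<Rightarrow> 'n heis \<Rightarrow> real" where
  "kdist4 z x = norm (fst z - fst x) ^ 4 + (snd z - snd x - 2 * (fst x \<bullet> (symplJ *v fst z)))\<^sup>2"

lemma kdist4_nonneg: "kdist4 z x \<ge> 0" by (simp add: kdist4_def)

lemma koranyi_dist_root: "koranyi_dist z x = root 4 (kdist4 z x)"
  using symplJ_skew[of "fst z" "fst x"]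
  by (simp add: koranyi_dist_def koranyi_norm_def kdist4_def hmult_def hinv_def norm_minus_commute power2_commute algebra_simps)

lemma koranyi_dist_nonneg [simp]: "koranyi_dist z x \<ge> 0"
  by (simp add: koranyi_dist_root kdist4_nonneg)

lemma koranyi_dist_power4: "koranyi_dist z x ^ 4 = kdist4 z x"
  by (simp add: koranyi_dist_root kdist4_nonneg)

lemma koranyi_dist_le: "r \<ge> 0 \<Longrightarrow> koranyi_dist z x \<le> r \<longleftrightarrow> kdist4 z x \<le> r ^ 4"
  by (simp flip: koranyi_dist_power4)

lemma koranyi_dist_less: "r \<ge> 0 \<Longrightarrow> koranyi_dist z x < r \<longleftrightarrow> kdist4 z x < r ^ 4"
  using koranyi_dist_le[of "koranyi_dist z x"] power_strict_mono[of "koranyi_dist z x" r 4] power_mono[of r "koranyi_dist z x" 4]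
  by (simp add: koranyi_dist_power4) linarith

lemma kball_kdist4: "r \<ge> 0 \<Longrightarrow> kball r x = {z. kdist4 z x \<le> r ^ 4}"
  by (simp add: kball_def koranyi_dist_le)

lemma kdist4_commute: "kdist4 z x = kdist4 x z"
  using symplJ_skew[of "fst z" "fst x"]
  by (simp add: kdist4_def norm_minus_commute power2_commute[of "snd z - _ - _"] algebra_simps)
     (simp add: power2_eq_square algebra_simps)

lemma koranyi_dist_commute: "koranyi_dist z x = koranyi_dist x z"
  by (simp add: koranyi_dist_root kdist4_commute)

lemma kdist4_left_invariant: "kdist4 (hmult p z) (hmult p x) = kdist4 z x"
  using symplJ_skew[of "fst x" "fst p"]
  by (simp add: kdist4_def hmult_def symplJ_lin inner_add_left inner_add_right algebra_simps)

lemma koranyi_norm_power4: "koranyi_norm x ^ 4 = norm (fst x) ^ 4 + (snd x)\<^sup>2"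
  by (simp add: koranyi_norm_def)

lemma koranyi_norm_nonneg [simp]: "koranyi_norm x \<ge> 0"
  by (simp add: koranyi_norm_def)

lemma koranyi_norm_power2: "(koranyi_norm x)\<^sup>2 = cmod (Complex ((norm (fst x))\<^sup>2) (snd x))"
proof -
  have "((koranyi_norm x)\<^sup>2)\<^sup>2 = (cmod (Complex ((norm (fst x))\<^sup>2) (snd x)))\<^sup>2"
    using koranyi_norm_power4[of x] by (simp add: cmod_power2 flip: power_mult)
  then show ?thesis by (rule power2_eq_imp_eq) auto
qed

text \<open>
  Cygan's argument: identify the square of the gauge with the modulus of a complex number; the
  cross term of a product is then \<open>2 (\<langle>x,y\<rangle> + \<i> \<langle>x,Jy\<rangle>)\<close>, a Hermitian product, to which the
  Cauchy--Schwarz inequality applies.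
\<close>

lemma koranyi_norm_triangle: "koranyi_norm (hmult x y) \<le> koranyi_norm x + koranyi_norm y"
proof -
  define a b where "a = fst x" and "b = fst y"
  have herm: "(a \<bullet> b)\<^sup>2 + (a \<bullet> (symplJ *v b))\<^sup>2 \<le> (norm a * norm b)\<^sup>2"
  proof -
    define u where "u = (a \<bullet> b) *\<^sub>R b + (a \<bullet> (symplJ *v b)) *\<^sub>R (symplJ *v b)"
    let ?h = "(a \<bullet> b)\<^sup>2 + (a \<bullet> (symplJ *v b))\<^sup>2"
    have nJ: "(symplJ *v b) \<bullet> (symplJ *v b) = b \<bullet> b"
      by (metis norm_symplJ dot_square_norm)
    have 0: "(symplJ *v b) \<bullet> b = 0" by (metis symplJ_self inner_commute)
    have 1: "a \<bullet> u = ?h" by (simp add: u_def inner_add_right power2_eq_square)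
    have 2: "u \<bullet> u = ?h * (b \<bullet> b)"
      by (simp add: u_def inner_add_right inner_add_left nJ 0 power2_eq_square algebra_simps)
    have "?h\<^sup>2 \<le> (a \<bullet> a) * (?h * (b \<bullet> b))" using Cauchy_Schwarz_ineq[of a u] unfolding 1 2 .
    moreover have "(a \<bullet> a) * (?h * (b \<bullet> b)) = ?h * ((norm a * norm b)\<^sup>2)"
      by (simp only: dot_square_norm power_mult_distrib mult_ac)
    ultimately have "?h * ?h \<le> ?h * ((norm a * norm b)\<^sup>2)"
      by (simp only: power2_eq_square[of ?h])
    moreover have "?h \<ge> 0" "(norm a * norm b)\<^sup>2 \<ge> 0" by simp_all
    ultimately show ?thesis using mult_le_cancel_left[of ?h ?h "(norm a * norm b)\<^sup>2"] by linarith
  qed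
  have na: "norm (a + b) ^ 2 = norm a ^ 2 + norm b ^ 2 + 2 * (a \<bullet> b)"
    by (simp add: power2_norm_eq_inner inner_add_left inner_add_right inner_commute)
  have "Complex ((norm (a + b))\<^sup>2) (snd x + snd y + 2 * (a \<bullet> (symplJ *v b)))
      = Complex ((norm a)\<^sup>2) (snd x) + Complex ((norm b)\<^sup>2) (snd y)
        + 2 * Complex (a \<bullet> b) (a \<bullet> (symplJ *v b))"
    by (simp add: na complex_eq_iff)
  moreover have tri: "cmod (p + q + 2 * s) \<le> cmod p + cmod q + 2 * cmod s" for p q s
    using norm_triangle_ineq[of "p + q" "2 * s"] norm_triangle_ineq[of p q] by (simp add: norm_mult)
  ultimately have "(koranyi_norm (hmult x y))\<^sup>2
      \<le> (koranyi_norm x)\<^sup>2 + (koranyi_norm y)\<^sup>2 + 2 * cmod (Complex (a \<bullet> b) (a \<bullet> (symplJ *v b)))"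
    unfolding koranyi_norm_power2 hmult_def a_def b_def fst_conv snd_conv
    using tri[of "Complex ((norm (fst x))\<^sup>2) (snd x)" "Complex ((norm (fst y))\<^sup>2) (snd y)"] by metis
  also have "cmod (Complex (a \<bullet> b) (a \<bullet> (symplJ *v b))) \<le> norm a * norm b"
    using herm by (simp add: complex_norm real_le_lsqrt)
  also have "norm a * norm b \<le> koranyi_norm x * koranyi_norm y"
  proof -
    have "norm (fst x) \<le> koranyi_norm x" for x :: "'a heis"
      using koranyi_norm_power4[of x]
      by (metis koranyi_norm_nonneg le_add_same_cancel1 power_mono_iff norm_ge_zero zero_le_power2 zero_less_numeral)
    then show ?thesis unfolding a_def b_def by (intro mult_mono) auto
  qed
  finally have "(koranyi_norm (hmult x y))\<^sup>2 \<le> (koranyi_norm x + koranyi_norm y)\<^sup>2"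
    by (simp add: power2_sum)
  then show ?thesis by (rule power2_le_imp_le) simp
qed

lemma hmult_assoc: "hmult (hmult x y) z = hmult x (hmult y z)"
  by (simp add: hmult_def symplJ_lin inner_add_left inner_add_right algebra_simps)

lemma hmult_0 [simp]: "hmult 0 x = x" "hmult x 0 = x"
  by (simp_all add: hmult_def prod_eq_iff)

lemma koranyi_dist_triangle: "koranyi_dist x z \<le> koranyi_dist x y + koranyi_dist y z"
proof -
  have "hmult (hinv x) z = hmult (hmult (hinv x) y) (hmult (hinv y) z)"
    by (metis hmult_assoc hinv_inverse(2) hmult_0(1))
  then show ?thesis unfolding koranyi_dist_def by (metis koranyi_norm_triangle)
qed

lemma kdist4_self [simp]: "kdist4 x x = 0" by (simp add: kdist4_def)

lemma koranyi_dist_self [simp]: "koranyi_dist x x = 0" by (simp add: koranyi_dist_root)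

lemma continuous_on_matrix_vector [continuous_intros]:
  "continuous_on A f \<Longrightarrow> continuous_on A (\<lambda>x. (B::real^'m^'k) *v f x)"
  by (rule bounded_linear.continuous_on[OF matrix_vector_mul_bounded_linear])

lemma continuous_on_kdist4 [continuous_intros]:
  assumes "continuous_on A f" "continuous_on A g"
  shows "continuous_on A (\<lambda>y. kdist4 (f y) (g y))"
  unfolding kdist4_def by (intro continuous_intros assms)

lemma closed_kball: "closed (kball r x)"
proof (cases "r \<ge> 0")
  case True
  then show ?thesis unfolding kball_kdist4[OF True] by (intro closed_Collect_le continuous_intros)
next
  case False
  then have "kball r x = {}"
    unfolding kball_def by (auto simp: not_le) (meson koranyi_dist_nonneg less_le_trans not_le)
  then show ?thesis by simp
qed

lemma kball_borel [measurable]: "kball r x \<in> sets borel"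
  by (simp add: closed_kball borel_closed)

lemma kball_components:
  assumes "z \<in> kball r x" "r \<ge> 0"
  shows "norm (fst z - fst x) \<le> r" "\<bar>snd z - snd x - 2 * (fst x \<bullet> (symplJ *v fst z))\<bar> \<le> r\<^sup>2"
proof -
  have *: "kdist4 z x \<le> r ^ 4" using assms by (simp add: kball_kdist4)
  have "norm (fst z - fst x) ^ 4 \<le> r ^ 4" using * unfolding kdist4_def by (smt (verit) zero_le_power2)
  then show "norm (fst z - fst x) \<le> r" using assms(2) by (metis power_mono_iff norm_ge_zero zero_less_numeral)
  have "(snd z - snd x - 2 * (fst x \<bullet> (symplJ *v fst z)))\<^sup>2 \<le> (r\<^sup>2)\<^sup>2"
    using * unfolding kdist4_def by (smt (verit) zero_le_power norm_ge_zero power_mult numeral_Bit0 mult_2_right power_mult_numeral numeral_times_numeral)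
  then show "\<bar>snd z - snd x - 2 * (fst x \<bullet> (symplJ *v fst z))\<bar> \<le> r\<^sup>2"
    using abs_le_square_iff by (metis abs_of_nonneg zero_le_power2)
qed

lemma kball_dist:
  assumes "z \<in> kball r x" "r \<ge> 0"
  shows "dist z x \<le> r + r\<^sup>2 + 2 * norm x * r"
proof -
  have 1: "norm (fst z - fst x) \<le> r" and 2: "\<bar>snd z - snd x - 2 * (fst x \<bullet> (symplJ *v fst z))\<bar> \<le> r\<^sup>2"
    using kball_components[OF assms] by auto
  have "fst x \<bullet> (symplJ *v fst z) = fst x \<bullet> (symplJ *v (fst z - fst x))"
    by (simp add: symplJ_lin inner_diff_right)
  then have "\<bar>fst x \<bullet> (symplJ *v fst z)\<bar> \<le> norm (fst x) * norm (fst z - fst x)"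
    using Cauchy_Schwarz_ineq2[of "fst x" "symplJ *v (fst z - fst x)"] by (simp add: norm_symplJ)
  also have "\<dots> \<le> norm x * r"
    by (intro mult_mono 1) (use norm_fst_le[of "fst x" "snd x"] in auto)
  finally have 3: "\<bar>snd z - snd x\<bar> \<le> r\<^sup>2 + 2 * norm x * r" using 2 by linarith
  have "dist z x \<le> norm (fst z - fst x) + \<bar>snd z - snd x\<bar>"
    unfolding dist_norm by (metis fst_diff snd_diff norm_Pair_le prod.collapse real_norm_def)
  then show ?thesis using 1 3 by linarith
qed

lemma compact_kball: "compact (kball r x)"
proof (cases "r \<ge> 0")
  case True
  have "bounded (kball r x)"
    by (rule boundedI[where B="norm x + (r + r\<^sup>2 + 2 * norm x * r)"])
       (smt (verit) kball_dist[OF _ True] dist_norm norm_triangle_ineq2)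
  then show ?thesis by (simp add: compact_eq_bounded_closed closed_kball)
next
  case False
  then have "kball r x = {}"
    unfolding kball_def by (auto simp: not_le) (meson koranyi_dist_nonneg less_le_trans not_le)
  then show ?thesis by simp
qed

lemma kball_subset_open:
  assumes "open U" "x \<in> U"
  obtains r where "r > 0" "kball r x \<subseteq> U"
proof -
  obtain e where e: "e > 0" "cball x e \<subseteq> U" using assms open_contains_cball by blast
  define r where "r = min 1 (e / (2 + 2 * norm x))"
  have p: "2 + 2 * norm x > 0" by (smt (verit) norm_ge_zero)
  have r: "0 < r" "r \<le> 1" "r * (2 + 2 * norm x) \<le> e"
  proof -
    have "r \<le> e / (2 + 2 * norm x)" by (simp add: r_def)
    then show "r * (2 + 2 * norm x) \<le> e" using p by (simp only: pos_le_divide_eq)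
  qed (use e p in \<open>auto simp: r_def\<close>)
  have "r\<^sup>2 \<le> r" using r by (simp add: power2_eq_square mult_left_le_one_le)
  then have "dist z x \<le> e" if "z \<in> kball r x" for z
  proof -
    have "dist z x \<le> r + r + 2 * norm x * r" using kball_dist[OF that] \<open>r\<^sup>2 \<le> r\<close> r by linarith
    also have "\<dots> = r * (2 + 2 * norm x)" by (simp add: algebra_simps)
    finally show ?thesis using r by linarith
  qed
  then show thesis using that e r by (metis dist_commute mem_cball subset_eq)
qed

lemma open_koranyi_dist_less: "open {z. koranyi_dist z x < r}"
proof (cases "r \<ge> 0")
  case True
  then have "{z. koranyi_dist z x < r} = {z. kdist4 z x < r ^ 4}" by (simp add: koranyi_dist_less)
  then show ?thesis by simp (intro open_Collect_less continuous_intros)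
next
  case False
  then have "\<not> koranyi_dist z x < r" for z using koranyi_dist_nonneg[of z x] by linarith
  then have "{z. koranyi_dist z x < r} = {}" by blast
  then show ?thesis by (simp only: open_empty)
qed

lemma kdist4_dil: "kdist4 (dil l z) (dil l x) = l ^ 4 * kdist4 z x"
proof -
  have 1: "norm (fst (dil l z) - fst (dil l x)) = \<bar>l\<bar> * norm (fst z - fst x)"
    by (simp add: dil_def flip: scaleR_diff_right)
  have 2: "snd (dil l z) - snd (dil l x) - 2 * (fst (dil l x) \<bullet> (symplJ *v fst (dil l z)))
     = l\<^sup>2 * (snd z - snd x - 2 * (fst x \<bullet> (symplJ *v fst z)))"
    by (simp add: dil_def symplJ_lin power2_eq_square algebra_simps)
  have 3: "\<bar>l\<bar> ^ 4 = l ^ 4" "(l\<^sup>2)\<^sup>2 = l ^ 4" by (simp_all flip: power_mult)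
  show ?thesis unfolding kdist4_def 1 2 power_mult_distrib 3 by (simp only: distrib_left)
qed

lemma koranyi_dist_dil: "l \<ge> 0 \<Longrightarrow> koranyi_dist (dil l z) (dil l x) = l * koranyi_dist z x"
  by (simp add: koranyi_dist_root kdist4_dil real_root_mult real_root_pos2)

section \<open>Covering by Koranyi balls\<close>

text \<open>
  Zorn's lemma is applied to the disjoint subfamilies \<open>F\<close> with the property that every set meeting
  \<open>F\<close> meets a member of \<open>F\<close> of at least half its size. A maximal such \<open>F\<close> meets everything: among
  the sets that it misses, one whose size is more than half of the supremum could be added.
\<close>

lemma vitali_selection:
  fixes ball :: "'i \<Rightarrow> 'a set" and rad :: "'i \<Rightarrow> real"
  assumes rad: "\<And>i. i \<in> I \<Longrightarrow> 0 < rad i \<and> rad i \<le> R" and ne: "\<And>i. i \<in> I \<Longrightarrow> ball i \<noteq> {}"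
  obtains F where "F \<subseteq> I" "disjoint_family_on ball F"
    "\<And>i. i \<in> I \<Longrightarrow> \<exists>j\<in>F. ball i \<inter> ball j \<noteq> {} \<and> rad i \<le> 2 * rad j"
proof -
  define meets where "meets i F \<longleftrightarrow> (\<exists>j\<in>F. ball i \<inter> ball j \<noteq> {})" for i F
  define large where "large i F \<longleftrightarrow> (\<exists>j\<in>F. ball i \<inter> ball j \<noteq> {} \<and> rad i \<le> 2 * rad j)" for i F
  define A where "A = {F. F \<subseteq> I \<and> disjoint_family_on ball F \<and> (\<forall>i\<in>I. meets i F \<longrightarrow> large i F)}"
  have "\<exists>F\<in>A. \<forall>X\<in>A. F \<subseteq> X \<longrightarrow> X = F"
  proof (rule subset_Zorn)
    fix C assume C: "subset.chain A C"
    then have CA: "C \<subseteq> A" and lin: "\<And>X Y. X \<in> C \<Longrightarrow> Y \<in> C \<Longrightarrow> X \<subseteq> Y \<or> Y \<subseteq> X"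
      by (auto simp: subset_chain_def)
    have "\<Union>C \<in> A"
      unfolding A_def
    proof (intro CollectI conjI ballI impI)
      show "\<Union>C \<subseteq> I" using CA by (auto simp: A_def)
      show "disjoint_family_on ball (\<Union>C)"
        unfolding disjoint_family_on_def
      proof (intro ballI impI)
        fix i j assume "i \<in> \<Union>C" "j \<in> \<Union>C" "i \<noteq> j"
        then obtain X where "X \<in> C" "i \<in> X" "j \<in> X" using lin by blast
        then show "ball i \<inter> ball j = {}"
          using CA \<open>i \<noteq> j\<close> unfolding A_def disjoint_family_on_def by blast
      qed
      fix i assume "i \<in> I" "meets i (\<Union>C)"
      then show "large i (\<Union>C)"
        using CA unfolding A_def meets_def large_def by blast
    qed
    then show "\<exists>U\<in>A. \<forall>X\<in>C. X \<subseteq> U" by blast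
  qed
  then obtain F where F: "F \<in> A" and max: "\<And>X. X \<in> A \<Longrightarrow> F \<subseteq> X \<Longrightarrow> X = F" by blast
  have meet: "meets i F" if i: "i \<in> I" for i
  proof (rule ccontr)
    assume "\<not> meets i F"
    define G where "G = {i \<in> I. \<not> meets i F}"
    have G: "i \<in> G" using i \<open>\<not> meets i F\<close> by (simp add: G_def)
    have bdd: "bdd_above (rad ` G)" using rad by (auto simp: G_def intro!: bdd_aboveI[of _ R])
    have "0 < rad i" using rad i by blast
    also have "rad i \<le> Sup (rad ` G)" using G bdd by (simp add: cSup_upper)
    finally have "Sup (rad ` G) / 2 < Sup (rad ` G)" by simp
    then obtain k where k: "k \<in> G" "Sup (rad ` G) / 2 < rad k"
      using G bdd by (subst (asm) less_cSup_iff) auto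
    have "insert k F \<in> A"
      unfolding A_def
    proof (intro CollectI conjI ballI impI)
      show "insert k F \<subseteq> I" using F k by (auto simp: A_def G_def)
      show "disjoint_family_on ball (insert k F)"
        using F k unfolding A_def G_def meets_def disjoint_family_on_def by (auto simp: Int_commute)
      fix j assume j: "j \<in> I" "meets j (insert k F)"
      show "large j (insert k F)"
      proof (cases "meets j F")
        case True
        then show ?thesis using F j unfolding A_def large_def by blast
      next
        case False
        then have "j \<in> G" using j by (simp add: G_def)
        then have "rad j \<le> Sup (rad ` G)" using bdd by (simp add: cSup_upper)
        then have "rad j \<le> 2 * rad k" using k by simp
        then show ?thesis using j False unfolding meets_def large_def by auto
      qed
    qed
    then have "k \<in> F" using max by blast
    moreover have "ball k \<noteq> {}" using k ne by (simp add: G_def)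
    ultimately have "meets k F" by (auto simp: meets_def)
    then show False using k by (simp add: G_def)
  qed
  show thesis
  proof
    show "F \<subseteq> I" "disjoint_family_on ball F" using F by (auto simp: A_def)
    show "\<exists>j\<in>F. ball i \<inter> ball j \<noteq> {} \<and> rad i \<le> 2 * rad j" if "i \<in> I" for i
      using F meet[OF that] that unfolding A_def large_def by blast
  qed
qed

lemma self_in_kball: "r \<ge> 0 \<Longrightarrow> x \<in> kball r x"
  by (simp add: kball_def)

text \<open>
  Select disjoint balls from the fine cover of \<open>E\<close> by balls inside \<open>U\<close>. All but finitely many of them
  have small total mass, and only these have to be enlarged: a point outside the finitely many
  remaining balls, whose union is closed, is the centre of a small ball that avoids them and
  therefore meets one of the others. All centres stay in \<open>E\<close>, as the centred measure demands.
\<close>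

lemma vitali_cover:
  fixes \<mu> :: "'n::finite heis measure"
  assumes sets [measurable_cong]: "sets \<mu> = sets borel"
    and ball: "\<And>x r. x \<in> E \<Longrightarrow> r > 0 \<Longrightarrow> emeasure \<mu> (kball r x) = ennreal (r ^ m)"
    and U: "open U" "E \<subseteq> U" "emeasure \<mu> U < \<infinity>" and pos: "\<delta> > 0" "\<epsilon> > 0"
  obtains I :: "nat set" and x r where
    "E \<subseteq> (\<Union>j\<in>I. kball (r j) (x j))" "\<forall>j\<in>I. x j \<in> E \<and> 0 < r j \<and> r j \<le> \<delta>"
    "(\<Sum>\<^sub>\<infinity>j\<in>I. ennreal (r j ^ m)) \<le> emeasure \<mu> U + ennreal \<epsilon>"
proof -
  define \<B> where "\<B> = {(x, r). x \<in> E \<and> 0 < r \<and> r \<le> \<delta> / 3 \<and> kball r x \<subseteq> U}"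
  define ball where "ball = (\<lambda>(x :: 'n heis, r). kball r x)"
  have "0 < snd i \<and> snd i \<le> \<delta> / 3" "ball i \<noteq> {}" if "i \<in> \<B>" for i
    using that self_in_kball[of "snd i" "fst i"] by (auto simp: \<B>_def ball_def)
  then obtain F where F: "F \<subseteq> \<B>" and disj: "disjoint_family_on ball F"
    and sel: "\<And>i. i \<in> \<B> \<Longrightarrow> \<exists>j\<in>F. ball i \<inter> ball j \<noteq> {} \<and> snd i \<le> 2 * snd j"
    using vitali_selection[of \<B> snd "\<delta> / 3" ball] by metis
  define u where "u = enn2real (emeasure \<mu> U)"
  have u: "emeasure \<mu> U = ennreal u" using U(3) by (simp add: u_def ennreal_enn2real less_top)
  have u0: "u \<ge> 0" by (simp add: u_def)
  have mball: "emeasure \<mu> (ball i) = ennreal (snd i ^ m)" if "i \<in> F" for i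
    using that F ball unfolding \<B>_def ball_def by (auto split: prod.splits)
  have pF: "snd i > 0" if "i \<in> F" for i using that F by (auto simp: \<B>_def)
  have fin_sum: "(\<Sum>i\<in>G. snd i ^ m) \<le> u" if G: "finite G" "G \<subseteq> F" for G
  proof -
    have "ennreal (\<Sum>i\<in>G. snd i ^ m) = (\<Sum>i\<in>G. emeasure \<mu> (ball i))"
    proof -
      have "0 \<le> snd i ^ m" if "i \<in> G" for i using pF G that by (meson less_imp_le subsetD zero_le_power)
      then have "ennreal (\<Sum>i\<in>G. snd i ^ m) = (\<Sum>i\<in>G. ennreal (snd i ^ m))" by simp
      then show ?thesis using G mball by (auto intro!: sum.cong)
    qed
    also have "\<dots> = emeasure \<mu> (\<Union>i\<in>G. ball i)"
      using G by (intro sum_emeasure disjoint_family_on_mono[OF _ disj]) (auto simp: ball_def sets split: prod.splits)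
    also have "\<dots> \<le> emeasure \<mu> U"
      using G F U(1) by (intro emeasure_mono) (auto simp: sets ball_def \<B>_def split: prod.splits)
    finally show ?thesis using u0 by (simp add: u)
  qed
  \<comment> \<open>\<open>F0\<close> almost attains the supremum \<open>T\<close> of the finite sums, so the other balls are small in total.\<close>
  define T where "T = {(\<Sum>i\<in>G. snd i ^ m) | G. finite G \<and> G \<subseteq> F}"
  have T: "bdd_above T" "T \<noteq> {}"
    using fin_sum by (auto simp: T_def intro!: bdd_aboveI[of _ u])
  \<comment> \<open>Balls enlarged by the factor 3 gain at most \<open>3 ^ m\<close> in weight.\<close>
  define \<eta> where "\<eta> = \<epsilon> / 3 ^ m"
  have \<eta>: "\<eta> > 0" using pos by (simp add: \<eta>_def)
  then have "Sup T - \<eta> < Sup T" by simp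
  then obtain F0 where F0: "finite F0" "F0 \<subseteq> F" and F0sum: "Sup T - \<eta> < (\<Sum>i\<in>F0. snd i ^ m)"
    using T by (subst (asm) less_cSup_iff) (auto simp: T_def)
  have tail: "(\<Sum>i\<in>G. snd i ^ m) \<le> \<eta>" if G: "finite G" "G \<subseteq> F - F0" for G
  proof -
    have "(\<Sum>i\<in>F0. snd i ^ m) + (\<Sum>i\<in>G. snd i ^ m) = (\<Sum>i\<in>F0 \<union> G. snd i ^ m)"
      using F0 G by (intro sum.union_disjoint[symmetric]) auto
    also have "\<dots> \<le> Sup T" using F0 G by (intro cSup_upper T) (auto simp: T_def)
    finally show ?thesis using F0sum by linarith
  qed
  have cF: "countable F"
  proof -
    have "(\<lambda>i. snd i ^ m) summable_on F"
      using fin_sum pF by (intro nonneg_bdd_above_summable_on) (auto simp: less_imp_le intro!: bdd_aboveI[of _ u])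
    from summable_countable_real[OF this] show ?thesis
      by (rule countable_subset[rotated]) (use pF in force)
  qed
  define \<rho> where "\<rho> i = (if i \<in> F0 then snd i else 3 * snd i)" for i :: "'n heis \<times> real"
  define g where "g = from_nat_into F"
  define J where "J = to_nat_on F ` F"
  have gJ: "bij_betw g J F"
    unfolding g_def J_def using cF by (intro bij_betw_byWitness[where f'="to_nat_on F"]) auto
  show thesis
  proof (rule that[where I = J and r = "\<lambda>j. \<rho> (g j)" and x = "\<lambda>j. fst (g j)"])
    show "\<forall>j\<in>J. fst (g j) \<in> E \<and> 0 < \<rho> (g j) \<and> \<rho> (g j) \<le> \<delta>"
    proof
      fix j assume "j \<in> J"
      then have "g j \<in> F" using gJ by (auto simp: bij_betw_def)
      then have "g j \<in> \<B>" using F by blast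
      then show "fst (g j) \<in> E \<and> 0 < \<rho> (g j) \<and> \<rho> (g j) \<le> \<delta>" by (auto simp: \<B>_def \<rho>_def)
    qed
    have "E \<subseteq> (\<Union>i\<in>F. kball (\<rho> i) (fst i))"
    proof
      fix x assume x: "x \<in> E"
      define V where "V = U - (\<Union>i\<in>F0. ball i)"
      have V: "open V" unfolding V_def using F0 U(1)
        by (intro open_Diff closed_UN) (auto simp: ball_def closed_kball split: prod.splits)
      show "x \<in> (\<Union>i\<in>F. kball (\<rho> i) (fst i))"
      proof (cases "x \<in> V")
        case False
        then obtain i where "i \<in> F0" "x \<in> ball i" using x U(2) by (auto simp: V_def)
        then show ?thesis using F0 by (intro UN_I[of i]) (auto simp: \<rho>_def ball_def split: prod.splits)
      next
        case True
        then obtain s where s: "s > 0" "kball s x \<subseteq> V" using kball_subset_open[OF V] by blast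
        define r where "r = min s (\<delta> / 3)"
        have "kball r x \<subseteq> kball s x" by (auto simp: kball_def r_def)
        then have r: "kball r x \<subseteq> V" "r > 0" "r \<le> \<delta> / 3" using s pos by (auto simp: r_def)
        then have "(x, r) \<in> \<B>" using x by (auto simp: \<B>_def V_def)
        then obtain j where j: "j \<in> F" "ball (x, r) \<inter> ball j \<noteq> {}" "r \<le> 2 * snd j" using sel by fastforce
        have "j \<notin> F0" using j(2) r(1) by (auto simp: V_def ball_def)
        obtain z where z: "z \<in> kball r x" "z \<in> kball (snd j) (fst j)"
          using j(2) by (auto simp: ball_def split: prod.splits)
        have "koranyi_dist x (fst j) \<le> koranyi_dist x z + koranyi_dist z (fst j)"
          by (rule koranyi_dist_triangle)
        also have "\<dots> \<le> r + snd j" using z by (auto simp: kball_def koranyi_dist_commute)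
        finally have "x \<in> kball (3 * snd j) (fst j)" using j(3) by (simp add: kball_def)
        then show ?thesis using j(1) \<open>j \<notin> F0\<close> by (intro UN_I[of j]) (auto simp: \<rho>_def)
      qed
    qed
    also have "\<dots> = (\<Union>j\<in>J. kball (\<rho> (g j)) (fst (g j)))"
      using gJ by (auto simp: bij_betw_def)
    finally show "E \<subseteq> (\<Union>j\<in>J. kball (\<rho> (g j)) (fst (g j)))" .
    have "(\<Sum>\<^sub>\<infinity>j\<in>J. ennreal (\<rho> (g j) ^ m)) = (\<Sum>\<^sub>\<infinity>i\<in>F. ennreal (\<rho> i ^ m))"
      by (rule infsum_reindex_bij_betw[OF gJ])
    also have "\<dots> \<le> ennreal (u + \<epsilon>)"
    proof (rule infsum_le_finite_sums)
      show "(\<lambda>i. ennreal (\<rho> i ^ m)) summable_on F" by (rule nonneg_summable_on_complete) simp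
      fix G assume G: "finite G" "G \<subseteq> F"
      have "(\<Sum>i\<in>G. \<rho> i ^ m) = (\<Sum>i\<in>G \<inter> F0. snd i ^ m) + (\<Sum>i\<in>G - F0. 3 ^ m * snd i ^ m)"
        using G by (subst sum.Int_Diff[of G _ F0]) (auto simp: \<rho>_def power_mult_distrib intro!: arg_cong2[where f="(+)"] sum.cong)
      also have "\<dots> \<le> u + 3 ^ m * \<eta>"
        unfolding sum_distrib_left[symmetric] using G
        by (intro add_mono mult_left_mono fin_sum tail) auto
      also have "\<dots> = u + \<epsilon>" by (simp add: \<eta>_def)
      finally have *: "(\<Sum>i\<in>G. \<rho> i ^ m) \<le> u + \<epsilon>" .
      have "0 \<le> \<rho> i ^ m" if "i \<in> G" for i
        using pF[of i] G that by (auto simp: \<rho>_def intro!: zero_le_power)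
      then have "(\<Sum>i\<in>G. ennreal (\<rho> i ^ m)) = ennreal (\<Sum>i\<in>G. \<rho> i ^ m)" by simp
      also have "\<dots> \<le> ennreal (u + \<epsilon>)" using * by (rule ennreal_leI)
      finally show "(\<Sum>i\<in>G. ennreal (\<rho> i ^ m)) \<le> ennreal (u + \<epsilon>)" .
    qed
    also have "\<dots> = emeasure \<mu> U + ennreal \<epsilon>" using u0 pos by (simp add: u)
    finally show "(\<Sum>\<^sub>\<infinity>j\<in>J. ennreal (\<rho> (g j) ^ m)) \<le> emeasure \<mu> U + ennreal \<epsilon>" .
  qed
qed

lemma emeasure_le_centred_cover:
  fixes \<mu> :: "'n::finite heis measure" and I :: "nat set"
  assumes sets: "sets \<mu> = sets borel" and A: "A \<in> sets borel"
    and ball: "\<And>j. j \<in> I \<Longrightarrow> emeasure \<mu> (kball (r j) (x j)) = ennreal (r j ^ m)"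
    and cover: "A \<subseteq> (\<Union>j\<in>I. kball (r j) (x j))"
  shows "emeasure \<mu> A \<le> (\<Sum>\<^sub>\<infinity>j\<in>I. ennreal (r j ^ m))"
proof -
  have "emeasure \<mu> A \<le> emeasure \<mu> (\<Union>j. if j \<in> I then kball (r j) (x j) else {})"
    using cover A by (intro emeasure_mono) (auto simp: sets split: if_splits)
  also have "\<dots> \<le> (\<Sum>j. emeasure \<mu> (if j \<in> I then kball (r j) (x j) else {}))"
    by (intro emeasure_subadditive_countably) (auto simp: sets)
  also have "\<dots> = (\<Sum>j. if j \<in> I then ennreal (r j ^ m) else 0)"
    by (intro suminf_cong) (auto simp: ball)
  also have "\<dots> \<le> (\<Sum>\<^sub>\<infinity>j\<in>I. ennreal (r j ^ m))"
  proof (rule suminf_le_const)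
    fix n
    have "(\<Sum>j<n. if j \<in> I then ennreal (r j ^ m) else 0) = (\<Sum>j\<in>{..<n} \<inter> I. ennreal (r j ^ m))"
      by (subst sum.inter_restrict) auto
    also have "\<dots> \<le> (\<Sum>\<^sub>\<infinity>j\<in>I. ennreal (r j ^ m))"
      by (subst nonneg_infsum_complete) (auto intro!: SUP_upper)
    finally show "(\<Sum>j<n. if j \<in> I then ennreal (r j ^ m) else 0) \<le> (\<Sum>\<^sub>\<infinity>j\<in>I. ennreal (r j ^ m))" .
  qed auto
  finally show ?thesis .
qed

text \<open>
  Coverings by balls with centres in \<open>A\<close> have a total weight of at least the mass of \<open>A\<close>, and by
  \<open>vitali_cover\<close> this is optimal up to \<open>\<epsilon>\<close>. So a uniform measure is determined by its support, and
  two measures whose balls agree at the points of \<open>A\<close> agree on \<open>A\<close>.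
\<close>

lemma csph_eq_emeasure:
  fixes \<mu> :: "'n::finite heis measure"
  assumes sets: "sets \<mu> = sets borel" and A: "A \<in> sets borel"
    and ball: "\<And>x r. x \<in> A \<Longrightarrow> r > 0 \<Longrightarrow> emeasure \<mu> (kball r x) = ennreal (r ^ m)"
    and outer: "emeasure \<mu> A = (INF U\<in>{U. open U \<and> A \<subseteq> U}. emeasure \<mu> U)"
  shows "csph m A = emeasure \<mu> A"
proof (rule antisym)
  have "csph_pre m E \<le> emeasure \<mu> A" if E: "E \<subseteq> A" for E
    unfolding csph_pre_def
  proof (rule SUP_least)
    fix \<delta> :: real assume "\<delta> \<in> {0<..}"
    then have \<delta>: "\<delta> > 0" by simp
    let ?C = "{(\<Sum>\<^sub>\<infinity>j\<in>I. ennreal (r j ^ m)) | (I :: nat set) x r.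
      E \<subseteq> (\<Union>j\<in>I. kball (r j) (x j)) \<and> (\<forall>j\<in>I. x j \<in> E \<and> 0 < r j \<and> r j \<le> \<delta>)}"
    have cov: "Inf ?C \<le> emeasure \<mu> U" if U: "open U" "A \<subseteq> U" for U
    proof (cases "emeasure \<mu> U < \<infinity>")
      case True
      show ?thesis
      proof (rule ennreal_le_epsilon)
        fix \<epsilon> :: real assume \<epsilon>: "\<epsilon> > 0"
        obtain I :: "nat set" and x r where "E \<subseteq> (\<Union>j\<in>I. kball (r j) (x j))"
          "\<forall>j\<in>I. x j \<in> E \<and> 0 < r j \<and> r j \<le> \<delta>"
          and le: "(\<Sum>\<^sub>\<infinity>j\<in>I. ennreal (r j ^ m)) \<le> emeasure \<mu> U + ennreal \<epsilon>"
          by (rule vitali_cover[of \<mu> E m U \<delta> \<epsilon>]) (use sets ball E U True \<delta> \<epsilon> in auto)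
        then have "(\<Sum>\<^sub>\<infinity>j\<in>I. ennreal (r j ^ m)) \<in> ?C" by blast
        then show "Inf ?C \<le> emeasure \<mu> U + ennreal \<epsilon>" using le by (rule Inf_lower2)
      qed
    next
      case False
      then have "emeasure \<mu> U = \<infinity>" by (simp add: less_top[symmetric])
      then show ?thesis by simp
    qed
    show "Inf ?C \<le> emeasure \<mu> A"
      unfolding outer by (rule INF_greatest) (use cov in blast)
  qed
  then show "csph m A \<le> emeasure \<mu> A" unfolding csph_def by (auto intro!: SUP_least)
  have "emeasure \<mu> A \<le> csph_pre m A"
    unfolding csph_pre_def
  proof (rule SUP_upper2[where i=1])
    show "emeasure \<mu> A \<le> Inf {(\<Sum>\<^sub>\<infinity>j\<in>I. ennreal (r j ^ m)) | (I :: nat set) x r.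
      A \<subseteq> (\<Union>j\<in>I. kball (r j) (x j)) \<and> (\<forall>j\<in>I. x j \<in> A \<and> 0 < r j \<and> r j \<le> 1)}"
    proof (rule Inf_greatest)
      fix s assume "s \<in> {(\<Sum>\<^sub>\<infinity>j\<in>I. ennreal (r j ^ m)) | (I :: nat set) x r.
      A \<subseteq> (\<Union>j\<in>I. kball (r j) (x j)) \<and> (\<forall>j\<in>I. x j \<in> A \<and> 0 < r j \<and> r j \<le> 1)}"
      then obtain I :: "nat set" and x r where s: "s = (\<Sum>\<^sub>\<infinity>j\<in>I. ennreal (r j ^ m))"
        "A \<subseteq> (\<Union>j\<in>I. kball (r j) (x j))" "\<forall>j\<in>I. x j \<in> A \<and> 0 < r j \<and> r j \<le> 1" by blast
      show "emeasure \<mu> A \<le> s" unfolding s(1)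
        by (rule emeasure_le_centred_cover[OF sets A]) (use s ball in auto)
    qed
  qed simp
  also have "\<dots> \<le> csph m A" unfolding csph_def by (rule SUP_upper) simp
  finally show "emeasure \<mu> A \<le> csph m A" .
qed

section \<open>Laplace transforms of uniform measures\<close>

text \<open>
  Write \<open>exp (- h)\<close> as the integral of \<open>exp (- Y)\<close> over \<open>Y \<ge> h\<close>.
\<close>

lemma nn_integral_exp_layer_cake:
  assumes "sigma_finite_measure M"
    and [measurable]: "h \<in> borel_measurable M" "w \<in> borel_measurable M"
    and h: "\<And>z. z \<in> space M \<Longrightarrow> 0 \<le> (h z :: real)"
  shows "(\<integral>\<^sup>+z. w z * ennreal (exp (- h z)) \<partial>M)
    = (\<integral>\<^sup>+Y. ennreal (exp (- Y)) * indicator {0..} Y * (\<integral>\<^sup>+z. w z * indicator {z. h z \<le> Y} z \<partial>M) \<partial>lborel)"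
proof -
  interpret sigma_finite_measure M by fact
  interpret pair_sigma_finite M lborel ..
  have tail: "(\<integral>\<^sup>+Y. ennreal (exp (- Y)) * indicator {0..} Y * indicator {a..} Y \<partial>lborel) = ennreal (exp (- a))"
    if "a \<ge> 0" for a :: real
  proof -
    have "(\<integral>\<^sup>+Y. ennreal (exp (- Y)) * indicator {a..} Y \<partial>lborel) = ennreal (0 - (- exp (- a)))"
    proof (rule nn_integral_FTC_atLeast)
      show "((\<lambda>x. - exp (- x :: real)) \<longlongrightarrow> 0) at_top"
        by (rule tendsto_eq_intros filterlim_compose[OF exp_at_bot] filterlim_uminus_at_bot_at_top refl | simp)+
    qed (auto intro!: derivative_eq_intros)
    also have "(\<lambda>Y. ennreal (exp (- Y)) * indicator {a..} Y)
      = (\<lambda>Y. ennreal (exp (- Y)) * indicator {0..} Y * indicator {a..} Y)"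
      using that by (auto simp: indicator_def fun_eq_iff)
    finally show ?thesis by simp
  qed
  have "(\<integral>\<^sup>+z. w z * ennreal (exp (- h z)) \<partial>M)
    = (\<integral>\<^sup>+z. (\<integral>\<^sup>+Y. w z * (ennreal (exp (- Y)) * indicator {0..} Y * indicator {h z..} Y) \<partial>lborel) \<partial>M)"
    by (intro nn_integral_cong) (simp add: nn_integral_cmult tail h)
  also have "\<dots> = (\<integral>\<^sup>+z. (\<integral>\<^sup>+Y. (ennreal (exp (- Y)) * indicator {0..} Y) * (w z * indicator {p. h (fst p) \<le> snd p} (z, Y)) \<partial>lborel) \<partial>M)"
    by (intro nn_integral_cong) (auto simp: indicator_def mult_ac)
  also have "\<dots> = (\<integral>\<^sup>+Y. (\<integral>\<^sup>+z. (ennreal (exp (- Y)) * indicator {0..} Y) * (w z * indicator {p. h (fst p) \<le> snd p} (z, Y)) \<partial>M) \<partial>lborel)"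
    by (rule Fubini'[symmetric]) measurable
  also have "\<dots> = (\<integral>\<^sup>+Y. (ennreal (exp (- Y)) * indicator {0..} Y) * (\<integral>\<^sup>+z. w z * indicator {p. h (fst p) \<le> snd p} (z, Y) \<partial>M) \<partial>lborel)"
    by (intro nn_integral_cong nn_integral_cmult) measurable
  finally show ?thesis by (simp add: indicator_def)
qed

text \<open>
  The Laplace transform of a quantity with exactly polynomial growth along the sublevel sets of
  \<open>h\<close>.
\<close>

lemma nn_integral_exp_homogeneous:
  assumes sf: "sigma_finite_measure M"
    and meas [measurable]: "h \<in> borel_measurable M" "w \<in> borel_measurable M"
    and h: "\<And>z. z \<in> space M \<Longrightarrow> 0 \<le> (h z :: real)"
    and growth: "\<And>Y. Y > 0 \<Longrightarrow> (\<integral>\<^sup>+z. w z * indicator {z. h z \<le> Y} z \<partial>M) = c * ennreal (Y powr p)"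
    and p: "p > 0" and s: "s > 0"
  shows "(\<integral>\<^sup>+z. w z * ennreal (exp (- s * h z)) \<partial>M) = c * ennreal (Gamma (p + 1) * s powr (- p))"
proof -
  have "(\<integral>\<^sup>+z. w z * ennreal (exp (- s * h z)) \<partial>M)
    = (\<integral>\<^sup>+Y. ennreal (exp (- Y)) * indicator {0..} Y * (\<integral>\<^sup>+z. w z * indicator {z. s * h z \<le> Y} z \<partial>M) \<partial>lborel)"
    using nn_integral_exp_layer_cake[OF sf, of "\<lambda>z. s * h z" w] h s by simp
  also have "\<dots> = (\<integral>\<^sup>+Y. (c * ennreal (s powr (- p))) * ennreal (indicator {0..} Y * Y powr (p + 1 - 1) / exp Y) \<partial>lborel)"
  proof (intro nn_integral_cong_AE, use AE_lborel_singleton[of "0::real"] in eventually_elim)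
    fix Y :: real assume "Y \<noteq> 0"
    show "ennreal (exp (- Y)) * indicator {0..} Y * (\<integral>\<^sup>+z. w z * indicator {z. s * h z \<le> Y} z \<partial>M)
      = (c * ennreal (s powr (- p))) * ennreal (indicator {0..} Y * Y powr (p + 1 - 1) / exp Y)"
    proof (cases "Y > 0")
      case True
      have "{z. s * h z \<le> Y} = {z. h z \<le> Y / s}" using s by (auto simp: field_simps)
      then have "(\<integral>\<^sup>+z. w z * indicator {z. s * h z \<le> Y} z \<partial>M) = c * ennreal ((Y / s) powr p)"
        using growth[of "Y / s"] True s by simp
      also have "(Y / s) powr p = s powr (- p) * Y powr p"
        using True s by (simp add: powr_divide powr_minus field_simps)
      finally show ?thesis using True
        by (simp add: exp_minus ennreal_mult' mult_ac divide_inverse)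
    qed (use \<open>Y \<noteq> 0\<close> in auto)
  qed
  also have "\<dots> = (c * ennreal (s powr (- p))) * ennreal (Gamma (p + 1))"
    using p by (subst nn_integral_cmult) (auto simp: Gamma_conv_nn_integral_real)
  finally show ?thesis using Gamma_real_pos[of "p + 1"] p by (simp add: ennreal_mult mult_ac)
qed

lemma sigma_finite_of_kballs:
  fixes \<mu> :: "'n::finite heis measure"
  assumes sets: "sets \<mu> = sets borel" and fin: "\<And>r. r > 0 \<Longrightarrow> emeasure \<mu> (kball r x) < \<infinity>"
  shows "sigma_finite_measure \<mu>"
proof
  let ?A = "range (\<lambda>n. kball (real (Suc n)) x)"
  have "z \<in> \<Union>?A" for z
  proof -
    obtain n where "koranyi_dist z x \<le> real n" using real_arch_simple by blast
    then show ?thesis by (auto simp: kball_def intro!: exI[of _ n])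
  qed
  then show "\<exists>A. countable A \<and> A \<subseteq> sets \<mu> \<and> \<Union>A = space \<mu> \<and> (\<forall>a\<in>A. emeasure \<mu> a \<noteq> \<infinity>)"
    using fin sets_eq_imp_space_eq[OF sets] by (intro exI[of _ ?A]) (auto simp: sets less_top)
qed

lemma measurable_kdist4 [measurable]:
  "(\<lambda>z. kdist4 z x) \<in> borel_measurable borel" "(\<lambda>z. kdist4 x z) \<in> borel_measurable borel"
  by (intro borel_measurable_continuous_onI continuous_intros)+

lemma uniform_exp_integral:
  fixes \<mu> :: "'n::finite heis measure"
  assumes sets [measurable_cong]: "sets \<mu> = sets borel"
    and ball: "\<And>r. r > 0 \<Longrightarrow> emeasure \<mu> (kball r x) = ennreal (r ^ m)" and "m > 0" and s: "s > 0"
  shows "(\<integral>\<^sup>+z. ennreal (exp (- s * kdist4 z x)) \<partial>\<mu>) = ennreal (Gamma (m / 4 + 1) * s powr (- (m / 4)))"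
proof -
  have "sigma_finite_measure \<mu>" using ball by (intro sigma_finite_of_kballs[OF sets, of x]) auto
  have "(\<integral>\<^sup>+z. 1 * ennreal (exp (- s * kdist4 z x)) \<partial>\<mu>) = 1 * ennreal (Gamma (m / 4 + 1) * s powr (- (m / 4)))"
  proof (rule nn_integral_exp_homogeneous)
    fix Y :: real assume Y: "Y > 0"
    have "kball (Y powr (1/4)) x = {z. kdist4 z x \<le> Y}"
      using Y by (subst kball_kdist4) (auto simp: powr_powr simp flip: powr_realpow)
    then show "(\<integral>\<^sup>+z. 1 * indicator {z. kdist4 z x \<le> Y} z \<partial>\<mu>) = 1 * ennreal (Y powr (m / 4))"
      using ball[of "Y powr (1/4)"] Y
      by (simp add: sets powr_powr flip: powr_realpow)
  qed (use \<open>m > 0\<close> s in \<open>auto simp: kdist4_nonneg \<open>sigma_finite_measure \<mu>\<close>\<close>)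
  then show ?thesis by simp
qed

text \<open>
  A ball without mass around \<open>p\<close> makes the Laplace transform of the distance to \<open>p\<close> decay
  exponentially, so the power law of the previous lemma characterises the points of the support.
\<close>

lemma in_msupp_of_exp_integral:
  fixes \<mu> :: "'n::finite heis measure"
  assumes sets [measurable_cong]: "sets \<mu> = sets borel"
    and int: "\<And>s. s > 0 \<Longrightarrow> (\<integral>\<^sup>+z. ennreal (exp (- s * kdist4 z p)) \<partial>\<mu>) = ennreal (c * s powr (- q))"
    and c: "c > 0"
  shows "p \<in> msupp \<mu>"
proof (rule ccontr)
  assume "p \<notin> msupp \<mu>"
  then obtain U where U: "open U" "p \<in> U" "emeasure \<mu> U = 0" by (auto simp: msupp_def)
  then obtain \<rho> where \<rho>: "\<rho> > 0" "kball \<rho> p \<subseteq> U" using kball_subset_open by blast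
  have "AE z in \<mu>. z \<notin> U" using U by (intro AE_I'[of U]) (auto simp: null_sets_def sets)
  then have far: "AE z in \<mu>. \<rho> ^ 4 \<le> kdist4 z p"
    by eventually_elim (use \<rho> in \<open>force simp: kball_kdist4\<close>)
  have le: "c * s powr (- q) \<le> exp (- (s - 1) * \<rho> ^ 4) * c" if s: "s \<ge> 1" for s
  proof -
    have "ennreal (c * s powr (- q)) = (\<integral>\<^sup>+z. ennreal (exp (- s * kdist4 z p)) \<partial>\<mu>)"
      using int s by simp
    also have "\<dots> \<le> (\<integral>\<^sup>+z. ennreal (exp (- (s - 1) * \<rho> ^ 4)) * ennreal (exp (- 1 * kdist4 z p)) \<partial>\<mu>)"
    proof (intro nn_integral_mono_AE, use far in eventually_elim)
      fix z assume "\<rho> ^ 4 \<le> kdist4 z p"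
      then have "(s - 1) * \<rho> ^ 4 \<le> (s - 1) * kdist4 z p" using s by (intro mult_left_mono) auto
      then show "ennreal (exp (- s * kdist4 z p)) \<le> ennreal (exp (- (s - 1) * \<rho> ^ 4)) * ennreal (exp (- 1 * kdist4 z p))"
        by (simp add: algebra_simps flip: ennreal_mult' exp_add)
    qed
    also have "\<dots> = ennreal (exp (- (s - 1) * \<rho> ^ 4)) * ennreal (c * 1 powr (- q))"
      using int[of 1] by (subst nn_integral_cmult) auto
    finally show ?thesis using c by (simp flip: ennreal_mult')
  qed
  have "((\<lambda>s. exp (- (s - 1) * \<rho> ^ 4) * s powr q) \<longlongrightarrow> 0) at_top"
    using \<rho> by real_asymp
  then have "eventually (\<lambda>s. exp (- (s - 1) * \<rho> ^ 4) * s powr q < 1) at_top"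
    by (rule order_tendstoD) simp
  then have "eventually (\<lambda>s. exp (- (s - 1) * \<rho> ^ 4) * s powr q < 1 \<and> s \<ge> 1) at_top"
    using eventually_ge_at_top[of 1] by eventually_elim auto
  then obtain s where s: "exp (- (s - 1) * \<rho> ^ 4) * s powr q < 1" "s \<ge> 1"
    using eventually_happens by fastforce
  have "1 = s powr (- q) * s powr q" using s by (simp flip: powr_add)
  also have "\<dots> \<le> exp (- (s - 1) * \<rho> ^ 4) * s powr q"
    using le[OF s(2)] c by (intro mult_right_mono) (auto simp: mult.commute)
  finally show False using s by simp
qed

section \<open>Exponential moments\<close>

lemma exp_moments:
  fixes w h :: "'a \<Rightarrow> real"
  assumes [measurable]: "w \<in> borel_measurable M" "h \<in> borel_measurable M"
    and w: "\<And>z. w z \<ge> 0" and int: "integrable M (\<lambda>z. w z * exp (r * \<bar>h z\<bar>))" and t: "\<bar>t\<bar> \<le> r"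
  shows "t \<noteq> 0 \<Longrightarrow> integrable M (\<lambda>z. w z * h z ^ k)"
    and "(\<lambda>k. (\<integral>z. w z * h z ^ k \<partial>M) / fact k * t ^ k) sums (\<integral>z. w z * exp (t * h z) \<partial>M)"
proof -
  define f where "f k z = w z * ((t * h z) ^ k /\<^sub>R fact k)" for k z
  have fsum: "(\<lambda>k. f k z) sums (w z * exp (t * h z))" for z
    unfolding f_def by (intro sums_mult exp_converges)
  have nfsum: "(\<lambda>k. norm (f k z)) sums (w z * exp (\<bar>t * h z\<bar>))" for z
  proof -
    have "(\<lambda>k. w z * (\<bar>t * h z\<bar> ^ k /\<^sub>R fact k)) sums (w z * exp (\<bar>t * h z\<bar>))"
      by (intro sums_mult exp_converges)
    then show ?thesis using w by (simp add: f_def abs_mult power_abs)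
  qed
  have fm [measurable]: "f k \<in> borel_measurable M" for k unfolding f_def by measurable
  have bound: "w z * exp (\<bar>t * h z\<bar>) \<le> w z * exp (r * \<bar>h z\<bar>)" for z
    using w t by (intro mult_left_mono) (auto simp: abs_mult mult_right_mono)
  have psum: "(\<Sum>k<n. norm (f k z)) \<le> w z * exp (r * \<bar>h z\<bar>)" for n z
    using sum_le_suminf[of "\<lambda>k. norm (f k z)" "{..<n}"] nfsum[of z] bound[of z]
    by (auto simp: sums_iff)
  have fint: "integrable M (f k)" for k
  proof (rule Bochner_Integration.integrable_bound[OF int])
    have "norm (f k z) \<le> w z * exp (r * \<bar>h z\<bar>)" for z
    proof -
      have "norm (f k z) \<le> (\<Sum>j<Suc k. norm (f j z))" by (simp add: sum_nonneg)
      then show ?thesis using psum[of z "Suc k"] by linarith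
    qed
    then show "AE z in M. norm (f k z) \<le> norm (w z * exp (r * \<bar>h z\<bar>))"
      using w by (auto simp: abs_mult intro: order_trans)
  qed simp
  show "integrable M (\<lambda>z. w z * h z ^ k)" if "t \<noteq> 0"
  proof -
    have "(\<lambda>z. w z * h z ^ k) = (\<lambda>z. (fact k / t ^ k) * f k z)"
      using that by (auto simp: f_def power_mult_distrib field_simps)
    then show ?thesis using fint[of k] by (metis integrable_mult_right)
  qed
  have summ: "summable (\<lambda>k. \<integral>z. norm (f k z) \<partial>M)"
  proof (rule summableI_nonneg_bounded)
    fix n
    have "(\<Sum>k<n. \<integral>z. norm (f k z) \<partial>M) = (\<integral>z. (\<Sum>k<n. norm (f k z)) \<partial>M)"
      using fint by (subst Bochner_Integration.integral_sum) auto
    also have "\<dots> \<le> (\<integral>z. w z * exp (r * \<bar>h z\<bar>) \<partial>M)"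
      using fint by (intro integral_mono int psum Bochner_Integration.integrable_sum) auto
    finally show "(\<Sum>k<n. \<integral>z. norm (f k z) \<partial>M) \<le> (\<integral>z. w z * exp (r * \<bar>h z\<bar>) \<partial>M)" .
  qed auto
  have "(\<lambda>k. integral\<^sup>L M (f k)) sums (\<integral>z. (\<Sum>k. f k z) \<partial>M)"
    using fint summ nfsum by (intro sums_integral) (auto simp: sums_iff)
  moreover have "(\<Sum>k. f k z) = w z * exp (t * h z)" for z using fsum[of z] by (simp add: sums_iff)
  moreover have "integral\<^sup>L M (f k) = (\<integral>z. w z * h z ^ k \<partial>M) / fact k * t ^ k" for k
  proof -
    have "f k = (\<lambda>z. (t ^ k / fact k) * (w z * h z ^ k))"
      by (auto simp: f_def power_mult_distrib field_simps)
    then show ?thesis by (simp only: integral_mult_right_zero) simp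
  qed
  ultimately show "(\<lambda>k. (\<integral>z. w z * h z ^ k \<partial>M) / fact k * t ^ k) sums (\<integral>z. w z * exp (t * h z) \<partial>M)"
    by simp
qed

text \<open>
  The zeros of a power series that is not identically zero do not accumulate at the centre.
\<close>

lemma powser_eq_coeff:
  fixes a b :: "nat \<Rightarrow> real"
  assumes r: "r > 0"
    and a: "\<And>t. \<bar>t\<bar> < r \<Longrightarrow> (\<lambda>n. a n * t ^ n) sums f t"
    and b: "\<And>t. \<bar>t\<bar> < r \<Longrightarrow> (\<lambda>n. b n * t ^ n) sums g t"
    and acc: "\<And>e. e > 0 \<Longrightarrow> \<exists>t. t \<noteq> 0 \<and> \<bar>t\<bar> < e \<and> f t = g t"
  shows "a = b"
proof -
  define D where "D t = f t - g t" for t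
  have D: "(\<lambda>n. (a n - b n) * t ^ n) sums D t" if "\<bar>t\<bar> < r" for t
    using sums_diff[OF a b] that by (simp add: D_def left_diff_distrib)
  have acc': "\<exists>t. t \<noteq> 0 \<and> \<bar>t\<bar> < e \<and> D t = 0" if "e > 0" for e
    using acc[OF that] by (auto simp: D_def)
  have lim: "(D \<longlongrightarrow> a 0 - b 0) (at 0)"
    using powser_limit_0[of r "\<lambda>n. a n - b n" D] D r by auto
  have 0: "a 0 = b 0"
  proof (rule ccontr)
    assume "a 0 \<noteq> b 0"
    then have "eventually (\<lambda>t. D t \<noteq> 0) (at 0)"
      using tendsto_imp_eventually_ne[OF lim, of 0] by simp
    then obtain e where "e > 0" "\<And>t. t \<noteq> 0 \<Longrightarrow> \<bar>t\<bar> < e \<Longrightarrow> D t \<noteq> 0"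
      by (auto simp: eventually_at dist_real_def)
    then show False using acc' by blast
  qed
  show ?thesis
  proof (rule ccontr)
    assume "a \<noteq> b"
    then obtain m where m: "a m \<noteq> b m" by auto
    then have "m > 0" using 0 by (cases m) auto
    have D0: "D 0 = 0" using D[of 0] r 0 by (auto simp: sums_iff)
    obtain e where e: "0 < e" "\<And>z. z \<in> cball 0 e - {0} \<Longrightarrow> D z \<noteq> 0"
      by (rule powser_0_nonzero[of r 0 "\<lambda>n. a n - b n" D m]) (use r D D0 m \<open>m > 0\<close> in auto)
    then show False using acc'[of e] by (auto simp: dist_norm)
  qed
qed

lemma exp_square_powser:
  fixes s t :: real
  shows "(\<lambda>n. (if even n then s ^ (n div 2) / fact (n div 2) else 0) * t ^ n) sums exp (s * t\<^sup>2)"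
proof -
  have "(\<lambda>n. (s * t\<^sup>2) ^ n /\<^sub>R fact n) sums exp (s * t\<^sup>2)" by (rule exp_converges)
  then have "(\<lambda>n. (if even (2*n) then s ^ (2*n div 2) / fact (2*n div 2) else 0) * t ^ (2*n)) sums exp (s * t\<^sup>2)"
    by (simp add: power_mult_distrib field_simps flip: power_mult)
  then show ?thesis
    by (subst (asm) sums_mono_reindex[where g="\<lambda>n. 2 * n"]) (auto simp: strict_mono_def elim!: evenE)
qed

text \<open>
  The analyticity argument: an exponential transform that agrees with a Gaussian along a sequence
  tending to 0 is this Gaussian, and the moments of even order can be read off.
\<close>

lemma gaussian_transform:
  fixes w h :: "'a \<Rightarrow> real"
  assumes meas [measurable]: "w \<in> borel_measurable M" "h \<in> borel_measurable M"
    and w: "\<And>z. w z \<ge> 0" and int: "\<And>t. integrable M (\<lambda>z. w z * exp (t * h z))"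
    and acc: "\<And>e. e > 0 \<Longrightarrow> \<exists>t. t \<noteq> 0 \<and> \<bar>t\<bar> < e \<and> (\<integral>z. w z * exp (t * h z) \<partial>M) = c * exp (s * t\<^sup>2)"
  shows "(\<integral>z. w z * exp (t * h z) \<partial>M) = c * exp (s * t\<^sup>2)"
    and "(\<integral>z. w z * h z ^ k \<partial>M) = (if even k then c * s ^ (k div 2) * fact k / fact (k div 2) else 0)"
    and "integrable M (\<lambda>z. w z * h z ^ k)"
proof -
  have int': "integrable M (\<lambda>z. w z * exp (r * \<bar>h z\<bar>))" for r
  proof (rule Bochner_Integration.integrable_bound[OF Bochner_Integration.integrable_add[OF int[of r] int[of "- r"]]])
    show "AE z in M. norm (w z * exp (r * \<bar>h z\<bar>)) \<le> norm (w z * exp (r * h z) + w z * exp (- r * h z))"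
    proof (rule AE_I2)
      fix z
      have "exp (r * \<bar>h z\<bar>) \<le> exp (r * h z) + exp (- r * h z)" by (cases "h z \<ge> 0") auto
      then have "w z * exp (r * \<bar>h z\<bar>) \<le> w z * (exp (r * h z) + exp (- r * h z))"
        using w by (rule mult_left_mono)
      then show "norm (w z * exp (r * \<bar>h z\<bar>)) \<le> norm (w z * exp (r * h z) + w z * exp (- r * h z))"
        using w[of z] by (simp add: distrib_left abs_mult)
    qed
  qed simp
  let ?b = "\<lambda>n. c * (if even n then s ^ (n div 2) / fact (n div 2) else 0)"
  let ?a = "\<lambda>k. (\<integral>z. w z * h z ^ k \<partial>M) / fact k"
  have A: "(\<lambda>k. ?a k * t ^ k) sums (\<integral>z. w z * exp (t * h z) \<partial>M)" for t
    by (rule exp_moments(2)[OF meas w int' order_refl])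
  have B: "(\<lambda>k. ?b k * t ^ k) sums (c * exp (s * t\<^sup>2))" for t
    using sums_mult[OF exp_square_powser[of s t], of c] by (simp only: mult.assoc)
  have ab: "?a = ?b" by (rule powser_eq_coeff[OF zero_less_one A B acc])
  have ab': "?a k = ?b k" for k using ab by (rule fun_cong)
  have eq: "(\<lambda>k. ?a k * t ^ k) = (\<lambda>k. ?b k * t ^ k)" by (rule ext) (simp only: ab')
  show "(\<integral>z. w z * exp (t * h z) \<partial>M) = c * exp (s * t\<^sup>2)"
    by (rule sums_unique2[OF A[of t, unfolded eq] B[of t]])
  then show "(\<integral>z. w z * h z ^ k \<partial>M) = (if even k then c * s ^ (k div 2) * fact k / fact (k div 2) else 0)"
    using ab'[of k] by (auto simp: field_simps split: if_splits)
  show "integrable M (\<lambda>z. w z * h z ^ k)"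
    by (rule exp_moments(1)[OF meas w int'[of 1], of 1]) auto
qed

section \<open>Ball volumes\<close>

lemma square_le_interval: "0 \<le> b \<Longrightarrow> {t. (t - c)\<^sup>2 \<le> b} = {c - sqrt b .. c + sqrt b}" for b c :: real
proof (rule set_eqI)
  fix t
  assume "0 \<le> b"
  have "(t - c)\<^sup>2 \<le> b \<longleftrightarrow> \<bar>t - c\<bar> \<le> sqrt b"
    using real_sqrt_le_iff[of "(t - c)\<^sup>2" b] by (simp only: real_sqrt_abs)
  then show "t \<in> {t. (t - c)\<^sup>2 \<le> b} \<longleftrightarrow> t \<in> {c - sqrt b .. c + sqrt b}"
    unfolding mem_Collect_eq atLeastAtMost_iff by (simp only: abs_le_iff) linarith
qed

lemma fibre_length_scale:
  fixes r a :: real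
  shows "2 * sqrt (max 0 (r ^ 4 - (r * a) ^ 4)) = r\<^sup>2 * (2 * sqrt (max 0 (1 - a ^ 4)))"
proof -
  have "max 0 (r ^ 4 - (r * a) ^ 4) = r ^ 4 * max 0 (1 - a ^ 4)"
  proof (cases "a ^ 4 \<le> 1")
    case True
    then have "r ^ 4 * a ^ 4 \<le> r ^ 4" by (intro mult_left_le) auto
    then show ?thesis using True by (simp add: power_mult_distrib max_def algebra_simps)
  next
    case False
    then have "r ^ 4 * 1 \<le> r ^ 4 * a ^ 4" by (intro mult_left_mono) auto
    then show ?thesis using False by (simp add: power_mult_distrib max_def algebra_simps)
  qed
  moreover have "sqrt (r ^ 4) = r\<^sup>2" by (rule real_sqrt_unique) (auto simp flip: power_mult)
  ultimately show ?thesis by (simp add: real_sqrt_mult)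
qed

text \<open>
  The vertical fibre of a ball is an interval; the symplectic form moves its midpoint but does not
  affect its length. This is why integration over vertical lines makes the geometry Euclidean.
\<close>

lemma emeasure_kball_fibre:
  assumes "r > 0"
  shows "emeasure lborel {t. (y, t) \<in> kball r p} = ennreal (2 * sqrt (max 0 (r ^ 4 - norm (y - fst p) ^ 4)))"
proof -
  define c where "c = snd p + 2 * (fst p \<bullet> (symplJ *v y))"
  define b where "b = r ^ 4 - norm (y - fst p) ^ 4"
  have eq: "{t. (y, t) \<in> kball r p} = {t. (t - c)\<^sup>2 \<le> b}"
    using assms by (auto simp: kball_kdist4 kdist4_def c_def b_def algebra_simps)
  show ?thesis
  proof (cases "b \<ge> 0")
    case True
    then show ?thesis unfolding eq square_le_interval[OF True] by (simp add: b_def[symmetric])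
  next
    case False
    then have "{t. (t - c)\<^sup>2 \<le> b} = {}" by (auto simp: not_le) (meson less_le_trans zero_le_power2 not_le)
    then show ?thesis using False unfolding eq by (simp add: b_def[symmetric] max_def)
  qed
qed

lemma emeasure_kball_pair:
  fixes \<nu> :: "(real ^ ('n::finite + 'n)) measure"
  assumes [measurable_cong]: "sets \<nu> = sets borel" and r: "r > 0"
  shows "emeasure (\<nu> \<Otimes>\<^sub>M lborel) (kball r p) = (\<integral>\<^sup>+y. ennreal (2 * sqrt (max 0 (r ^ 4 - norm (y - fst p) ^ 4))) \<partial>\<nu>)"
proof -
  have "sets (\<nu> \<Otimes>\<^sub>M (lborel :: real measure)) = sets (borel \<Otimes>\<^sub>M borel)"
    by (intro sets_pair_measure_cong assms) simp
  then have "kball r p \<in> sets (\<nu> \<Otimes>\<^sub>M lborel)" unfolding borel_prod using kball_borel by blast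
  then have "emeasure (\<nu> \<Otimes>\<^sub>M lborel) (kball r p) = (\<integral>\<^sup>+y. emeasure lborel (Pair y -` kball r p) \<partial>\<nu>)"
    by (rule lborel.emeasure_pair_measure_alt)
  moreover have "Pair y -` kball r p = {t. (y, t) \<in> kball r p}" for y by auto
  ultimately show ?thesis by (simp add: emeasure_kball_fibre[OF r])
qed

text \<open>
  By the fibre formula this is a Euclidean integral, to which translation and scaling apply.
\<close>

lemma lborel_kball:
  fixes p :: "'n::finite heis"
  assumes r: "r > 0"
  shows "emeasure lborel (kball r p) = ennreal (r ^ (2 * CARD('n) + 2)) * emeasure lborel (kball 1 (0 :: 'n heis))"
proof -
  let ?g = "\<lambda>(r::real) (a::real). ennreal (2 * sqrt (max 0 (r ^ 4 - a ^ 4)))"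
  have dim: "DIM(real ^ ('n + 'n)) = 2 * CARD('n)" by simp
  have "(\<integral>\<^sup>+y. ?g r (norm (y - fst p)) \<partial>lborel)
    = (\<integral>\<^sup>+y. ennreal (r ^ (2 * CARD('n))) * ?g r (norm ((fst p + r *\<^sub>R y) - fst p)) \<partial>lborel)"
    using r by (subst lborel_affine[of r "fst p"]) (simp_all add: nn_integral_density nn_integral_distr flip: mult_2)
  also have "\<dots> = (\<integral>\<^sup>+y. ennreal (r ^ (2 * CARD('n) + 2)) * ?g 1 (norm (y - fst (0 :: 'n heis))) \<partial>lborel)"
  proof (rule nn_integral_cong)
    fix y :: "real ^ ('n + 'n)"
    note fibre_length_scale[of r "norm y"]
    then show "ennreal (r ^ (2 * CARD('n))) * ?g r (norm ((fst p + r *\<^sub>R y) - fst p))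
      = ennreal (r ^ (2 * CARD('n) + 2)) * ?g 1 (norm (y - fst (0 :: 'n heis)))"
      using r by (simp add: power_add flip: ennreal_mult') (simp add: mult_ac power2_eq_square)
  qed
  also have "\<dots> = ennreal (r ^ (2 * CARD('n) + 2)) * (\<integral>\<^sup>+y. ?g 1 (norm (y - fst (0 :: 'n heis))) \<partial>lborel)"
    by (rule nn_integral_cmult) measurable
  finally show ?thesis
    unfolding lborel_prod[symmetric] using r by (simp add: emeasure_kball_pair)
qed

lemma kball_contains_ball:
  obtains e where "e > 0" "ball 0 e \<subseteq> kball 1 (0 :: 'n::finite heis)"
proof -
  have "open {z. koranyi_dist z (0 :: 'n heis) < 1}" by (rule open_koranyi_dist_less)
  moreover have "0 \<in> {z. koranyi_dist z (0 :: 'n heis) < 1}" by simp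
  ultimately obtain e where "e > 0" "ball 0 e \<subseteq> {z. koranyi_dist z (0 :: 'n heis) < 1}"
    by (meson openE)
  moreover have "{z. koranyi_dist z (0 :: 'n heis) < 1} \<subseteq> kball 1 0" by (auto simp: kball_def)
  ultimately show thesis using that by blast
qed

lemma lborel_kball_unit:
  obtains c where "c > 0" "emeasure lborel (kball 1 (0 :: 'n::finite heis)) = ennreal c"
proof -
  have fin: "emeasure lborel (kball 1 (0 :: 'n heis)) < \<infinity>"
    by (intro emeasure_bounded_finite compact_imp_bounded compact_kball)
  obtain e where e: "e > 0" "ball 0 e \<subseteq> kball 1 (0 :: 'n heis)" by (rule kball_contains_ball)
  have "0 < emeasure lborel (ball (0 :: 'n heis) e)"
    using content_ball_pos[OF e(1), of "0 :: 'n heis"] by (auto simp: measure_def enn2real_positive_iff)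
  also have "\<dots> \<le> emeasure lborel (kball 1 (0 :: 'n heis))" using e by (intro emeasure_mono) auto
  finally have "0 < enn2real (emeasure lborel (kball 1 (0 :: 'n heis)))"
    using fin by (simp add: enn2real_positive_iff)
  then show thesis
    by (rule that) (use fin in \<open>simp add: less_top\<close>)
qed

section \<open>Vertical fibres of the support\<close>

text \<open>
  The distances to \<open>p\<close> and to \<open>q\<close> differ by at most the constant \<open>koranyi_dist p q\<close>, so it suffices
  that the balls around the single point \<open>q\<close> have finite mass.
\<close>

lemma integrable_exp_kdist4:
  fixes \<mu> :: "'n::finite heis measure"
  assumes sets [measurable_cong]: "sets \<mu> = sets borel"
    and ball: "\<And>r. r > 0 \<Longrightarrow> emeasure \<mu> (kball r q) = ennreal (r ^ m)" and "m > 0" and s: "s > 0"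
  shows "integrable \<mu> (\<lambda>z. exp (- s * kdist4 z p))"
proof (rule Bochner_Integration.integrable_bound)
  let ?D = "koranyi_dist p q"
  have "integrable \<mu> (\<lambda>z. exp (- (s / 8) * kdist4 z q))"
    using uniform_exp_integral[OF sets ball \<open>m > 0\<close>, of "s / 8"] s
    by (intro integrableI_nonneg) auto
  then show "integrable \<mu> (\<lambda>z. exp (s * ?D ^ 4) * exp (- (s / 8) * kdist4 z q))"
    by (rule integrable_mult_right)
  show "AE z in \<mu>. norm (exp (- s * kdist4 z p)) \<le> norm (exp (s * ?D ^ 4) * exp (- (s / 8) * kdist4 z q))"
  proof (rule AE_I2)
    fix z
    let ?a = "koranyi_dist z p"
    have convex: "(a + b) ^ 4 \<le> 8 * (a ^ 4 + b ^ 4)" for a b :: real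
    proof -
      have "8 * (a ^ 4 + b ^ 4) - (a + b) ^ 4 = (a - b)\<^sup>2 * (7 * a\<^sup>2 + 10 * a * b + 7 * b\<^sup>2)" by algebra
      also have "7 * a\<^sup>2 + 10 * a * b + 7 * b\<^sup>2 = 2 * a\<^sup>2 + 2 * b\<^sup>2 + 5 * (a + b)\<^sup>2" by algebra
      finally show ?thesis by (smt (verit) zero_le_power2 mult_nonneg_nonneg)
    qed
    have "kdist4 z q = koranyi_dist z q ^ 4" by (simp add: koranyi_dist_power4)
    also have "\<dots> \<le> (?a + ?D) ^ 4" by (intro power_mono koranyi_dist_triangle) simp
    also have "\<dots> \<le> 8 * (?a ^ 4 + ?D ^ 4)" by (rule convex)
    finally have "s * (kdist4 z q / 8) \<le> s * (kdist4 z p + ?D ^ 4)"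
      using s by (intro mult_left_mono) (auto simp: koranyi_dist_power4)
    then show "norm (exp (- s * kdist4 z p)) \<le> norm (exp (s * ?D ^ 4) * exp (- (s / 8) * kdist4 z q))"
      by (simp add: algebra_simps flip: exp_add)
  qed
qed simp

lemma uniform_measureD:
  assumes "uniform_measure m \<mu>"
  shows "sets \<mu> = sets borel" "0 \<in> msupp \<mu>"
    "x \<in> msupp \<mu> \<Longrightarrow> r > 0 \<Longrightarrow> emeasure \<mu> (kball r x) = ennreal (r ^ m)"
    "A \<in> sets borel \<Longrightarrow> emeasure \<mu> A = (INF U\<in>{U. open U \<and> A \<subseteq> U}. emeasure \<mu> U)"
  using assms unfolding uniform_measure_def radon_measure_def by blast+

lemma closed_msupp: "closed (msupp \<mu>)"
proof -
  have "- msupp \<mu> = \<Union>{U. open U \<and> emeasure \<mu> U = 0}" by (auto simp: msupp_def)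
  then show ?thesis unfolding closed_def by (metis (mono_tags, lifting) mem_Collect_eq open_Union)
qed

lemma emeasure_compl_msupp:
  fixes \<mu> :: "'a::second_countable_topology measure"
  assumes "sets \<mu> = sets borel"
  shows "emeasure \<mu> (- msupp \<mu>) = 0"
proof -
  define \<U> where "\<U> = {U. open U \<and> emeasure \<mu> U = 0}"
  have eq: "- msupp \<mu> = \<Union>\<U>" by (auto simp: msupp_def \<U>_def)
  obtain \<V> where V: "\<V> \<subseteq> \<U>" "countable \<V>" "\<Union>\<V> = \<Union>\<U>"
    using Lindelof[of \<U>] by (auto simp: \<U>_def)
  have "\<Union>(id ` \<V>) \<in> null_sets \<mu>"
    using V assms by (intro null_sets_UN') (auto simp: \<U>_def null_sets_def)
  then show ?thesis using V eq by auto
qed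

lemma emeasure_Int_msupp:
  fixes \<mu> :: "'a::second_countable_topology measure"
  assumes sets: "sets \<mu> = sets borel" and A: "A \<in> sets borel"
  shows "emeasure \<mu> (A \<inter> msupp \<mu>) = emeasure \<mu> A"
proof (rule antisym)
  have S: "msupp \<mu> \<in> sets borel" by (simp add: closed_msupp)
  have "emeasure \<mu> A \<le> emeasure \<mu> ((A \<inter> msupp \<mu>) \<union> - msupp \<mu>)"
    using A S by (intro emeasure_mono) (auto simp: sets)
  also have "\<dots> \<le> emeasure \<mu> (A \<inter> msupp \<mu>) + emeasure \<mu> (- msupp \<mu>)"
    using A S by (intro emeasure_subadditive) (auto simp: sets)
  finally show "emeasure \<mu> A \<le> emeasure \<mu> (A \<inter> msupp \<mu>)"
    using emeasure_compl_msupp[OF sets] by simp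
  show "emeasure \<mu> (A \<inter> msupp \<mu>) \<le> emeasure \<mu> A" using A by (intro emeasure_mono) (auto simp: sets)
qed

lemma measurable_fst_heis [measurable]: "(fst :: 'n::finite heis \<Rightarrow> _) \<in> borel_measurable borel"
  "(snd :: 'n::finite heis \<Rightarrow> _) \<in> borel_measurable borel"
  by (intro borel_measurable_continuous_onI continuous_intros)+

text \<open>
  In terms of \<open>h(z)\<close>, the height of \<open>z\<close> relative to \<open>(x, t0)\<close>, the fourth power of the distance to
  \<open>(x, t0 + t)\<close> is \<open>|z\<^sub>H - x|\<^sup>4 + h(z)\<^sup>2 + t\<^sup>2 - 2 t h(z)\<close>. So its Laplace transform times \<open>exp (s t\<^sup>2)\<close> is
  an exponential transform in \<open>t\<close>, which uniformity makes a Gaussian along a sequence tending to 0,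
  hence for all \<open>t\<close>. Then \<open>in_msupp_of_exp_integral\<close> applies to every point of the line.
\<close>

lemma fibre_full_of_accumulation:
  fixes \<mu> :: "'n::finite heis measure"
  assumes \<mu>: "uniform_measure m \<mu>" and m: "m > 0"
    and acc: "\<And>e. e > 0 \<Longrightarrow> \<exists>t. t \<noteq> 0 \<and> \<bar>t\<bar> < e \<and> (x, t0 + t) \<in> msupp \<mu>"
  shows "(x, t1) \<in> msupp \<mu>"
proof -
  note sets [measurable_cong] = uniform_measureD(1)[OF \<mu>]
  note ball = uniform_measureD(3)[OF \<mu>]
  define h where "h z = snd z - t0 - 2 * (x \<bullet> (symplJ *v fst z))" for z :: "'n heis"
  have hm [measurable]: "h \<in> borel_measurable borel"
    unfolding h_def by (intro borel_measurable_continuous_onI continuous_intros)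
  have kd: "kdist4 z (x, t0 + t) = (norm (fst z - x) ^ 4 + (h z)\<^sup>2) + (t\<^sup>2 - 2 * t * h z)" for z t
    unfolding kdist4_def h_def by (simp add: power2_eq_square algebra_simps)
  have main: "(\<integral>\<^sup>+z. ennreal (exp (- s * kdist4 z (x, t1))) \<partial>\<mu>) = ennreal (Gamma (m / 4 + 1) * s powr (- (m / 4)))"
    if s: "s > 0" for s
  proof -
    define w where "w z = exp (- s * (norm (fst z - x) ^ 4 + (h z)\<^sup>2))" for z
    have wm [measurable]: "w \<in> borel_measurable borel" unfolding w_def by measurable
    have wexp: "w z * exp (t * (2 * s * h z)) = exp (s * t\<^sup>2) * exp (- s * kdist4 z (x, t0 + t))" for z t
      unfolding w_def kd by (simp add: algebra_simps flip: exp_add)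
    have int: "integrable \<mu> (\<lambda>z. exp (- s * kdist4 z p))" for p
      using integrable_exp_kdist4[OF sets ball m s] uniform_measureD(2)[OF \<mu>] by blast
    let ?c = "Gamma (m / 4 + 1) * s powr (- (m / 4))"
    have c: "?c \<ge> 0" by (simp add: Gamma_real_nonneg)
    have "(\<integral>z. w z * exp ((t1 - t0) * (2 * s * h z)) \<partial>\<mu>) = ?c * exp (s * (t1 - t0)\<^sup>2)"
    proof (rule gaussian_transform(1))
      show "integrable \<mu> (\<lambda>z. w z * exp (t * (2 * s * h z)))" for t
        unfolding wexp using int by simp
      fix e :: real assume "e > 0"
      then obtain t where t: "t \<noteq> 0" "\<bar>t\<bar> < e" "(x, t0 + t) \<in> msupp \<mu>" using acc by blast
      have "(\<integral>\<^sup>+z. ennreal (exp (- s * kdist4 z (x, t0 + t))) \<partial>\<mu>) = ennreal ?c"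
        by (rule uniform_exp_integral[OF sets ball[OF t(3)] m s])
      then have "(\<integral>z. exp (- s * kdist4 z (x, t0 + t)) \<partial>\<mu>) = ?c"
        using c int by (subst (asm) nn_integral_eq_integral) auto
      then show "\<exists>t. t \<noteq> 0 \<and> \<bar>t\<bar> < e \<and> (\<integral>z. w z * exp (t * (2 * s * h z)) \<partial>\<mu>) = ?c * exp (s * t\<^sup>2)"
        using t unfolding wexp by (intro exI[of _ t]) simp
    qed (auto simp: w_def)
    then have "(\<integral>z. exp (- s * kdist4 z (x, t1)) \<partial>\<mu>) = ?c"
      unfolding wexp by simp
    then show ?thesis using int by (subst nn_integral_eq_integral) auto
  qed
  show ?thesis
    by (rule in_msupp_of_exp_integral[OF sets main]) (simp_all add: Gamma_real_pos)
qed

section \<open>Null sets transversal to a direction\<close>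

lemma compact_translates:
  fixes A :: "'n::finite heis set"
  assumes "compact A"
  shows "compact {(x + s *\<^sub>R v, t) | x s t. (x, t) \<in> A \<and> 0 \<le> s \<and> s \<le> s0}"
proof -
  have "{(x + s *\<^sub>R v, t) | x s t. (x, t) \<in> A \<and> 0 \<le> s \<and> s \<le> s0} = (\<lambda>(p, s). p + s *\<^sub>R (v, 0)) ` (A \<times> {0..s0})"
    by (force simp: image_iff)
  then show ?thesis
    using assms by (auto intro!: compact_continuous_image compact_Times continuous_intros simp: case_prod_beta)
qed

text \<open>
  Cover \<open>A\<close> by balls of radius \<open>2 r\<close> around \<open>j\<close> points such that the balls of radius \<open>r\<close> are disjoint. The
  function \<open>f\<close> vanishes on \<open>A\<close> but grows linearly along \<open>v\<close>, so the translates of these \<open>j\<close> balls by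
  multiples of \<open>K r v\<close> are still disjoint. There are about \<open>s0 / (K r)\<close> admissible multiples, and all
  the translates lie close to the set swept out by \<open>A\<close>. Hence \<open>j r\<^bsup>2n+1\<^esup>\<close>, which bounds the mass of
  \<open>A\<close>, is at most a constant times the volume of a small neighbourhood of the swept set.
\<close>

lemma null_of_transversal:
  fixes \<mu> :: "'n::finite heis measure" and f :: "real ^ ('n + 'n) \<Rightarrow> real"
  assumes \<mu>: "uniform_measure (2 * CARD('n) + 1) \<mu>" and A: "compact A" "A \<subseteq> msupp \<mu>"
    and f0: "\<And>x t. (x, t) \<in> A \<Longrightarrow> f x = 0"
    and trans: "\<And>x t s. (x, t) \<in> A \<Longrightarrow> \<bar>s\<bar> \<le> s0 \<Longrightarrow> \<epsilon> * \<bar>s\<bar> \<le> \<bar>f (x + s *\<^sub>R v)\<bar>"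
    and pos: "\<epsilon> > 0" "s0 > 0"
    and lip: "\<And>\<rho>. \<exists>L. \<forall>y\<in>cball 0 \<rho>. \<forall>y'\<in>cball 0 \<rho>. \<bar>f y - f y'\<bar> \<le> L * norm (y - y')"
    and null: "emeasure lborel {(x + s *\<^sub>R v, t) | x s t. (x, t) \<in> A \<and> 0 \<le> s \<and> s \<le> s0} = 0"
  shows "emeasure \<mu> A = 0"
proof -
  note sets [measurable_cong] = uniform_measureD(1)[OF \<mu>]
  note ball = uniform_measureD(3)[OF \<mu>]
  define T where "T = {(x + s *\<^sub>R v, t) | x s t. (x, t) \<in> A \<and> 0 \<le> s \<and> s \<le> s0}"
  let ?m = "2 * CARD('n) + 1"
  have T: "compact T" unfolding T_def by (rule compact_translates[OF A(1)])
  obtain R where R: "\<And>p. p \<in> A \<Longrightarrow> norm p \<le> R" using A compact_imp_bounded bounded_iff by metis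
  define \<rho> where "\<rho> = \<bar>R\<bar> + s0 * norm v"
  obtain L0 where L0: "\<And>y y'. y \<in> cball 0 \<rho> \<Longrightarrow> y' \<in> cball 0 \<rho> \<Longrightarrow> \<bar>f y - f y'\<bar> \<le> L0 * norm (y - y')"
    using lip[of \<rho>] by blast
  define L where "L = max 0 L0"
  have L: "L \<ge> 0" "\<And>y y'. y \<in> cball 0 \<rho> \<Longrightarrow> y' \<in> cball 0 \<rho> \<Longrightarrow> \<bar>f y - f y'\<bar> \<le> L * norm (y - y')"
  proof -
    fix y y' :: "real ^ ('n + 'n)" assume "y \<in> cball 0 \<rho>" "y' \<in> cball 0 \<rho>"
    then have "\<bar>f y - f y'\<bar> \<le> L0 * norm (y - y')" by (rule L0)
    also have "\<dots> \<le> L * norm (y - y')" by (rule mult_right_mono) (auto simp: L_def)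
    finally show "\<bar>f y - f y'\<bar> \<le> L * norm (y - y')" .
  qed (simp add: L_def)
  \<comment> \<open>This makes \<open>\<epsilon> K r\<close>, the least growth of \<open>f\<close> over one step \<open>K r v\<close>, exceed \<open>2 r L\<close>, the largest
    value that \<open>f\<close> can have at distance \<open>2 r\<close> from its zeros on \<open>A\<close>.\<close>
  define K where "K = 2 * L / \<epsilon> + 1"
  have K: "K > 0" "2 * L < \<epsilon> * K" using L(1) pos by (auto simp: K_def field_simps add_nonneg_pos)
  obtain c0 where c0: "c0 > 0" "emeasure lborel (kball 1 (0 :: 'n heis)) = ennreal c0"
    by (rule lborel_kball_unit)
  \<comment> \<open>For \<open>r \<le> 1\<close>, Koranyi balls of radius \<open>r\<close> at points of \<open>A\<close> have Euclidean radius at most \<open>C1 r\<close>.\<close>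
  define C1 where "C1 = 2 + 2 * \<bar>R\<bar>"
  have C1: "C1 > 0" by (simp add: C1_def)
  have key: "emeasure \<mu> A \<le> ennreal (2 ^ ?m * K / (s0 * c0) * \<delta>)" if \<delta>: "\<delta> > 0" for \<delta>
  proof -
    obtain U where U: "open U" "T \<subseteq> U" "emeasure lborel U < ennreal \<delta>"
    proof -
      obtain U where "open U" "T \<subseteq> U" "emeasure lborel U \<le> emeasure lborel T + ennreal (\<delta> / 2)"
      proof -
        have "T \<in> sets lebesgue" using T by (simp add: lmeasurable_compact fmeasurableD)
        then obtain U where "open U" "T \<subseteq> U" "U - T \<in> lmeasurable" "emeasure lebesgue (U - T) < ennreal (\<delta> / 2)"
          using \<delta> sets_lebesgue_outer_open[of T "\<delta> / 2"] by (metis half_gt_zero)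
        moreover have "emeasure lebesgue U \<le> emeasure lebesgue T + emeasure lebesgue (U - T)"
        proof -
          have "emeasure lebesgue U \<le> emeasure lebesgue (T \<union> (U - T))"
            using \<open>T \<in> sets lebesgue\<close> \<open>U - T \<in> lmeasurable\<close> fmeasurableD by (intro emeasure_mono sets.Un) blast+
          also have "\<dots> \<le> emeasure lebesgue T + emeasure lebesgue (U - T)"
            using \<open>T \<in> sets lebesgue\<close> \<open>U - T \<in> lmeasurable\<close> by (intro emeasure_subadditive) auto
          finally show ?thesis .
        qed
        moreover have "emeasure lebesgue U = emeasure lborel U" "emeasure lebesgue T = emeasure lborel T"
          using \<open>open U\<close> T by (auto intro!: emeasure_completion simp: borel_compact)
        ultimately have "emeasure lborel U \<le> emeasure lborel T + emeasure lebesgue (U - T)" by metis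
        also have "\<dots> \<le> emeasure lborel T + ennreal (\<delta> / 2)"
          using \<open>emeasure lebesgue (U - T) < ennreal (\<delta> / 2)\<close> by (intro add_left_mono less_imp_le)
        finally show thesis using that \<open>open U\<close> \<open>T \<subseteq> U\<close> by blast
      qed
      moreover have "ennreal (\<delta> / 2) < ennreal \<delta>" using \<delta> by (simp add: ennreal_less_iff)
      ultimately show thesis using that null unfolding T_def by fastforce
    qed
    obtain \<eta> where \<eta>: "\<eta> > 0" "(\<Union>x\<in>T. ball x \<eta>) \<subseteq> U"
      using compact_subset_open_imp_ball_epsilon_subset[OF T U(1,2)] by blast
    define r where "r = min 1 (\<eta> / (2 * C1))"
    have r: "0 < r" "r \<le> 1" "C1 * r < \<eta>"
    proof -
      have "r \<le> \<eta> / (2 * C1)" by (simp add: r_def)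
      then have "C1 * r \<le> \<eta> / 2" using C1 by (simp add: field_simps)
      then show "C1 * r < \<eta>" using \<eta> by simp
    qed (use \<eta> C1 in \<open>auto simp: r_def\<close>)
    \<comment> \<open>The number of translates: the last one is still a translate by at most \<open>s0 v\<close>.\<close>
    define k where "k = nat \<lfloor>s0 / (K * r)\<rfloor> + 1"
    have k: "s0 / (K * r) \<le> real k" "\<And>l. l < k \<Longrightarrow> real l * (K * r) \<le> s0"
    proof -
      have nn: "0 \<le> s0 / (K * r)" using pos K r by simp
      show "s0 / (K * r) \<le> real k" unfolding k_def using nn by (simp add: nat_add_distrib) linarith
      fix l assume "l < k"
      then have "real l \<le> s0 / (K * r)" unfolding k_def using nn by (simp add: less_Suc_eq_le le_nat_floor) linarith
      then show "real l * (K * r) \<le> s0" using K r by (simp add: field_simps)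
    qed
    obtain F where F: "F \<subseteq> A" and disj: "disjoint_family_on (kball r) F"
      and cov: "\<And>p. p \<in> A \<Longrightarrow> \<exists>q\<in>F. kball r p \<inter> kball r q \<noteq> {} \<and> r \<le> 2 * r"
      using vitali_selection[of A "\<lambda>_. r" r "kball r"] r self_in_kball[of r] by (metis empty_iff less_imp_le order_refl)
    define B where "B = (\<lambda>(p, l). (+) (- (real l * (K * r)) *\<^sub>R v, 0) -` kball r p)"
    have Bmem: "z \<in> B (p, l) \<longleftrightarrow> (fst z - (real l * (K * r)) *\<^sub>R v, snd z) \<in> kball r p" for z p l
      by (cases z) (simp add: B_def)
    have Bsets: "B i \<in> sets lborel" for i
      unfolding B_def by (cases i) (auto intro!: measurable_sets_borel[OF _ kball_borel])
    have Bvol: "emeasure lborel (B i) = ennreal (r ^ (?m + 1) * c0)" for i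
    proof (cases i)
      case (Pair p l)
      have "emeasure lborel (kball r p) = emeasure (distr lborel borel ((+) (- (real l * (K * r)) *\<^sub>R v, 0))) (kball r p)"
        by (simp only: lborel_distr_plus)
      also have "\<dots> = emeasure lborel (B i)" by (subst emeasure_distr) (auto simp: B_def Pair)
      finally show ?thesis using lborel_kball[OF r(1), of p] r c0 by (simp add: ennreal_mult')
    qed
    have BU: "B (p, l) \<subseteq> U" if "p \<in> A" "l < k" for p l
    proof
      fix z assume "z \<in> B (p, l)"
      then have "(fst z - (real l * (K * r)) *\<^sub>R v, snd z) \<in> kball r p" by (simp add: Bmem)
      then have "dist (fst z - (real l * (K * r)) *\<^sub>R v, snd z) p \<le> r + r\<^sup>2 + 2 * norm p * r"
        by (rule kball_dist) (use r in simp)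
      also have "\<dots> \<le> C1 * r"
      proof -
        have "r\<^sup>2 \<le> r" using r by (simp add: power2_eq_square mult_left_le_one_le)
        moreover have "2 * norm p * r \<le> 2 * \<bar>R\<bar> * r" using R[OF that(1)] r by (intro mult_right_mono) auto
        ultimately show ?thesis unfolding C1_def by (simp add: algebra_simps)
      qed
      finally have "dist (fst z - (real l * (K * r)) *\<^sub>R v, snd z) p < \<eta>" using r by simp
      moreover have "(fst z - (real l * (K * r)) *\<^sub>R v, snd z) - p = z - (fst p + (real l * (K * r)) *\<^sub>R v, snd p)"
        by (simp add: prod_eq_iff algebra_simps)
      ultimately have "dist (fst p + (real l * (K * r)) *\<^sub>R v, snd p) z < \<eta>"
        by (metis dist_commute dist_norm)
      moreover have "(fst p + (real l * (K * r)) *\<^sub>R v, snd p) \<in> T"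
        unfolding T_def using that k(2)[of l] r K by (cases p) force
      ultimately show "z \<in> U" using \<eta>(2) by (meson UN_I mem_ball subsetD)
    qed
    have Bdisj: "disjoint_family_on B (F \<times> {..<k})"
      unfolding disjoint_family_on_def
    proof (intro ballI impI)
      fix i j assume i: "i \<in> F \<times> {..<k}" and j: "j \<in> F \<times> {..<k}" and ij: "i \<noteq> j"
      obtain p l where pl: "i = (p, l)" by (cases i)
      obtain q l' where ql: "j = (q, l')" by (cases j)
      show "B i \<inter> B j = {}"
      proof (rule ccontr)
        assume "B i \<inter> B j \<noteq> {}"
        then obtain z where z: "(fst z - (real l * (K * r)) *\<^sub>R v, snd z) \<in> kball r p"
          "(fst z - (real l' * (K * r)) *\<^sub>R v, snd z) \<in> kball r q"
          using Bmem pl ql by blast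
        show False
        proof (cases "l = l'")
          case True
          then have "p \<noteq> q" using ij pl ql by simp
          then show False using disj i j pl ql z True unfolding disjoint_family_on_def by blast
        next
          case False
          define \<sigma> where "\<sigma> = (real l - real l') * (K * r)"
          define y where "y = fst p + \<sigma> *\<^sub>R v"
          have pA: "p \<in> A" "q \<in> A" using i j pl ql F by auto
          have n1: "norm (fst z - (real l * (K * r)) *\<^sub>R v - fst p) \<le> r"
            and n2: "norm (fst z - (real l' * (K * r)) *\<^sub>R v - fst q) \<le> r"
            using kball_components(1)[OF z(1)] kball_components(1)[OF z(2)] r by auto
          have eqy: "y - fst q = (fst z - (real l' * (K * r)) *\<^sub>R v - fst q) - (fst z - (real l * (K * r)) *\<^sub>R v - fst p)"
            unfolding y_def \<sigma>_def by (simp add: algebra_simps)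
          have near: "norm (y - fst q) \<le> 2 * r"
            unfolding eqy using n1 n2 norm_triangle_ineq4[of "fst z - (real l' * (K * r)) *\<^sub>R v - fst q" "fst z - (real l * (K * r)) *\<^sub>R v - fst p"]
            by linarith
          have "1 \<le> \<bar>real l - real l'\<bar>" using False by linarith
          then have \<sigma>1: "K * r \<le> \<bar>\<sigma>\<bar>" using K r by (simp add: \<sigma>_def abs_mult)
          have "\<bar>\<sigma>\<bar> \<le> s0"
          proof -
            have "real l * (K * r) \<le> s0" "real l' * (K * r) \<le> s0" using k(2) i j pl ql by auto
            moreover have "0 \<le> real l * (K * r)" "0 \<le> real l' * (K * r)" using K r by auto
            ultimately show ?thesis unfolding \<sigma>_def left_diff_distrib by linarith
          qed
          moreover have "(fst p, snd p) \<in> A" "(fst q, snd q) \<in> A" using pA by auto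
          ultimately have "\<epsilon> * \<bar>\<sigma>\<bar> \<le> \<bar>f y\<bar>" "f (fst q) = 0" unfolding y_def using trans f0 by blast+
          moreover have "norm (fst p) \<le> \<bar>R\<bar>" "norm (fst q) \<le> \<bar>R\<bar>"
            using R[OF pA(1)] R[OF pA(2)] norm_fst_le[of "fst p" "snd p"] norm_fst_le[of "fst q" "snd q"] by auto
          moreover have "norm y \<le> norm (fst p) + s0 * norm v"
            unfolding y_def using \<open>\<bar>\<sigma>\<bar> \<le> s0\<close> norm_triangle_ineq[of "fst p" "\<sigma> *\<^sub>R v"]
              mult_right_mono[OF \<open>\<bar>\<sigma>\<bar> \<le> s0\<close>, of "norm v"] by simp
          moreover have "0 \<le> s0 * norm v" using pos by simp
          ultimately have "\<epsilon> * \<bar>\<sigma>\<bar> \<le> L * norm (y - fst q)"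
            using L(2)[of y "fst q"] by (simp add: \<rho>_def)
          also have "\<dots> \<le> L * (2 * r)" using near L(1) by (rule mult_left_mono)
          finally have "\<epsilon> * \<bar>\<sigma>\<bar> \<le> L * (2 * r)" .
          moreover have "\<epsilon> * (K * r) \<le> \<epsilon> * \<bar>\<sigma>\<bar>" using \<sigma>1 pos by (intro mult_left_mono) auto
          ultimately have "\<epsilon> * (K * r) \<le> 2 * L * r" by simp
          then have "\<epsilon> * K \<le> 2 * L" using r by simp
          then show False using K by simp
        qed
      qed
    qed
    have count: "real (card G) * real k * (r ^ (?m + 1) * c0) \<le> \<delta>" if G: "finite G" "G \<subseteq> F" for G
    proof -
      have "ennreal (real (card G) * real k * (r ^ (?m + 1) * c0)) = (\<Sum>i\<in>G \<times> {..<k}. emeasure lborel (B i))"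
        using r c0 by (simp add: Bvol card_cartesian_product ennreal_mult' ennreal_of_nat_eq_real_of_nat)
      also have "\<dots> = emeasure lborel (\<Union>i\<in>G \<times> {..<k}. B i)"
        using G Bsets by (intro sum_emeasure disjoint_family_on_mono[OF _ Bdisj]) auto
      also have "\<dots> \<le> emeasure lborel U"
      proof (rule emeasure_mono)
        show "\<Union> (B ` (G \<times> {..<k})) \<subseteq> U" using BU G F by fastforce
      qed (use U in simp)
      also have "\<dots> \<le> ennreal \<delta>" using U by simp
      finally show ?thesis using \<delta> by simp
    qed
    have kpos: "real k > 0" by (simp add: k_def)
    have "finite F"
    proof (rule ccontr)
      assume "infinite F"
      define N where "N = nat \<lceil>\<delta> / (real k * (r ^ (?m + 1) * c0))\<rceil> + 1"
      obtain G where G: "G \<subseteq> F" "finite G" "card G = N"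
        using \<open>infinite F\<close> infinite_arbitrarily_large by blast
      have p: "real k * (r ^ (?m + 1) * c0) > 0" using kpos r c0 by simp
      have "\<delta> / (real k * (r ^ (?m + 1) * c0)) < real N" unfolding N_def by linarith
      then have "\<delta> < real N * (real k * (r ^ (?m + 1) * c0))" using p by (simp add: pos_divide_less_eq)
      then show False using count[OF G(2,1)] G(3) by (simp add: mult.assoc)
    qed
    have "A \<subseteq> (\<Union>q\<in>F. kball (2 * r) q)"
    proof
      fix p assume "p \<in> A"
      then obtain q z where q: "q \<in> F" "z \<in> kball r p" "z \<in> kball r q" using cov by blast
      have "koranyi_dist p q \<le> koranyi_dist p z + koranyi_dist z q" by (rule koranyi_dist_triangle)
      then have "p \<in> kball (2 * r) q" using q by (auto simp: kball_def koranyi_dist_commute)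
      then show "p \<in> (\<Union>q\<in>F. kball (2 * r) q)" using q by blast
    qed
    then have "emeasure \<mu> A \<le> emeasure \<mu> (\<Union>q\<in>F. kball (2 * r) q)"
      using \<open>finite F\<close> by (intro emeasure_mono) (auto simp: sets)
    also have "\<dots> \<le> (\<Sum>q\<in>F. emeasure \<mu> (kball (2 * r) q))"
      using \<open>finite F\<close> by (intro emeasure_subadditive_finite) (auto simp: sets)
    also have "\<dots> = (\<Sum>q\<in>F. ennreal ((2 * r) ^ ?m))"
      using F A r by (intro sum.cong ball) auto
    also have "\<dots> = ennreal (real (card F) * (2 * r) ^ ?m)"
      using r by (simp add: ennreal_mult' ennreal_of_nat_eq_real_of_nat)
    also have "\<dots> \<le> ennreal (2 ^ ?m * K / (s0 * c0) * \<delta>)"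
    proof (rule ennreal_leI)
      have "real (card F) * (s0 / (K * r)) * (r ^ (?m + 1) * c0) \<le> real (card F) * real k * (r ^ (?m + 1) * c0)"
        using k(1) r c0 by (intro mult_right_mono mult_left_mono) auto
      also have "\<dots> \<le> \<delta>" using count \<open>finite F\<close> by blast
      finally have "real (card F) * (s0 / K) * r ^ ?m * c0 \<le> \<delta>" using r by (simp add: field_simps)
      then have "real (card F) * r ^ ?m \<le> K / (s0 * c0) * \<delta>" using K pos c0 by (simp add: field_simps)
      then have "2 ^ ?m * (real (card F) * r ^ ?m) \<le> 2 ^ ?m * (K / (s0 * c0) * \<delta>)" by (intro mult_left_mono) auto
      then show "real (card F) * (2 * r) ^ ?m \<le> 2 ^ ?m * K / (s0 * c0) * \<delta>" by (simp add: power_mult_distrib mult_ac)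
    qed
    finally show ?thesis .
  qed
  have le_eps: "emeasure \<mu> A \<le> 0 + ennreal e" if "e > 0" for e
  proof -
    define P where "P = 2 ^ ?m * K / (s0 * c0)"
    have p: "P > 0" using K pos c0 by (simp add: P_def)
    have "e / P > 0" using p that by simp
    then have "emeasure \<mu> A \<le> ennreal (P * (e / P))" unfolding P_def by (rule key)
    also have "P * (e / P) = e" using p by simp
    finally show ?thesis by simp
  qed
  have "emeasure \<mu> A \<le> 0" by (rule ennreal_le_epsilon, rule le_eps)
  then show ?thesis by simp
qed

section \<open>Vertical invariance of the support\<close>

text \<open>
  An infinite bounded fibre has an accumulation point.
\<close>

lemma finite_fibre_of_compact:
  fixes A S :: "('a::metric_space \<times> real) set"
  assumes A: "compact A" "A \<subseteq> S"
    and isol: "\<And>t0. \<exists>e>0. \<forall>t. t \<noteq> 0 \<longrightarrow> \<bar>t\<bar> < e \<longrightarrow> (x, t0 + t) \<notin> S"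
  shows "finite {t. (x, t) \<in> A}"
proof (rule ccontr)
  assume inf: "infinite {t. (x, t) \<in> A}"
  have "bounded (snd ` A)" by (intro compact_imp_bounded compact_continuous_image continuous_intros A)
  then have "bounded {t. (x, t) \<in> A}" by (rule bounded_subset) force
  then obtain t0 where t0: "t0 islimpt {t. (x, t) \<in> A}"
    using inf bounded_infinite_imp_islimpt[of UNIV] by (metis Bolzano_Weierstrass_imp_closed bounded_closure closed_closure closure_subset compact_closure compact_eq_Bolzano_Weierstrass)
  obtain e where e: "e > 0" "\<And>t. t \<noteq> 0 \<Longrightarrow> \<bar>t\<bar> < e \<Longrightarrow> (x, t0 + t) \<notin> S" using isol by blast
  obtain t where "(x, t) \<in> A" "t \<noteq> t0" "dist t t0 < e"
    using t0 e(1) unfolding islimpt_approachable by auto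
  then show False using e(2)[of "t - t0"] A(2) by (auto simp: dist_real_def)
qed

lemma quad_shift:
  fixes Q :: "real ^ 'k ^ 'k"
  assumes "transpose Q = Q"
  shows "(x + s *\<^sub>R v) \<bullet> (Q *v (x + s *\<^sub>R v)) = x \<bullet> (Q *v x) + 2 * s * ((Q *v x) \<bullet> v) + s\<^sup>2 * (v \<bullet> (Q *v v))"
proof -
  have "x \<bullet> (Q *v v) = (Q *v x) \<bullet> v"
    using assms by (metis dot_lmul_matrix transpose_matrix_vector)
  then show ?thesis
    by (simp add: matrix_vector_right_distrib matrix_vector_mult_scaleR inner_add_left inner_add_right
        inner_commute power2_eq_square algebra_simps)
qed

lemma quad_lipschitz:
  fixes Q :: "real ^ 'k ^ 'k"
  assumes "transpose Q = Q"
  shows "\<exists>L. \<forall>y\<in>cball 0 \<rho>. \<forall>y'\<in>cball 0 \<rho>. \<bar>y \<bullet> (Q *v y) - y' \<bullet> (Q *v y')\<bar> \<le> L * norm (y - y')"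
proof -
  obtain B where B: "\<And>x. norm (Q *v x) \<le> B * norm x"
    using linear_bounded[OF matrix_vector_mul_linear[of Q]] by blast
  have "\<bar>y \<bullet> (Q *v y) - y' \<bullet> (Q *v y')\<bar> \<le> (\<bar>B\<bar> * (2 * \<bar>\<rho>\<bar>)) * norm (y - y')"
    if "norm y \<le> \<rho>" "norm y' \<le> \<rho>" for y y'
  proof -
    have s: "y \<bullet> (Q *v y') = y' \<bullet> (Q *v y)"
      using assms by (metis dot_lmul_matrix transpose_matrix_vector inner_commute)
    have "y \<bullet> (Q *v y) - y' \<bullet> (Q *v y') = (y - y') \<bullet> (Q *v (y + y'))"
      by (simp add: matrix_vector_right_distrib inner_diff_left inner_add_right s)
    then have 1: "\<bar>y \<bullet> (Q *v y) - y' \<bullet> (Q *v y')\<bar> \<le> norm (y - y') * norm (Q *v (y + y'))"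
      by (simp add: Cauchy_Schwarz_ineq2)
    have 2: "norm (y - y') * norm (Q *v (y + y')) \<le> norm (y - y') * (\<bar>B\<bar> * (2 * \<bar>\<rho>\<bar>))"
    proof (rule mult_left_mono)
      show "norm (Q *v (y + y')) \<le> \<bar>B\<bar> * (2 * \<bar>\<rho>\<bar>)"
    proof -
      have "norm (Q *v (y + y')) \<le> B * norm (y + y')" by (rule B)
      also have "\<dots> \<le> \<bar>B\<bar> * norm (y + y')" by (intro mult_right_mono) auto
      also have "\<dots> \<le> \<bar>B\<bar> * (2 * \<bar>\<rho>\<bar>)"
        using that norm_triangle_ineq[of y y'] by (intro mult_left_mono) auto
      finally show ?thesis .
    qed
    qed simp
    show ?thesis using order_trans[OF 1 2] by (simp only: mult.commute)
  qed
  then show ?thesis by (intro exI[of _ "\<bar>B\<bar> * (2 * \<bar>\<rho>\<bar>)"]) auto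
qed

lemma emeasure_lborel_finite_fibres:
  fixes T :: "'n::finite heis set"
  assumes T: "T \<in> sets borel" and fin: "\<And>y. finite {t. (y, t) \<in> T}"
  shows "emeasure lborel T = 0"
proof -
  have "emeasure (lborel \<Otimes>\<^sub>M lborel) T = (\<integral>\<^sup>+y. emeasure lborel (Pair y -` T) \<partial>lborel)"
  proof (rule lborel.emeasure_pair_measure_alt)
    show "T \<in> sets (lborel \<Otimes>\<^sub>M lborel)" unfolding lborel_prod using T by simp
  qed
  also have "\<dots> = (\<integral>\<^sup>+y. 0 \<partial>(lborel :: (real ^ ('n + 'n)) measure))"
  proof (rule nn_integral_cong)
    fix y
    have "Pair y -` T = {t. (y, t) \<in> T}" by auto
    then show "emeasure lborel (Pair y -` T) = 0" using fin[of y]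
      by (simp add: emeasure_lborel_countable countable_finite)
  qed
  finally show ?thesis by (simp add: lborel_prod)
qed

text \<open>
  A symmetric matrix of rank one is a multiple of \<open>a \<otimes> a\<close>.
\<close>

lemma symmetric_rank_one_zero:
  fixes Q :: "real ^ 'k ^ 'k"
  assumes sym: "transpose Q = Q" and Q: "Q \<noteq> 0" and rows: "\<And>x. Q *v x = (a \<bullet> x) *\<^sub>R c"
    and x: "x \<bullet> (Q *v x) = 0"
  shows "a \<bullet> x = 0"
proof (rule ccontr)
  assume a: "a \<bullet> x \<noteq> 0"
  have "x \<bullet> c = 0" using x a by (simp add: rows)
  have "c \<bullet> y = 0" for y
  proof -
    have "y \<bullet> (Q *v x) = x \<bullet> (Q *v y)"
      using sym by (metis dot_lmul_matrix transpose_matrix_vector inner_commute)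
    then have "(a \<bullet> x) * (y \<bullet> c) = (a \<bullet> y) * (x \<bullet> c)" by (simp add: rows)
    then show ?thesis using a \<open>x \<bullet> c = 0\<close> by (simp add: inner_commute)
  qed
  then have "c = 0" using inner_eq_zero_iff by blast
  then have "Q *v y = 0 *v y" for y by (simp add: rows)
  then show False using Q by (metis matrix_eq)
qed

text \<open>
  If the line over \<open>x0\<close> is not contained in the support, the fibres over all nearby points are
  discrete. The part of the support near \<open>(x0, t0)\<close> is decomposed into compact pieces: those on which
  the \<open>i\<close>-th component of the gradient of the quadratic form is bounded below, which are transversal
  to the \<open>i\<close>-th coordinate direction, and the singular piece \<open>W\<close> over the kernel of \<open>Q\<close>. Since the
  support is not contained in a hyperplane, \<open>Q\<close> has rank at least two; the kernel is then
  transversal to some direction in which it sweeps out no more than a hyperplane. So all the pieces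
  are null sets, which contradicts the definition of the support.
\<close>

lemma msupp_vertical_dichotomy:
  fixes \<mu> :: "'n::finite heis measure"
  assumes \<mu>: "uniform_measure (2 * CARD('n) + 1) \<mu>"
    and Q: "Q \<noteq> 0" "transpose Q = Q" and supp: "\<And>p. p \<in> msupp \<mu> \<Longrightarrow> fst p \<bullet> (Q *v fst p) = 0"
    and plane: "\<not> (\<exists>\<nn>. \<nn> \<noteq> 0 \<and> msupp \<mu> \<subseteq> vplane \<nn>)"
    and p: "(x0, t0) \<in> msupp \<mu>"
  shows "(x0, t1) \<in> msupp \<mu>"
proof (rule ccontr)
  assume t1: "(x0, t1) \<notin> msupp \<mu>"
  let ?S = "msupp \<mu>"
  have isol: "\<exists>e>0. \<forall>t. t \<noteq> 0 \<longrightarrow> \<bar>t\<bar> < e \<longrightarrow> (x, t' + t) \<notin> ?S" if "(x, t2) \<notin> ?S" for x t' t2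
    using fibre_full_of_accumulation[OF \<mu>, of x t' t2] that by auto
  have "open {x. (x, t1) \<notin> ?S}"
  proof -
    have "{x. (x, t1) \<notin> ?S} = (\<lambda>x. (x, t1)) -` (- ?S)" by auto
    moreover have "open \<dots>" by (intro open_vimage continuous_intros) (simp add: closed_msupp open_Compl)
    ultimately show ?thesis by simp
  qed
  then have "open ({x. (x, t1) \<notin> ?S} \<times> (UNIV :: real set))" by (intro open_Times) auto
  moreover have "(x0, t0) \<in> {x. (x, t1) \<notin> ?S} \<times> (UNIV :: real set)" using t1 by simp
  ultimately obtain \<rho> where \<rho>: "\<rho> > 0" "cball (x0, t0) \<rho> \<subseteq> {x. (x, t1) \<notin> ?S} \<times> (UNIV :: real set)"
    using open_contains_cball by blast
  define A where "A = ?S \<inter> cball (x0, t0) \<rho>"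
  have A: "compact A" "A \<subseteq> ?S" by (auto simp: A_def closed_msupp intro: closed_Int_compact)
  have Afin: "finite {t. (x, t) \<in> A}" if "(x, t) \<in> A" for x t
    by (rule finite_fibre_of_compact[OF A isol[of x t1]]) (use that \<rho>(2) in \<open>auto simp: A_def\<close>)
  have Afin: "finite {t. (x, t) \<in> A}" for x
    using Afin[of x] by (cases "{t. (x, t) \<in> A} = {}") auto
  have q0: "x \<bullet> (Q *v x) = 0" if "(x, t) \<in> A" for x t using supp[of "(x, t)"] that A(2) by auto
  have sets: "sets \<mu> = sets borel" by (rule uniform_measureD(1)[OF \<mu>])
  define R where "R i k = {p \<in> A. \<bar>(Q *v fst p) $ i\<bar> \<ge> 1 / real (Suc k)}" for i k
  define W where "W = {p \<in> A. Q *v fst p = 0}"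
  have R: "compact (R i k)" for i k
  proof -
    have "R i k = A \<inter> {p. 1 / real (Suc k) \<le> \<bar>(Q *v fst p) $ i\<bar>}" by (auto simp: R_def)
    then show ?thesis
      by (simp add: compact_Int_closed A closed_Collect_le continuous_intros)
  qed
  have W: "compact W"
  proof -
    have "W = A \<inter> {p. Q *v fst p = 0}" by (auto simp: W_def)
    then show ?thesis
      by (simp add: compact_Int_closed A closed_Collect_eq continuous_intros)
  qed
  have Rnull: "emeasure \<mu> (R i k) = 0" for i k
  proof -
    define v where "v = (axis i 1 :: real ^ ('n + 'n))"
    define \<epsilon> where "\<epsilon> = 1 / real (Suc k)"
    \<comment> \<open>Up to \<open>s0\<close> the quadratic term of the form along \<open>v\<close> is dominated by the linear one.\<close>
    define s0 where "s0 = \<epsilon> / (\<bar>v \<bullet> (Q *v v)\<bar> + 1)"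
    have pos: "\<epsilon> > 0" "s0 > 0" by (auto simp: \<epsilon>_def s0_def intro!: divide_pos_pos add_nonneg_pos)
    have tr: "\<epsilon> * \<bar>s\<bar> \<le> \<bar>(x + s *\<^sub>R v) \<bullet> (Q *v (x + s *\<^sub>R v))\<bar>" if "(x, t) \<in> R i k" "\<bar>s\<bar> \<le> s0" for x t s
    proof -
      have xA: "(x, t) \<in> A" and big: "\<epsilon> \<le> \<bar>(Q *v x) \<bullet> v\<bar>"
        using that by (auto simp: R_def \<epsilon>_def v_def inner_axis)
      have "\<bar>s\<bar> * (\<bar>v \<bullet> (Q *v v)\<bar> + 1) \<le> \<epsilon>"
        using that(2) unfolding s0_def by (subst (asm) pos_le_divide_eq) auto
      then have small: "\<bar>s\<bar> * \<bar>v \<bullet> (Q *v v)\<bar> \<le> \<epsilon>" by (simp add: algebra_simps)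
      have "(x + s *\<^sub>R v) \<bullet> (Q *v (x + s *\<^sub>R v)) = s * (2 * ((Q *v x) \<bullet> v) + s * (v \<bullet> (Q *v v)))"
        unfolding quad_shift[OF Q(2)] q0[OF xA] by (simp add: power2_eq_square algebra_simps)
      moreover have "\<epsilon> \<le> \<bar>2 * ((Q *v x) \<bullet> v) + s * (v \<bullet> (Q *v v))\<bar>"
        using big small by (simp add: abs_mult[symmetric])
      ultimately show ?thesis
        using mult_left_mono[of \<epsilon> "\<bar>2 * ((Q *v x) \<bullet> v) + s * (v \<bullet> (Q *v v))\<bar>" "\<bar>s\<bar>"]
        by (simp only: abs_mult mult.commute[of \<epsilon>])
    qed
    show ?thesis
    proof (rule null_of_transversal[OF \<mu> R _ _ tr pos quad_lipschitz[OF Q(2)]])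
      show "R i k \<subseteq> ?S" using A by (auto simp: R_def)
      show "x \<bullet> (Q *v x) = 0" if "(x, t) \<in> R i k" for x t using that q0 by (auto simp: R_def)
      show "emeasure lborel {(x + s *\<^sub>R v, t) | x s t. (x, t) \<in> R i k \<and> 0 \<le> s \<and> s \<le> s0} = 0" (is "emeasure lborel ?T = 0")
      proof (rule emeasure_lborel_finite_fibres)
        show "?T \<in> sets borel" by (rule borel_compact[OF compact_translates[OF R]])
        fix y
        show "finite {t. (y, t) \<in> ?T}"
        proof (cases "{t. (y, t) \<in> ?T} = {}")
          case False
          then obtain x s t where x: "(x, t) \<in> R i k" "0 \<le> s" "s \<le> s0" "y = x + s *\<^sub>R v" by auto
          have "{t. (y, t) \<in> ?T} \<subseteq> {t. (x, t) \<in> A}"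
          proof
            fix t' assume "t' \<in> {t. (y, t) \<in> ?T}"
            then obtain x' s' where x': "(x', t') \<in> R i k" "0 \<le> s'" "s' \<le> s0" "y = x' + s' *\<^sub>R v" by auto
            have "x' = x + (s - s') *\<^sub>R v" using x(4) x'(4) by (simp add: algebra_simps)
            moreover have "x' \<bullet> (Q *v x') = 0" using x'(1) q0 by (auto simp: R_def)
            moreover have "\<bar>s - s'\<bar> \<le> s0" using x x' by linarith
            ultimately have "\<epsilon> * \<bar>s - s'\<bar> \<le> 0" using tr[OF x(1), of "s - s'"] by simp
            then have "s = s'" using pos(1) by (simp add: mult_le_0_iff)
            then have "x' = x" using \<open>x' = x + (s - s') *\<^sub>R v\<close> by simp
            then show "t' \<in> {t. (x, t) \<in> A}" using x'(1) by (simp add: R_def)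
          qed
          then show ?thesis using Afin finite_subset by blast
        next
          case True
          then show ?thesis by (simp only: finite.emptyI)
        qed
      qed
    qed auto
  qed
  have Wnull: "emeasure \<mu> W = 0"
  proof -
    obtain i where i: "row i Q \<noteq> 0"
    proof -
      have "\<exists>i. row i Q \<noteq> 0"
      proof (rule ccontr)
        assume "\<nexists>i. row i Q \<noteq> 0"
        then have "Q = 0" by (simp add: row_def vec_eq_iff)
        then show False using Q by simp
      qed
      then show thesis using that by blast
    qed
    define a where "a = row i Q"
    have mv: "(Q *v x) $ j = row j Q \<bullet> x" for j x
      by (simp add: matrix_vector_mult_def row_def inner_vec_def)
    have a: "a \<noteq> 0" using i by (simp add: a_def)
    obtain j where j: "row j Q - ((row j Q \<bullet> a) / (a \<bullet> a)) *\<^sub>R a \<noteq> 0"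
    proof -
      have "\<exists>j. row j Q - ((row j Q \<bullet> a) / (a \<bullet> a)) *\<^sub>R a \<noteq> 0"
      proof (rule ccontr)
        assume "\<nexists>j. row j Q - ((row j Q \<bullet> a) / (a \<bullet> a)) *\<^sub>R a \<noteq> 0"
        then have rj: "row j Q = ((row j Q \<bullet> a) / (a \<bullet> a)) *\<^sub>R a" for j by simp
        define c where "c = (\<chi> j. (row j Q \<bullet> a) / (a \<bullet> a))"
        have "Q *v x = (a \<bullet> x) *\<^sub>R c" for x
        proof -
          have "(Q *v x) $ j = ((a \<bullet> x) *\<^sub>R c) $ j" for j
            unfolding mv by (subst rj) (simp add: c_def)
          then show ?thesis by (simp add: vec_eq_iff)
        qed
        then have "a \<bullet> fst p = 0" if "p \<in> ?S" for p
          using symmetric_rank_one_zero[OF Q(2,1)] supp[OF that] by blast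
        then have "?S \<subseteq> vplane a" by (auto simp: vplane_def)
        then show False using plane a by blast
      qed
      then show thesis using that by blast
    qed
    \<comment> \<open>Moving the kernel in direction \<open>a\<close> stays inside the hyperplane orthogonal to \<open>b\<close>.\<close>
    define b where "b = row j Q - ((row j Q \<bullet> a) / (a \<bullet> a)) *\<^sub>R a"
    have b: "b \<noteq> 0" "b \<bullet> a = 0" using j a by (auto simp: b_def inner_diff_left)
    have aW: "a \<bullet> x = 0" "b \<bullet> x = 0" if "(x, t) \<in> W" for x t
    proof -
      have "row l Q \<bullet> x = 0" for l using that mv[of x l] by (simp add: W_def)
      then show "a \<bullet> x = 0" "b \<bullet> x = 0" by (simp_all add: a_def b_def inner_diff_left)
    qed
    show ?thesis
    proof (rule null_of_transversal[OF \<mu> W, where f="\<lambda>x. a \<bullet> x" and v=a and \<epsilon>="a \<bullet> a" and ?s0.0=1])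
      show "W \<subseteq> ?S" using A by (auto simp: W_def)
      show "a \<bullet> x = 0" if "(x, t) \<in> W" for x t using aW that by blast
      show "a \<bullet> a * \<bar>s\<bar> \<le> \<bar>a \<bullet> (x + s *\<^sub>R a)\<bar>" if "(x, t) \<in> W" for x t s
        using aW(1)[OF that] by (simp add: inner_add_right abs_mult)
      show "a \<bullet> a > 0" using a by simp
      show "\<exists>L. \<forall>y\<in>cball 0 \<rho>. \<forall>y'\<in>cball 0 \<rho>. \<bar>a \<bullet> y - a \<bullet> y'\<bar> \<le> L * norm (y - y')" for \<rho>
        by (intro exI[of _ "norm a"]) (simp add: Cauchy_Schwarz_ineq2 flip: inner_diff_right)
      have "{(x + s *\<^sub>R a, t) | x s t. (x, t) \<in> W \<and> 0 \<le> s \<and> s \<le> 1} \<subseteq> {z. (b, 0) \<bullet> z = 0}"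
        using aW(2) b(2) by (auto simp: inner_add_right inner_Pair)
      moreover have "negligible {z. (b, 0 :: real) \<bullet> z = 0}" using b(1) by (intro negligible_hyperplane) (simp add: zero_prod_def)
      ultimately have "negligible {(x + s *\<^sub>R a, t) | x s t. (x, t) \<in> W \<and> 0 \<le> s \<and> s \<le> 1}" (is "negligible ?T")
        using negligible_subset by blast
      moreover have "?T \<in> sets borel" by (rule borel_compact[OF compact_translates[OF W]])
      ultimately show "emeasure lborel ?T = 0"
        by (simp add: negligible_iff_null_sets null_sets_def emeasure_completion)
    qed simp
  qed
  have "A \<subseteq> (\<Union>i. \<Union>k. R i k) \<union> W"
  proof
    fix p assume p: "p \<in> A"
    show "p \<in> (\<Union>i. \<Union>k. R i k) \<union> W"
    proof (cases "Q *v fst p = 0")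
      case False
      then obtain i where i: "(Q *v fst p) $ i \<noteq> 0" by (auto simp: vec_eq_iff)
      then obtain k where "1 / real (Suc k) < \<bar>(Q *v fst p) $ i\<bar>"
        using nat_approx_posE[of "\<bar>(Q *v fst p) $ i\<bar>"] by auto
      then show ?thesis using p by (auto simp: R_def intro: less_imp_le)
    qed (use p in \<open>simp add: W_def\<close>)
  qed
  moreover have "(\<Union>i. \<Union>k. R i k) \<union> W \<in> null_sets \<mu>"
    using Rnull Wnull R W by (intro null_sets.Un null_sets_UN') (auto simp: null_sets_def sets borel_compact)
  ultimately have "emeasure \<mu> A = 0"
    by (metis emeasure_mono null_setsD1 null_setsD2 le_zero_eq)
  moreover have "emeasure \<mu> (- ?S) = 0" by (rule emeasure_compl_msupp[OF sets])
  ultimately have "emeasure \<mu> (A \<union> - ?S) = 0"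
    using A by (intro emeasure_Un_null_set[THEN trans]) (auto simp: null_sets_def sets borel_compact closed_msupp)
  moreover have "emeasure \<mu> (ball (x0, t0) \<rho>) \<le> emeasure \<mu> (A \<union> - ?S)"
    using A closed_msupp[of \<mu>] by (intro emeasure_mono) (auto simp: A_def sets)
  moreover have "emeasure \<mu> (ball (x0, t0) \<rho>) > 0"
    using p \<rho>(1) unfolding msupp_def by simp
  ultimately show False by simp
qed

section \<open>Vertical translation invariance\<close>

definition vshift :: "real \<Rightarrow> 'n::finite heis \<Rightarrow> 'n heis" where
  "vshift c z = (fst z, snd z + c)"

lemma kdist4_vshift: "kdist4 (vshift c z) (vshift c x) = kdist4 z x"
  by (simp add: kdist4_def vshift_def algebra_simps)

lemma vshift_vshift [simp]: "vshift a (vshift b z) = vshift (b + a) z" "vshift 0 z = z"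
  by (simp_all add: vshift_def)

lemma continuous_vshift: "continuous_on A (vshift c)"
  unfolding vshift_def by (intro continuous_intros)

lemma measurable_vshift [measurable]: "vshift c \<in> borel_measurable borel"
  by (intro borel_measurable_continuous_onI continuous_vshift)

lemma vshift_vimage_kball: "r > 0 \<Longrightarrow> vshift c -` kball r x = kball r (vshift (- c) x)"
  using kdist4_vshift[of c _ "vshift (- c) x"] by (auto simp: kball_kdist4)

definition vertically_invariant :: "('a \<times> real) set \<Rightarrow> bool" where
  "vertically_invariant S \<longleftrightarrow> (\<forall>x t t'. (x, t) \<in> S \<longrightarrow> (x, t') \<in> S)"

lemma vertically_invariantD: "vertically_invariant S \<Longrightarrow> (x, t) \<in> S \<Longrightarrow> (x, t') \<in> S"
  by (auto simp: vertically_invariant_def)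

text \<open>
  Vertical translations are isometries. So \<open>\<mu>\<close> and its translate are uniform measures with the same
  support.
\<close>

lemma distr_vshift:
  fixes \<mu> :: "'n::finite heis measure"
  assumes \<mu>: "uniform_measure m \<mu>" and inv: "vertically_invariant (msupp \<mu>)"
  shows "distr \<mu> borel (vshift c) = \<mu>"
proof (rule measure_eqI)
  note sets [measurable_cong] = uniform_measureD(1)[OF \<mu>]
  let ?\<mu> = "distr \<mu> borel (vshift c)" and ?S = "msupp \<mu>"
  have vm: "vshift c \<in> \<mu> \<rightarrow>\<^sub>M borel" by measurable
  have sp: "space \<mu> = UNIV" using sets_eq_imp_space_eq[OF sets] by simp
  have em: "emeasure ?\<mu> A = emeasure \<mu> (vshift c -` A)" if "A \<in> sets borel" for A
    using that by (simp add: emeasure_distr[OF vm] sp)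
  have Sinv: "vshift a z \<in> ?S \<longleftrightarrow> z \<in> ?S" for a z
    using vertically_invariantD[OF inv, of "fst z" "snd z" "snd z + a"]
      vertically_invariantD[OF inv, of "fst z" "snd z + a" "snd z"] by (auto simp: vshift_def)
  show "sets ?\<mu> = sets \<mu>" by (simp add: sets)
  fix A assume "A \<in> sets ?\<mu>"
  then have A: "A \<in> sets borel" by simp
  have S: "?S \<in> sets borel" by (simp add: closed_msupp)
  let ?B = "A \<inter> ?S"
  have B: "?B \<in> sets borel" using A S by auto
  have "emeasure ?\<mu> A = emeasure \<mu> (vshift c -` A)" by (rule em[OF A])
  also have "\<dots> = emeasure \<mu> (vshift c -` A \<inter> ?S)"
    using measurable_sets_borel[OF measurable_vshift[of c] A] by (intro emeasure_Int_msupp[OF sets, symmetric]) simp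
  also have "vshift c -` A \<inter> ?S = vshift c -` ?B" by (rule set_eqI) (simp add: Sinv)
  also have "emeasure \<mu> \<dots> = emeasure ?\<mu> ?B" using em[OF B] by simp
  also have "\<dots> = csph m ?B"
  proof (rule csph_eq_emeasure[symmetric])
    fix x r assume "x \<in> ?B" "0 < (r :: real)"
    then show "emeasure ?\<mu> (kball r x) = ennreal (r ^ m)"
      using uniform_measureD(3)[OF \<mu>, of "vshift (- c) x" r] Sinv[of "- c" x]
      by (simp add: em vshift_vimage_kball)
  next
    have "emeasure ?\<mu> ?B = emeasure \<mu> (vshift c -` ?B)" by (rule em[OF B])
    also have "\<dots> = (INF U\<in>{U. open U \<and> vshift c -` ?B \<subseteq> U}. emeasure \<mu> U)"
      using measurable_sets_borel[OF measurable_vshift[of c] B] by (intro uniform_measureD(4)[OF \<mu>]) simp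
    also have "\<dots> = (INF U\<in>{U. open U \<and> ?B \<subseteq> U}. emeasure ?\<mu> U)"
    proof (rule antisym)
      show "(INF U\<in>{U. open U \<and> vshift c -` ?B \<subseteq> U}. emeasure \<mu> U) \<le> (INF U\<in>{U. open U \<and> ?B \<subseteq> U}. emeasure ?\<mu> U)"
      proof (rule INF_greatest)
        fix U assume "U \<in> {U. open U \<and> ?B \<subseteq> U}"
        then have "open (vshift c -` U)" "vshift c -` ?B \<subseteq> vshift c -` U" "emeasure ?\<mu> U = emeasure \<mu> (vshift c -` U)"
          using continuous_vshift[of UNIV c] by (auto simp: em intro!: open_vimage)
        then show "(INF U\<in>{U. open U \<and> vshift c -` ?B \<subseteq> U}. emeasure \<mu> U) \<le> emeasure ?\<mu> U"
          by (metis (mono_tags, lifting) INF_lower mem_Collect_eq)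
      qed
      show "(INF U\<in>{U. open U \<and> ?B \<subseteq> U}. emeasure ?\<mu> U) \<le> (INF U\<in>{U. open U \<and> vshift c -` ?B \<subseteq> U}. emeasure \<mu> U)"
      proof (rule INF_greatest)
        fix U assume U: "U \<in> {U. open U \<and> vshift c -` ?B \<subseteq> U}"
        have "vshift c -` (vshift (- c) -` U) = U" by (simp add: vimage_def)
        moreover have "open (vshift (- c) -` U)"
          using U continuous_vshift[of UNIV "- c"] by (auto intro!: open_vimage)
        moreover have "?B \<subseteq> vshift (- c) -` U"
        proof
          fix z assume "z \<in> ?B"
          then have "vshift (- c) z \<in> vshift c -` ?B" by simp
          then show "z \<in> vshift (- c) -` U" using U by blast
        qed
        moreover have "emeasure ?\<mu> (vshift (- c) -` U) = emeasure \<mu> (vshift c -` (vshift (- c) -` U))"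
          using \<open>open (vshift (- c) -` U)\<close> by (intro em) auto
        ultimately show "(INF U\<in>{U. open U \<and> ?B \<subseteq> U}. emeasure ?\<mu> U) \<le> emeasure \<mu> U"
          by (metis (mono_tags, lifting) INF_lower mem_Collect_eq)
      qed
    qed
    finally show "emeasure ?\<mu> ?B = (INF U\<in>{U. open U \<and> ?B \<subseteq> U}. emeasure ?\<mu> U)" .
  qed (use B in auto)
  also have "\<dots> = emeasure \<mu> ?B"
    by (rule csph_eq_emeasure[OF sets B]) (use uniform_measureD(3,4)[OF \<mu>] B in auto)
  also have "\<dots> = emeasure \<mu> A" by (rule emeasure_Int_msupp[OF sets A])
  finally show "emeasure ?\<mu> A = emeasure \<mu> A" .
qed

text \<open>
  The mass of \<open>\<mu>\<close> per unit of height: if \<open>\<mu>\<close> is invariant under vertical translations, it is the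
  product of this measure and the Lebesgue measure of the vertical axis.
\<close>

definition base_measure :: "'n::finite heis measure \<Rightarrow> (real ^ ('n + 'n)) measure" where
  "base_measure \<mu> = distr (density \<mu> (\<lambda>z. indicator {0..<1} (snd z))) borel fst"

lemma sets_base_measure [simp, measurable_cong]: "sets (base_measure \<mu>) = sets borel"
  by (simp add: base_measure_def)

lemma space_base_measure [simp]: "space (base_measure \<mu>) = UNIV"
  by (simp add: base_measure_def)

lemma nn_integral_base_measure:
  fixes \<mu> :: "'n::finite heis measure"
  assumes [measurable_cong]: "sets \<mu> = sets borel" and [measurable]: "f \<in> borel_measurable borel"
  shows "(\<integral>\<^sup>+y. f y \<partial>base_measure \<mu>) = (\<integral>\<^sup>+z. indicator {0..<1} (snd z) * f (fst z) \<partial>\<mu>)"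
  unfolding base_measure_def by (subst nn_integral_distr) (auto simp: nn_integral_density)

lemma nn_integral_lborel_shift:
  fixes f :: "real \<Rightarrow> ennreal"
  assumes [measurable]: "f \<in> borel_measurable borel"
  shows "(\<integral>\<^sup>+s. f (t + s) \<partial>lborel) = (\<integral>\<^sup>+s. f s \<partial>lborel)"
  using nn_integral_real_affine[of f 1 t] by simp

text \<open>
  Insert the integral over \<open>s\<close> of the indicator function of \<open>0 \<le> t - s < 1\<close>, which is 1, and use the
  invariance of \<open>\<mu>\<close> to move the translation by \<open>s\<close> onto \<open>F\<close>.
\<close>

lemma nn_integral_vertical:
  fixes \<mu> :: "'n::finite heis measure"
  assumes sets [measurable_cong]: "sets \<mu> = sets borel" and "sigma_finite_measure \<mu>"
    and inv: "\<And>c. distr \<mu> borel (vshift c) = \<mu>" and [measurable]: "F \<in> borel_measurable borel"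
  shows "(\<integral>\<^sup>+z. F z \<partial>\<mu>) = (\<integral>\<^sup>+y. (\<integral>\<^sup>+s. F (y, s) \<partial>lborel) \<partial>base_measure \<mu>)"
proof -
  interpret sigma_finite_measure \<mu> by fact
  interpret pair_sigma_finite \<mu> lborel ..
  have shift: "(\<integral>\<^sup>+z. G z \<partial>\<mu>) = (\<integral>\<^sup>+z. G (vshift c z) \<partial>\<mu>)" if [measurable]: "G \<in> borel_measurable borel" for G c
    by (subst inv[of c, symmetric], subst nn_integral_distr) auto
  have bp: "borel_measurable (borel :: 'n heis measure) = borel_measurable (borel \<Otimes>\<^sub>M borel)"
    unfolding borel_prod ..
  have [measurable]: "(\<lambda>p. F (fst (fst p), snd p)) \<in> borel_measurable (\<mu> \<Otimes>\<^sub>M lborel)"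
  proof -
    have "(\<lambda>p. (fst (fst p), snd p)) \<in> \<mu> \<Otimes>\<^sub>M lborel \<rightarrow>\<^sub>M (borel \<Otimes>\<^sub>M borel)" by measurable
    then have "(\<lambda>p. (fst (fst p), snd p)) \<in> \<mu> \<Otimes>\<^sub>M lborel \<rightarrow>\<^sub>M borel" unfolding borel_prod .
    then show ?thesis by measurable
  qed
  have [measurable]: "(\<lambda>p. F (vshift (snd p) (fst p))) \<in> borel_measurable (\<mu> \<Otimes>\<^sub>M lborel)"
  proof -
    have "(\<lambda>p. (fst (fst p), snd (fst p) + snd p)) \<in> \<mu> \<Otimes>\<^sub>M lborel \<rightarrow>\<^sub>M (borel \<Otimes>\<^sub>M borel)" by measurable
    then have "(\<lambda>p. (fst (fst p), snd (fst p) + snd p)) \<in> \<mu> \<Otimes>\<^sub>M lborel \<rightarrow>\<^sub>M borel" unfolding borel_prod .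
    then show ?thesis unfolding vshift_def by measurable
  qed
  have "(\<integral>\<^sup>+z. F z \<partial>\<mu>) = (\<integral>\<^sup>+z. (\<integral>\<^sup>+s. F z * indicator {0..<1} (snd z - s) \<partial>lborel) \<partial>\<mu>)"
  proof (rule nn_integral_cong)
    fix z :: "'n heis"
    have "(\<integral>\<^sup>+s. F z * indicator {0..<1} (snd z - s) \<partial>lborel) = F z * (\<integral>\<^sup>+s. indicator {snd z - 1<..snd z} s \<partial>lborel)"
      by (subst nn_integral_cmult[symmetric]) (auto intro!: nn_integral_cong simp: indicator_def)
    then show "F z = (\<integral>\<^sup>+s. F z * indicator {0..<1} (snd z - s) \<partial>lborel)" by simp
  qed
  also have "\<dots> = (\<integral>\<^sup>+s. (\<integral>\<^sup>+z. F z * indicator {0..<1} (snd z - s) \<partial>\<mu>) \<partial>lborel)"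
    by (rule Fubini'[symmetric]) measurable
  also have "\<dots> = (\<integral>\<^sup>+s. (\<integral>\<^sup>+z. F (vshift s z) * indicator {0..<1} (snd z) \<partial>\<mu>) \<partial>lborel)"
  proof (rule nn_integral_cong)
    fix s :: real
    show "(\<integral>\<^sup>+z. F z * indicator {0..<1} (snd z - s) \<partial>\<mu>) = (\<integral>\<^sup>+z. F (vshift s z) * indicator {0..<1} (snd z) \<partial>\<mu>)"
      by (subst shift[of _ s]) (auto simp: vshift_def)
  qed
  also have "\<dots> = (\<integral>\<^sup>+z. (\<integral>\<^sup>+s. F (vshift s z) * indicator {0..<1} (snd z) \<partial>lborel) \<partial>\<mu>)"
    by (rule Fubini') measurable
  also have "\<dots> = (\<integral>\<^sup>+z. indicator {0..<1} (snd z) * (\<integral>\<^sup>+s. F (fst z, s) \<partial>lborel) \<partial>\<mu>)"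
  proof (rule nn_integral_cong)
    fix z :: "'n heis"
    have m: "(\<lambda>s. F (fst z, s)) \<in> borel_measurable borel"
      by (intro measurable_compose[OF borel_measurable_continuous_onI[of "\<lambda>s. (fst z, s)"]] continuous_intros) measurable
    have "(\<integral>\<^sup>+s. F (vshift s z) * indicator {0..<1} (snd z) \<partial>lborel) = (\<integral>\<^sup>+s. indicator {0..<1} (snd z) * F (fst z, snd z + s) \<partial>lborel)"
      by (simp add: vshift_def mult.commute)
    also have "\<dots> = indicator {0..<1} (snd z) * (\<integral>\<^sup>+s. F (fst z, snd z + s) \<partial>lborel)"
      using m by (intro nn_integral_cmult) simp
    finally show "(\<integral>\<^sup>+s. F (vshift s z) * indicator {0..<1} (snd z) \<partial>lborel) = indicator {0..<1} (snd z) * (\<integral>\<^sup>+s. F (fst z, s) \<partial>lborel)"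
      using nn_integral_lborel_shift[OF m, of "snd z"] by simp
  qed
  also have "\<dots> = (\<integral>\<^sup>+y. (\<integral>\<^sup>+s. F (y, s) \<partial>lborel) \<partial>base_measure \<mu>)"
  proof (rule nn_integral_base_measure[symmetric, OF sets])
    have "F \<in> borel_measurable (borel \<Otimes>\<^sub>M borel)" unfolding borel_prod by simp
    then have "(\<lambda>p. F (fst p, snd p)) \<in> borel_measurable (borel \<Otimes>\<^sub>M lborel)"
      by (simp cong: measurable_cong_sets)
    then show "(\<lambda>y. \<integral>\<^sup>+s. F (y, s) \<partial>lborel) \<in> borel_measurable borel"
      by (intro lborel.borel_measurable_nn_integral) (simp add: case_prod_beta)
  qed
  finally show ?thesis .
qed

section \<open>Subordination\<close>

lemma Gamma_three_halves: "Gamma (1/2 + 1 :: real) = sqrt pi / 2"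
proof -
  have "(1/2 :: real) \<notin> \<int>\<^sub>\<le>\<^sub>0" by (auto elim!: nonpos_Ints_cases)
  then show ?thesis
    using Gamma_plus1[of "1/2 :: real"] Gamma_one_half_real by simp
qed

lemma nn_integral_gauss_shift:
  assumes s: "s > 0"
  shows "(\<integral>\<^sup>+t. ennreal (exp (- s * (t - c)\<^sup>2)) \<partial>lborel) = ennreal (sqrt pi * s powr (- (1/2)))"
proof -
  have "(\<integral>\<^sup>+t. 1 * ennreal (exp (- s * (t - c)\<^sup>2)) \<partial>lborel) = ennreal 2 * ennreal (Gamma (1/2 + 1) * s powr (- (1/2)))"
  proof (rule nn_integral_exp_homogeneous)
    show "sigma_finite_measure (lborel :: real measure)" by (rule sigma_finite_lborel)
    fix Y :: real assume Y: "Y > 0"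
    then have "{t. (t - c)\<^sup>2 \<le> Y} = {c - sqrt Y .. c + sqrt Y}" by (intro square_le_interval) simp
    then show "(\<integral>\<^sup>+t. 1 * indicator {t. (t - c)\<^sup>2 \<le> Y} t \<partial>lborel) = ennreal 2 * ennreal (Y powr (1/2))"
      using Y by (simp add: powr_half_sqrt ennreal_mult')
  qed (use s in auto)
  moreover note Gamma_three_halves
  moreover have "ennreal 2 * ennreal (sqrt pi / 2 * s powr (- (1/2))) = ennreal (2 * (sqrt pi / 2 * s powr (- (1/2))))"
    by (subst ennreal_mult') auto
  moreover have "2 * (sqrt pi / 2 * s powr (- (1/2))) = sqrt pi * s powr (- (1/2))" by simp
  ultimately show ?thesis by (simp only: mult_1_left)
qed

text \<open>
  The primitive of the Gaussian that vanishes at 0 is odd, so both limits follow from one value of the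
  Gamma function.
\<close>

lemma gauss_primitive:
  obtains G :: "real \<Rightarrow> real" where "\<And>y. (G has_real_derivative exp (- y\<^sup>2)) (at y)"
    "G 0 = 0" "(G \<longlongrightarrow> sqrt pi / 2) at_top" "(G \<longlongrightarrow> - (sqrt pi / 2)) at_bot"
proof -
  have "\<exists>G. \<forall>x::real. -\<infinity> < ereal x \<longrightarrow> ereal x < \<infinity> \<longrightarrow> (G has_vector_derivative exp (- x\<^sup>2)) (at x)"
    by (rule einterval_antiderivative) (auto intro!: continuous_intros)
  then obtain G0 where G0: "\<And>x::real. (G0 has_real_derivative exp (- x\<^sup>2)) (at x)"
    by (auto simp: has_real_derivative_iff_has_vector_derivative)
  define G where "G y = G0 y - G0 0" for y
  have G: "(G has_real_derivative exp (- y\<^sup>2)) (at y)" for y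
    unfolding G_def by (rule derivative_eq_intros G0 | simp)+
  have "((\<lambda>y. G y + G (- y)) has_real_derivative 0) (at x)" for x
  proof -
    have "((\<lambda>y. G (- y)) has_real_derivative - exp (- (- x)\<^sup>2)) (at x)"
      using G[of "- x"] by (simp only: DERIV_mirror)
    then show "((\<lambda>y. G y + G (- y)) has_real_derivative 0) (at x)"
      using DERIV_add[OF G[of x]] by fastforce
  qed
  then have "(\<lambda>y. G y + G (- y)) y = (\<lambda>y. G y + G (- y)) 0" for y
    by (intro DERIV_isconst_all) blast
  then have "G y + G (- y) = G 0 + G (- 0)" for y by blast
  then have odd: "G y = - G (- y)" for y by (simp add: eq_neg_iff_add_eq_0) (simp add: G_def)
  let ?f = "\<lambda>u::real. indicator {0..} u * exp (- u\<^sup>2)"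
  have nn: "(\<integral>\<^sup>+u. ennreal (?f u) \<partial>lborel) = ennreal (sqrt pi / 2)"
  proof -
    have "(\<integral>\<^sup>+u. indicator {0..} u * ennreal (exp (- 1 * u\<^sup>2)) \<partial>lborel) = 1 * ennreal (Gamma (1/2 + 1) * 1 powr (- (1/2)))"
    proof (rule nn_integral_exp_homogeneous)
      show "sigma_finite_measure (lborel :: real measure)" by (rule sigma_finite_lborel)
      fix Y :: real assume Y: "Y > 0"
      have "u\<^sup>2 \<le> Y \<longleftrightarrow> \<bar>u\<bar> \<le> sqrt Y" for u
        using real_sqrt_le_iff[of "u\<^sup>2" Y] by (simp only: real_sqrt_abs)
      then have "indicator {0..} u * indicator {t. t\<^sup>2 \<le> Y} u = (indicator {0..sqrt Y} u :: ennreal)" for u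
        by (auto simp: indicator_def abs_le_iff)
      then show "(\<integral>\<^sup>+t. indicator {0..} t * indicator {t. t\<^sup>2 \<le> Y} t \<partial>lborel) = 1 * ennreal (Y powr (1/2))"
        using Y by (simp add: powr_half_sqrt)
    qed auto
    moreover note Gamma_three_halves
    moreover have "ennreal (?f u) = indicator {0..} u * ennreal (exp (- 1 * u\<^sup>2))" for u
      by (auto simp: indicator_def)
    ultimately show ?thesis by simp
  qed
  have int: "integrable lborel ?f" using nn by (intro integrableI_nonneg) auto
  have val: "integral\<^sup>L lborel ?f = sqrt pi / 2"
    using nn nn_integral_eq_integral[OF int] by (simp add: integral_nonneg_AE)
  have "((\<lambda>y. \<integral>u. indicator {..y} u *\<^sub>R ?f u \<partial>lborel) \<longlongrightarrow> sqrt pi / 2) at_top"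
    using tendsto_integral_at_top[OF _ int] val by simp
  moreover have "eventually (\<lambda>y. (\<integral>u. indicator {..y} u *\<^sub>R ?f u \<partial>lborel) = G y) at_top"
    using eventually_ge_at_top[of 0]
  proof eventually_elim
    fix y :: real assume y: "0 \<le> y"
    have "has_bochner_integral lborel (\<lambda>x. exp (- x\<^sup>2) * indicator {0 .. y} x) (G y - G 0)"
      using y G by (intro has_bochner_integral_FTC_Icc_nonneg) (auto intro!: continuous_intros simp: DERIV_subset)
    moreover have "(\<lambda>x. exp (- x\<^sup>2) * indicator {0 .. y} x) = (\<lambda>u. indicator {..y} u *\<^sub>R ?f u)"
      by (auto simp: indicator_def)
    ultimately show "(\<integral>u. indicator {..y} u *\<^sub>R ?f u \<partial>lborel) = G y"
      by (simp add: has_bochner_integral_iff G_def)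
  qed
  ultimately have top: "(G \<longlongrightarrow> sqrt pi / 2) at_top" by (rule Lim_transform_eventually)
  have "((\<lambda>y. - G (- y)) \<longlongrightarrow> - (sqrt pi / 2)) at_bot"
    by (intro tendsto_minus filterlim_compose[OF top]) (rule filterlim_uminus_at_top_at_bot)
  moreover have "(\<lambda>y. - G (- y)) = G" by (rule ext) (rule odd[symmetric])
  ultimately have "(G \<longlongrightarrow> - (sqrt pi / 2)) at_bot" by (simp only:)
  moreover have "G 0 = 0" by (simp add: G_def)
  ultimately show thesis using that G top by blast
qed

text \<open>
  \<open>exp (-2\<beta>)\<close> as a mixture of the functions \<open>exp (- \<beta>\<^sup>2 \<tau>)\<close>. The primitive comes from splitting
  \<open>2 exp (-\<sigma>\<^sup>2 - \<beta>\<^sup>2/\<sigma>\<^sup>2)\<close> as \<open>exp (-2\<beta>) exp (-(\<sigma> - \<beta>/\<sigma>)\<^sup>2) (\<sigma> - \<beta>/\<sigma>)'\<close> plus the same expression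
  with the sign of \<open>\<beta>\<close> reversed.
\<close>

lemma nn_integral_subordination:
  assumes \<beta>: "\<beta> \<ge> 0"
  shows "(\<integral>\<^sup>+\<sigma>. ennreal (exp (- \<sigma>\<^sup>2 - (\<beta> / \<sigma>)\<^sup>2)) * indicator {0<..} \<sigma> \<partial>lborel) = ennreal (sqrt pi / 2 * exp (- 2 * \<beta>))"
proof -
  obtain G :: "real \<Rightarrow> real" where G: "\<And>y. (G has_real_derivative exp (- y\<^sup>2)) (at y)"
    and G0: "G 0 = 0" and Gtop: "(G \<longlongrightarrow> sqrt pi / 2) at_top" and Gbot: "(G \<longlongrightarrow> - (sqrt pi / 2)) at_bot"
    using gauss_primitive by blast
  \<comment> \<open>At \<open>\<sigma> = 0\<close> the two arguments tend to \<open>-\<infinity>\<close> and \<open>\<infinity>\<close>, at \<open>\<sigma> = \<infinity>\<close> both tend to \<open>\<infinity>\<close>: the terms with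
    \<open>exp (2 \<beta>)\<close> cancel. For \<open>\<beta> = 0\<close> the arguments have no such limits at 0; this case is separate.\<close>
  define F where "F \<sigma> = (exp (- 2 * \<beta>) * G (\<sigma> - \<beta> / \<sigma>) + exp (2 * \<beta>) * G (\<sigma> + \<beta> / \<sigma>)) / 2" for \<sigma>
  let ?f = "\<lambda>\<sigma>::real. exp (- \<sigma>\<^sup>2 - (\<beta> / \<sigma>)\<^sup>2)"
  have dF: "(F has_real_derivative ?f \<sigma>) (at \<sigma>)" if \<sigma>: "\<sigma> > 0" for \<sigma>
  proof -
    have 1: "((\<lambda>\<sigma>. G (\<sigma> - \<beta> / \<sigma>)) has_real_derivative exp (- (\<sigma> - \<beta> / \<sigma>)\<^sup>2) * (1 + \<beta> / \<sigma>\<^sup>2)) (at \<sigma>)"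
      using \<sigma> by (intro DERIV_chain2[OF G]) (auto intro!: derivative_eq_intros simp: power2_eq_square)
    have 2: "((\<lambda>\<sigma>. G (\<sigma> + \<beta> / \<sigma>)) has_real_derivative exp (- (\<sigma> + \<beta> / \<sigma>)\<^sup>2) * (1 - \<beta> / \<sigma>\<^sup>2)) (at \<sigma>)"
      using \<sigma> by (intro DERIV_chain2[OF G]) (auto intro!: derivative_eq_intros simp: power2_eq_square)
    have e1: "exp (- 2 * \<beta>) * exp (- (\<sigma> - \<beta> / \<sigma>)\<^sup>2) = ?f \<sigma>"
      and e2: "exp (2 * \<beta>) * exp (- (\<sigma> + \<beta> / \<sigma>)\<^sup>2) = ?f \<sigma>"
      using \<sigma> by (simp_all only: exp_add[symmetric] exp_inj_iff power2_diff power2_sum) (simp_all add: field_simps)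
    have "(F has_real_derivative (exp (- 2 * \<beta>) * (exp (- (\<sigma> - \<beta> / \<sigma>)\<^sup>2) * (1 + \<beta> / \<sigma>\<^sup>2))
       + exp (2 * \<beta>) * (exp (- (\<sigma> + \<beta> / \<sigma>)\<^sup>2) * (1 - \<beta> / \<sigma>\<^sup>2))) / 2) (at \<sigma>)"
      unfolding F_def by (intro DERIV_cdivide DERIV_add DERIV_cmult 1 2)
    also have "(exp (- 2 * \<beta>) * (exp (- (\<sigma> - \<beta> / \<sigma>)\<^sup>2) * (1 + \<beta> / \<sigma>\<^sup>2))
       + exp (2 * \<beta>) * (exp (- (\<sigma> + \<beta> / \<sigma>)\<^sup>2) * (1 - \<beta> / \<sigma>\<^sup>2))) / 2 = ?f \<sigma>"
      unfolding mult.assoc[symmetric] e1 e2 by (simp add: algebra_simps)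
    finally show ?thesis .
  qed
  show ?thesis
  proof (cases "\<beta> = 0")
    case True
    have "(\<integral>\<^sup>+\<sigma>. ennreal (exp (- \<sigma>\<^sup>2)) * indicator {0..} \<sigma> \<partial>lborel) = ennreal (sqrt pi / 2 - G 0)"
      by (rule nn_integral_FTC_atLeast) (auto intro: G Gtop)
    moreover note G0
    moreover have "(\<integral>\<^sup>+\<sigma>. ennreal (exp (- \<sigma>\<^sup>2)) * indicator {0..} \<sigma> \<partial>lborel) = (\<integral>\<^sup>+\<sigma>. ennreal (exp (- \<sigma>\<^sup>2)) * indicator {0<..} \<sigma> \<partial>lborel)"
      using AE_lborel_singleton[of "0::real"] by (intro nn_integral_cong_AE) (auto simp: indicator_def elim!: eventually_mono)
    ultimately show ?thesis using True by simp
  next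
    case False
    then have \<beta>0: "\<beta> > 0" using \<beta> by simp
    have top: "(F \<longlongrightarrow> (exp (- 2 * \<beta>) * (sqrt pi / 2) + exp (2 * \<beta>) * (sqrt pi / 2)) / 2) at_top"
      unfolding F_def
      by (intro tendsto_intros filterlim_compose[OF Gtop]) (real_asymp | simp)+
    have bot: "(F \<longlongrightarrow> (exp (- 2 * \<beta>) * (- (sqrt pi / 2)) + exp (2 * \<beta>) * (sqrt pi / 2)) / 2) (at_right 0)"
      unfolding F_def
      by (intro tendsto_intros filterlim_compose[OF Gtop] filterlim_compose[OF Gbot]) (use \<beta>0 in \<open>real_asymp | simp\<close>)+
    have A: "((F \<circ> real_of_ereal) \<longlongrightarrow> (exp (- 2 * \<beta>) * (- (sqrt pi / 2)) + exp (2 * \<beta>) * (sqrt pi / 2)) / 2) (at_right (ereal 0))"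
      and B: "((F \<circ> real_of_ereal) \<longlongrightarrow> (exp (- 2 * \<beta>) * (sqrt pi / 2) + exp (2 * \<beta>) * (sqrt pi / 2)) / 2) (at_left \<infinity>)"
      using top bot by (simp_all only: ereal_tendsto_simps1)
    have c: "isCont ?f x" if "ereal 0 < ereal x" for x
      using that by (intro continuous_intros) auto
    note ftc = interval_integral_FTC_nonneg[of "ereal 0" \<infinity> F ?f, OF _ _ _ _ A B]
    have int: "set_integrable lborel (einterval 0 \<infinity>) ?f"
      using ftc(1) dF c by (simp add: zero_ereal_def)
    have val: "(LBINT x=0..\<infinity>. ?f x) = sqrt pi / 2 * exp (- 2 * \<beta>)"
    proof -
      have "(LBINT x=0..\<infinity>. ?f x) = (exp (- 2 * \<beta>) * (sqrt pi / 2) + exp (2 * \<beta>) * (sqrt pi / 2)) / 2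
        - (exp (- 2 * \<beta>) * (- (sqrt pi / 2)) + exp (2 * \<beta>) * (sqrt pi / 2)) / 2"
        using ftc(2) dF c by (simp add: zero_ereal_def)
      then show ?thesis by (simp add: field_simps)
    qed
    have ei: "einterval 0 \<infinity> = {0<..}" by (auto simp: einterval_def zero_ereal_def)
    have "(\<integral>\<^sup>+\<sigma>. ennreal (indicator {0<..} \<sigma> * ?f \<sigma>) \<partial>lborel) = ennreal (\<integral>\<sigma>. indicator {0<..} \<sigma> * ?f \<sigma> \<partial>lborel)"
      using int unfolding ei set_integrable_def by (intro nn_integral_eq_integral) auto
    also have "(\<integral>\<sigma>. indicator {0<..} \<sigma> * ?f \<sigma> \<partial>lborel) = sqrt pi / 2 * exp (- 2 * \<beta>)"
      using val unfolding interval_lebesgue_integral_def set_lebesgue_integral_def ei by simp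
    also have "(\<lambda>\<sigma>. ennreal (indicator {0<..} \<sigma> * ?f \<sigma>)) = (\<lambda>\<sigma>. ennreal (?f \<sigma>) * indicator {0<..} \<sigma>)"
      by (auto simp: indicator_def)
    finally show ?thesis .
  qed
qed

section \<open>The Euclidean base measure\<close>

text \<open>
  Integrate the transform of \<open>\<mu>\<close> over vertical lines first; the symplectic term is a shift of the
  integration variable.
\<close>

lemma base_measure_quartic:
  fixes \<mu> :: "'n::finite heis measure"
  assumes \<mu>: "uniform_measure (2 * CARD('n) + 1) \<mu>" and inv: "vertically_invariant (msupp \<mu>)"
    and x: "(x, 0) \<in> msupp \<mu>" and s: "s > 0"
  shows "(\<integral>\<^sup>+y. ennreal (exp (- s * norm (y - x) ^ 4)) \<partial>base_measure \<mu>)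
    = ennreal (Gamma ((2 * CARD('n) + 1) / 4 + 1) / sqrt pi * s powr (- ((2 * real CARD('n) - 1) / 4)))"
proof -
  note sets [measurable_cong] = uniform_measureD(1)[OF \<mu>]
  let ?m = "2 * CARD('n) + 1"
  have sf: "sigma_finite_measure \<mu>"
    by (rule sigma_finite_of_kballs[OF sets, of 0]) (use uniform_measureD(2,3)[OF \<mu>] in auto)
  let ?g = "ennreal (sqrt pi * s powr (- (1/2)))"
  have m: "(\<lambda>y. ennreal (exp (- s * norm (y - x) ^ 4))) \<in> borel_measurable (base_measure \<mu>)" by measurable
  have "ennreal (Gamma (?m / 4 + 1) * s powr (- (?m / 4))) = (\<integral>\<^sup>+z. ennreal (exp (- s * kdist4 z (x, 0))) \<partial>\<mu>)"
    by (rule uniform_exp_integral[symmetric, OF sets uniform_measureD(3)[OF \<mu> x] _ s]) auto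
  also have "\<dots> = (\<integral>\<^sup>+y. (\<integral>\<^sup>+t. ennreal (exp (- s * kdist4 (y, t) (x, 0))) \<partial>lborel) \<partial>base_measure \<mu>)"
    by (rule nn_integral_vertical[OF sets sf distr_vshift[OF \<mu> inv]]) auto
  also have "\<dots> = (\<integral>\<^sup>+y. ?g * ennreal (exp (- s * norm (y - x) ^ 4)) \<partial>base_measure \<mu>)"
  proof (rule nn_integral_cong)
    fix y :: "real ^ ('n + 'n)"
    have "(\<integral>\<^sup>+t. ennreal (exp (- s * kdist4 (y, t) (x, 0))) \<partial>lborel)
      = (\<integral>\<^sup>+t. ennreal (exp (- s * norm (y - x) ^ 4)) * ennreal (exp (- s * (t - 2 * (x \<bullet> (symplJ *v y)))\<^sup>2)) \<partial>lborel)"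
      by (intro nn_integral_cong) (simp add: kdist4_def algebra_simps flip: ennreal_mult' exp_add)
    also have "\<dots> = ennreal (exp (- s * norm (y - x) ^ 4)) * ?g"
      by (subst nn_integral_cmult) (auto simp: nn_integral_gauss_shift[OF s, simplified])
    finally show "(\<integral>\<^sup>+t. ennreal (exp (- s * kdist4 (y, t) (x, 0))) \<partial>lborel) = ?g * ennreal (exp (- s * norm (y - x) ^ 4))"
      by (simp add: mult.commute)
  qed
  also have "\<dots> = ?g * (\<integral>\<^sup>+y. ennreal (exp (- s * norm (y - x) ^ 4)) \<partial>base_measure \<mu>)"
    by (rule nn_integral_cmult[OF m])
  finally have eq: "ennreal (Gamma (?m / 4 + 1) * s powr (- (?m / 4))) = ?g * (\<integral>\<^sup>+y. ennreal (exp (- s * norm (y - x) ^ 4)) \<partial>base_measure \<mu>)" .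
  have "(\<integral>\<^sup>+y. ennreal (exp (- s * norm (y - x) ^ 4)) \<partial>base_measure \<mu>)
    = ennreal (s powr (1/2) / sqrt pi) * (?g * (\<integral>\<^sup>+y. ennreal (exp (- s * norm (y - x) ^ 4)) \<partial>base_measure \<mu>))"
  proof -
    have "s powr (1/2) / sqrt pi * (sqrt pi * s powr (- (1/2))) = 1"
      using s by (simp flip: powr_add)
    then have "ennreal (s powr (1/2) / sqrt pi) * ?g = 1" by (simp flip: ennreal_mult' ennreal_1)
    then show ?thesis by (simp flip: mult.assoc)
  qed
  also have "\<dots> = ennreal (s powr (1/2) / sqrt pi * (Gamma (?m / 4 + 1) * s powr (- (?m / 4))))"
    unfolding eq[symmetric] by (rule ennreal_mult'[symmetric]) simp
  also have "s powr (1/2) / sqrt pi * (Gamma (?m / 4 + 1) * s powr (- (?m / 4)))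
    = Gamma (?m / 4 + 1) / sqrt pi * (s powr (1/2) * s powr (- (?m / 4)))" by simp
  also have "s powr (1/2) * s powr (- (?m / 4)) = s powr (- ((2 * real CARD('n) - 1) / 4))"
    unfolding powr_add[symmetric] by (rule arg_cong[where f="\<lambda>e. s powr e"]) (simp add: field_simps)
  finally show ?thesis by simp
qed

lemma sigma_finite_base_measure:
  fixes \<mu> :: "'n::finite heis measure"
  assumes \<mu>: "uniform_measure m \<mu>"
  shows "sigma_finite_measure (base_measure \<mu>)"
proof
  note sets [measurable_cong] = uniform_measureD(1)[OF \<mu>]
  have fin: "emeasure (base_measure \<mu>) (cball 0 k) < \<infinity>" for k
  proof -
    have "emeasure (base_measure \<mu>) (cball 0 k) = (\<integral>\<^sup>+z. indicator {0..<1} (snd z) * indicator (cball 0 k) (fst z) \<partial>\<mu>)"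
      by (subst nn_integral_base_measure[OF sets, symmetric]) (auto intro!: borel_measurable_indicator)
    also have "\<dots> \<le> (\<integral>\<^sup>+z. indicator (cball 0 k \<times> {0..1}) z \<partial>\<mu>)"
      by (intro nn_integral_mono) (auto simp: indicator_def mem_Times_iff)
    also have "\<dots> = emeasure \<mu> (cball 0 k \<times> {0..1})"
      by (rule nn_integral_indicator) (simp add: sets borel_compact compact_Times)
    also have "\<dots> < \<infinity>"
    proof -
      have "\<forall>K. compact K \<longrightarrow> emeasure \<mu> K < \<infinity>"
        using \<mu> unfolding uniform_measure_def radon_measure_def by blast
      then show ?thesis by (simp only: compact_Times[OF compact_cball compact_Icc])
    qed
    finally show ?thesis .
  qed
  have "y \<in> (\<Union>k. cball 0 (real k))" for y :: "real ^ ('n + 'n)"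
    using real_arch_simple[of "norm y"] by auto
  then show "\<exists>A. countable A \<and> A \<subseteq> sets (base_measure \<mu>) \<and> \<Union>A = space (base_measure \<mu>) \<and> (\<forall>a\<in>A. emeasure (base_measure \<mu>) a \<noteq> \<infinity>)"
    using fin by (intro exI[of _ "range (\<lambda>k. cball 0 (real k))"]) (auto simp: less_top)
qed

text \<open>
  The integral of \<open>exp (- |y|\<^sup>2)\<close> over the base measure, as computed by subordination. It depends on
  \<open>n\<close> only, which makes the constant of the theorem independent of \<open>\<mu>\<close>.
\<close>

definition gauss_mass :: "nat \<Rightarrow> ennreal" where
  "gauss_mass n = (\<integral>\<^sup>+\<sigma>. indicator {0<..} \<sigma> *
     ennreal (2 / sqrt pi * (Gamma ((2 * n + 1) / 4 + 1) / sqrt pi) * exp (- \<sigma>\<^sup>2) * (2 * \<sigma>) powr ((2 * real n - 1) / 2)) \<partial>lborel)"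

text \<open>
  By subordination with \<open>\<beta> = s |y - x|\<^sup>2 / 2\<close> the Gaussian is a mixture, over \<open>\<sigma> > 0\<close>, of the functions
  \<open>exp (- (s / 2\<sigma>)\<^sup>2 |y - x|\<^sup>4)\<close>, whose integrals are known.
\<close>

lemma base_measure_gauss_nn:
  fixes \<mu> :: "'n::finite heis measure"
  assumes \<mu>: "uniform_measure (2 * CARD('n) + 1) \<mu>" and inv: "vertically_invariant (msupp \<mu>)"
    and x: "(x, 0) \<in> msupp \<mu>" and s: "s > 0"
  shows "(\<integral>\<^sup>+y. ennreal (exp (- s * (norm (y - x))\<^sup>2)) \<partial>base_measure \<mu>)
    = gauss_mass CARD('n) * ennreal (s powr (- ((2 * real CARD('n) - 1) / 2)))"
proof -
  interpret sigma_finite_measure "base_measure \<mu>" by (rule sigma_finite_base_measure[OF \<mu>])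
  interpret pair_sigma_finite "base_measure \<mu>" lborel ..
  let ?c = "Gamma ((2 * CARD('n) + 1) / 4 + 1) / sqrt pi" and ?p = "(2 * real CARD('n) - 1) / 2"
  have c: "?c \<ge> 0" by (intro divide_nonneg_nonneg less_imp_le[OF Gamma_real_pos] add_nonneg_pos) auto
  have "(\<integral>\<^sup>+y. ennreal (exp (- s * (norm (y - x))\<^sup>2)) \<partial>base_measure \<mu>)
    = (\<integral>\<^sup>+y. (\<integral>\<^sup>+\<sigma>. ennreal (2 / sqrt pi) * (indicator {0<..} \<sigma> * ennreal (exp (- \<sigma>\<^sup>2 - ((s * (norm (y - x))\<^sup>2 / 2) / \<sigma>)\<^sup>2))) \<partial>lborel) \<partial>base_measure \<mu>)"
  proof (rule nn_integral_cong)
    fix y :: "real ^ ('n + 'n)"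
    have "(\<integral>\<^sup>+\<sigma>. ennreal (2 / sqrt pi) * (indicator {0<..} \<sigma> * ennreal (exp (- \<sigma>\<^sup>2 - ((s * (norm (y - x))\<^sup>2 / 2) / \<sigma>)\<^sup>2))) \<partial>lborel)
      = ennreal (2 / sqrt pi) * ennreal (sqrt pi / 2 * exp (- 2 * (s * (norm (y - x))\<^sup>2 / 2)))"
    proof -
      have "(\<integral>\<^sup>+\<sigma>. indicator {0<..} \<sigma> * ennreal (exp (- \<sigma>\<^sup>2 - ((s * (norm (y - x))\<^sup>2 / 2) / \<sigma>)\<^sup>2)) \<partial>lborel)
        = ennreal (sqrt pi / 2 * exp (- 2 * (s * (norm (y - x))\<^sup>2 / 2)))"
        using nn_integral_subordination[of "s * (norm (y - x))\<^sup>2 / 2"] s by (simp only: mult.commute[of "indicator _ _"]) simp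
      then show ?thesis by (subst nn_integral_cmult) (auto simp del: times_divide_eq_right)
    qed
    also have "\<dots> = ennreal (exp (- s * (norm (y - x))\<^sup>2))"
      by (subst ennreal_mult'[symmetric]) auto
    finally show "ennreal (exp (- s * (norm (y - x))\<^sup>2)) = (\<integral>\<^sup>+\<sigma>. ennreal (2 / sqrt pi) * (indicator {0<..} \<sigma> * ennreal (exp (- \<sigma>\<^sup>2 - ((s * (norm (y - x))\<^sup>2 / 2) / \<sigma>)\<^sup>2))) \<partial>lborel)" ..
  qed
  also have "\<dots> = (\<integral>\<^sup>+\<sigma>. (\<integral>\<^sup>+y. ennreal (2 / sqrt pi) * (indicator {0<..} \<sigma> * ennreal (exp (- \<sigma>\<^sup>2 - ((s * (norm (y - x))\<^sup>2 / 2) / \<sigma>)\<^sup>2))) \<partial>base_measure \<mu>) \<partial>lborel)"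
    by (rule Fubini'[symmetric]) measurable
  also have "\<dots> = (\<integral>\<^sup>+\<sigma>. indicator {0<..} \<sigma> *
     ennreal (2 / sqrt pi * ?c * exp (- \<sigma>\<^sup>2) * (2 * \<sigma>) powr ?p) * ennreal (s powr (- ?p)) \<partial>lborel)"
  proof (rule nn_integral_cong)
    fix \<sigma> :: real
    show "(\<integral>\<^sup>+y. ennreal (2 / sqrt pi) * (indicator {0<..} \<sigma> * ennreal (exp (- \<sigma>\<^sup>2 - ((s * (norm (y - x))\<^sup>2 / 2) / \<sigma>)\<^sup>2))) \<partial>base_measure \<mu>)
      = indicator {0<..} \<sigma> * ennreal (2 / sqrt pi * ?c * exp (- \<sigma>\<^sup>2) * (2 * \<sigma>) powr ?p) * ennreal (s powr (- ?p))"
    proof (cases "\<sigma> > 0")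
      case True
      let ?s = "(s / (2 * \<sigma>))\<^sup>2"
      have e: "- \<sigma>\<^sup>2 - ((s * (norm (y - x))\<^sup>2 / 2) / \<sigma>)\<^sup>2 = - \<sigma>\<^sup>2 + - ?s * norm (y - x) ^ 4" for y
        using True by (simp add: power_divide power_mult_distrib flip: power_mult)
      have "(\<integral>\<^sup>+y. ennreal (2 / sqrt pi) * (indicator {0<..} \<sigma> * ennreal (exp (- \<sigma>\<^sup>2 - ((s * (norm (y - x))\<^sup>2 / 2) / \<sigma>)\<^sup>2))) \<partial>base_measure \<mu>)
        = (\<integral>\<^sup>+y. ennreal (2 / sqrt pi * exp (- \<sigma>\<^sup>2)) * ennreal (exp (- ?s * norm (y - x) ^ 4)) \<partial>base_measure \<mu>)"
      proof (rule nn_integral_cong)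
        fix y
        have 1: "ennreal (2 / sqrt pi * exp (- \<sigma>\<^sup>2)) = ennreal (2 / sqrt pi) * ennreal (exp (- \<sigma>\<^sup>2))"
          by (rule ennreal_mult') simp
        have 2: "ennreal (exp (- \<sigma>\<^sup>2) * exp (- ?s * norm (y - x) ^ 4)) = ennreal (exp (- \<sigma>\<^sup>2)) * ennreal (exp (- ?s * norm (y - x) ^ 4))"
          by (rule ennreal_mult') simp
        show "ennreal (2 / sqrt pi) * (indicator {0<..} \<sigma> * ennreal (exp (- \<sigma>\<^sup>2 - ((s * (norm (y - x))\<^sup>2 / 2) / \<sigma>)\<^sup>2)))
          = ennreal (2 / sqrt pi * exp (- \<sigma>\<^sup>2)) * ennreal (exp (- ?s * norm (y - x) ^ 4))"
          unfolding e exp_add 1 2 using True by (simp only: mult.assoc) simp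
      qed
      also have "\<dots> = ennreal (2 / sqrt pi * exp (- \<sigma>\<^sup>2)) * ennreal (?c * ?s powr (- (?p / 2)))"
        using base_measure_quartic[OF \<mu> inv x, where s="?s"] s True
        by (subst nn_integral_cmult) (auto simp: mult.commute)
      also have "?s powr (- (?p / 2)) = (s / (2 * \<sigma>)) powr (- ?p)"
      proof -
        have "?s = (s / (2 * \<sigma>)) powr 2" using s True by simp
        then have "?s powr (- (?p / 2)) = (s / (2 * \<sigma>)) powr (2 * (- (?p / 2)))" by (simp only: powr_powr)
        moreover have "2 * (- (?p / 2)) = - ?p" by (simp add: field_simps)
        ultimately show ?thesis by (simp only:)
      qed
      also have "\<dots> = (2 * \<sigma>) powr ?p * s powr (- ?p)"
        using s True by (simp add: powr_divide powr_minus field_simps)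
      finally have "(\<integral>\<^sup>+y. ennreal (2 / sqrt pi) * (indicator {0<..} \<sigma> * ennreal (exp (- \<sigma>\<^sup>2 - ((s * (norm (y - x))\<^sup>2 / 2) / \<sigma>)\<^sup>2))) \<partial>base_measure \<mu>)
        = ennreal (2 / sqrt pi * exp (- \<sigma>\<^sup>2)) * ennreal (?c * ((2 * \<sigma>) powr ?p * s powr (- ?p)))" .
      also have "\<dots> = ennreal (2 / sqrt pi * exp (- \<sigma>\<^sup>2) * (?c * ((2 * \<sigma>) powr ?p * s powr (- ?p))))"
        by (rule ennreal_mult'[symmetric]) simp
      also have "2 / sqrt pi * exp (- \<sigma>\<^sup>2) * (?c * ((2 * \<sigma>) powr ?p * s powr (- ?p)))
        = 2 / sqrt pi * ?c * exp (- \<sigma>\<^sup>2) * (2 * \<sigma>) powr ?p * s powr (- ?p)" by (simp only: mult_ac)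
      also have "ennreal \<dots> = ennreal (2 / sqrt pi * ?c * exp (- \<sigma>\<^sup>2) * (2 * \<sigma>) powr ?p) * ennreal (s powr (- ?p))"
        using c by (intro ennreal_mult') (intro mult_nonneg_nonneg, auto)
      finally show ?thesis using True by (simp only: greaterThan_iff indicator_simps mult_1_left)
    qed simp
  qed
  also have "\<dots> = gauss_mass CARD('n) * ennreal (s powr (- ?p))"
    unfolding gauss_mass_def by (subst nn_integral_multc) (auto simp: mult_ac add.commute)
  finally show ?thesis by simp
qed

lemma sqrt_kdist4_0_le: "sqrt (kdist4 z 0) \<le> (norm (fst z))\<^sup>2 + \<bar>snd z\<bar>"
proof -
  have "kdist4 z 0 = ((norm (fst z))\<^sup>2)\<^sup>2 + \<bar>snd z\<bar>\<^sup>2" by (simp add: kdist4_def flip: power_mult)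
  also have "\<dots> \<le> ((norm (fst z))\<^sup>2 + \<bar>snd z\<bar>)\<^sup>2" by (simp add: power2_sum)
  finally show ?thesis by (intro real_le_lsqrt) auto
qed

text \<open>
  On the slab \<open>0 \<le> t < 1\<close> the quantity \<open>|y|\<^sup>2\<close> differs from the squared gauge by less than 1.
\<close>

lemma base_measure_gauss_le:
  fixes \<mu> :: "'n::finite heis measure"
  assumes sets [measurable_cong]: "sets \<mu> = sets borel" and [measurable]: "f \<in> borel_measurable borel"
  shows "(\<integral>\<^sup>+y. f y * ennreal (exp (- 1 * (norm y)\<^sup>2)) \<partial>base_measure \<mu>)
    \<le> ennreal (exp 1) * (\<integral>\<^sup>+z. f (fst z) * ennreal (exp (- 1 * sqrt (kdist4 z 0))) \<partial>\<mu>)"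
proof -
  have "(\<integral>\<^sup>+y. f y * ennreal (exp (- 1 * (norm y)\<^sup>2)) \<partial>base_measure \<mu>)
    = (\<integral>\<^sup>+z. indicator {0..<1} (snd z) * (f (fst z) * ennreal (exp (- 1 * (norm (fst z))\<^sup>2))) \<partial>\<mu>)"
    by (rule nn_integral_base_measure[OF sets]) measurable
  also have "\<dots> \<le> (\<integral>\<^sup>+z. ennreal (exp 1) * (f (fst z) * ennreal (exp (- 1 * sqrt (kdist4 z 0)))) \<partial>\<mu>)"
  proof (rule nn_integral_mono)
    fix z :: "'n heis"
    show "indicator {0..<1} (snd z) * (f (fst z) * ennreal (exp (- 1 * (norm (fst z))\<^sup>2)))
      \<le> ennreal (exp 1) * (f (fst z) * ennreal (exp (- 1 * sqrt (kdist4 z 0))))"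
    proof (cases "snd z \<in> {0..<1}")
      case True
      then have "exp (- 1 * (norm (fst z))\<^sup>2) \<le> exp 1 * exp (- 1 * sqrt (kdist4 z 0))"
        using sqrt_kdist4_0_le[of z] by (simp flip: exp_add)
      then have "ennreal (exp (- 1 * (norm (fst z))\<^sup>2)) \<le> ennreal (exp 1) * ennreal (exp (- 1 * sqrt (kdist4 z 0)))"
        by (simp flip: ennreal_mult')
      then have "f (fst z) * ennreal (exp (- 1 * (norm (fst z))\<^sup>2)) \<le> f (fst z) * (ennreal (exp 1) * ennreal (exp (- 1 * sqrt (kdist4 z 0))))"
        by (rule mult_left_mono) simp
      then show ?thesis using True by (simp add: mult_ac)
    qed simp
  qed
  also have "\<dots> = ennreal (exp 1) * (\<integral>\<^sup>+z. f (fst z) * ennreal (exp (- 1 * sqrt (kdist4 z 0))) \<partial>\<mu>)"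
    by (rule nn_integral_cmult) measurable
  finally show ?thesis .
qed

lemma kball_sqrt_kdist4: "Y > 0 \<Longrightarrow> {z. sqrt (kdist4 z 0) \<le> Y} = kball (sqrt Y) 0"
proof -
  assume Y: "Y > 0"
  have "(sqrt Y) ^ 4 = Y\<^sup>2" using Y by (metis mult_2_right numeral_Bit0 power_mult real_sqrt_pow2 less_imp_le mult_2)
  moreover have "sqrt (kdist4 z 0) \<le> Y \<longleftrightarrow> kdist4 z 0 \<le> Y\<^sup>2" for z :: "'a::finite heis"
    using real_sqrt_le_iff[of "kdist4 z 0" "Y\<^sup>2"] Y by simp
  ultimately show ?thesis using Y by (simp add: kball_kdist4)
qed

lemma sqrt_power_powr: "Y > 0 \<Longrightarrow> sqrt Y ^ k = Y powr (real k / 2)"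
  by (simp add: powr_powr flip: powr_half_sqrt powr_realpow)

text \<open>
  Finiteness comes from the polynomial growth of \<open>\<mu>\<close> and positivity from \<open>base_measure_quartic\<close>, so
  the integral that defines \<open>gauss_mass\<close> need not be estimated.
\<close>

lemma gauss_mass_finite:
  fixes \<mu> :: "'n::finite heis measure"
  assumes \<mu>: "uniform_measure (2 * CARD('n) + 1) \<mu>" and inv: "vertically_invariant (msupp \<mu>)"
  obtains K where "K > 0" "gauss_mass CARD('n) = ennreal K"
proof -
  note sets [measurable_cong] = uniform_measureD(1)[OF \<mu>]
  let ?m = "2 * CARD('n) + 1"
  have 0: "(0, 0) \<in> msupp \<mu>" using uniform_measureD(2)[OF \<mu>] by (simp add: zero_prod_def)
  have sf: "sigma_finite_measure \<mu>"
    by (rule sigma_finite_of_kballs[OF sets, of 0]) (use uniform_measureD(2,3)[OF \<mu>] in auto)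
  have eq: "gauss_mass CARD('n) = (\<integral>\<^sup>+y. 1 * ennreal (exp (- 1 * (norm y)\<^sup>2)) \<partial>base_measure \<mu>)"
    using base_measure_gauss_nn[OF \<mu> inv 0, where s=1] by simp
  also have "\<dots> \<le> ennreal (exp 1) * (\<integral>\<^sup>+z. 1 * ennreal (exp (- 1 * sqrt (kdist4 z 0))) \<partial>\<mu>)"
    by (rule base_measure_gauss_le[OF sets]) simp
  also have "(\<integral>\<^sup>+z. 1 * ennreal (exp (- 1 * sqrt (kdist4 z 0))) \<partial>\<mu>) = 1 * ennreal (Gamma (?m / 2 + 1) * 1 powr (- (?m / 2)))"
  proof (rule nn_integral_exp_homogeneous[OF sf])
    fix Y :: real assume Y: "Y > 0"
    then show "(\<integral>\<^sup>+z. 1 * indicator {z. sqrt (kdist4 z 0) \<le> Y} z \<partial>\<mu>) = 1 * ennreal (Y powr (?m / 2))"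
      using uniform_measureD(3)[OF \<mu> uniform_measureD(2)[OF \<mu>], of "sqrt Y"]
      by (simp add: kball_sqrt_kdist4 sets sqrt_power_powr del: power_Suc power_add)
  qed (auto simp: kdist4_nonneg)
  finally have fin: "gauss_mass CARD('n) < \<infinity>"
    by (rule order_le_less_trans) (simp add: ennreal_mult_less_top)
  have pos: "gauss_mass CARD('n) \<noteq> 0"
  proof
    assume "gauss_mass CARD('n) = 0"
    then have "AE y in base_measure \<mu>. ennreal (exp (- (norm y)\<^sup>2)) = 0"
      unfolding eq by (subst (asm) nn_integral_0_iff_AE) auto
    then have "AE y in base_measure \<mu>. ennreal (exp (- 1 * norm (y - 0) ^ 4)) = 0"
      by (rule eventually_mono) (metis ennreal_eq_0_iff exp_gt_zero not_le)
    then have "(\<integral>\<^sup>+y. ennreal (exp (- 1 * norm (y - 0) ^ 4)) \<partial>base_measure \<mu>) = 0"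
      by (subst nn_integral_0_iff_AE) auto
    moreover have "(\<integral>\<^sup>+y. ennreal (exp (- 1 * norm (y - 0) ^ 4)) \<partial>base_measure \<mu>)
      = ennreal (Gamma (?m / 4 + 1) / sqrt pi * 1 powr (- ((2 * real CARD('n) - 1) / 4)))"
      by (rule base_measure_quartic[OF \<mu> inv 0]) simp
    moreover have "0 < Gamma (?m / 4 + 1 :: real)" by (intro Gamma_real_pos add_nonneg_pos) auto
    ultimately show False by (simp add: not_le[symmetric])
  qed
  show thesis
  proof (rule that)
    show "gauss_mass CARD('n) = ennreal (enn2real (gauss_mass CARD('n)))" using fin by simp
    show "0 < enn2real (gauss_mass CARD('n))" using fin pos by (simp add: enn2real_positive_iff zero_less_iff_neq_zero)
  qed
qed

lemma nn_integral_dil: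
  fixes \<mu> :: "'n::finite heis measure"
  assumes sets [measurable_cong]: "sets \<mu> = sets borel" and l: "l > 0"
    and cone: "\<forall>l>0. \<forall>A\<in>sets borel. ennreal (1 / l ^ m) * emeasure \<mu> (dil l ` A) = emeasure \<mu> A"
    and [measurable]: "f \<in> borel_measurable borel"
  shows "(\<integral>\<^sup>+z. f z \<partial>\<mu>) = ennreal (l ^ m) * (\<integral>\<^sup>+z. f (dil l z) \<partial>\<mu>)"
proof -
  have dm [measurable]: "dil l \<in> borel_measurable borel" for l :: real
    unfolding dil_def by (intro borel_measurable_continuous_onI continuous_intros)
  have dd: "dil l (dil (1 / l) z) = z" "dil (1 / l) (dil l z) = z" for z :: "'n heis"
    using l by (simp_all add: dil_def power_divide)
  have "distr \<mu> borel (dil (1 / l)) = scale_measure (ennreal (l ^ m)) \<mu>"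
  proof (rule measure_eqI)
    fix A assume "A \<in> sets (distr \<mu> borel (dil (1 / l)))"
    then have A: "A \<in> sets borel" by simp
    have "emeasure (distr \<mu> borel (dil (1 / l))) A = emeasure \<mu> (dil (1 / l) -` A)"
      using A sets_eq_imp_space_eq[OF sets] by (subst emeasure_distr) auto
    also have "dil (1 / l) -` A = dil l ` A"
    proof (intro set_eqI iffI)
      fix z assume "z \<in> dil (1 / l) -` A"
      then show "z \<in> dil l ` A" using dd(1)[of z] by (metis imageI vimageD)
    next
      fix z assume "z \<in> dil l ` A"
      then show "z \<in> dil (1 / l) -` A" by (auto simp: dd)
    qed
    also have "emeasure \<mu> (dil l ` A) = ennreal (l ^ m) * (ennreal (1 / l ^ m) * emeasure \<mu> (dil l ` A))"
      using l by (simp flip: mult.assoc ennreal_mult')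
    also have "\<dots> = ennreal (l ^ m) * emeasure \<mu> A" using cone l A by simp
    finally show "emeasure (distr \<mu> borel (dil (1 / l))) A = emeasure (scale_measure (ennreal (l ^ m)) \<mu>) A"
      using A by (simp add: sets)
  qed (simp add: sets)
  then have "(\<integral>\<^sup>+z. f (dil l z) \<partial>distr \<mu> borel (dil (1 / l))) = ennreal (l ^ m) * (\<integral>\<^sup>+z. f (dil l z) \<partial>\<mu>)"
    by (simp add: nn_integral_scale_measure)
  moreover have "(\<integral>\<^sup>+z. f (dil l z) \<partial>distr \<mu> borel (dil (1 / l))) = (\<integral>\<^sup>+z. f z \<partial>\<mu>)"
    by (subst nn_integral_distr) (auto simp: dd)
  ultimately show ?thesis by simp
qed

text \<open>
  The cone property turns the moment over the unit ball into the moments over all balls around 0,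
  and the Gaussian weight is a superposition of their indicator functions.
\<close>

lemma base_measure_second_moment_le:
  fixes \<mu> :: "'n::finite heis measure"
  assumes \<mu>: "uniform_measure (2 * CARD('n) + 1) \<mu>"
    and cone: "\<forall>l>0. \<forall>A\<in>sets borel. ennreal (1 / l ^ (2 * CARD('n) + 1)) * emeasure \<mu> (dil l ` A) = emeasure \<mu> A"
  shows "(\<integral>\<^sup>+y. ennreal ((v \<bullet> y)\<^sup>2) * ennreal (exp (- 1 * (norm y)\<^sup>2)) \<partial>base_measure \<mu>)
    \<le> ennreal (exp 1 * Gamma ((2 * CARD('n) + 3) / 2 + 1)) * (\<integral>\<^sup>+z. ennreal ((v \<bullet> fst z)\<^sup>2) * indicator (kball 1 0) z \<partial>\<mu>)"
    (is "_ \<le> _ * ?I")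
proof -
  note sets [measurable_cong] = uniform_measureD(1)[OF \<mu>]
  let ?m = "2 * CARD('n) + 1" and ?p = "(2 * real CARD('n) + 3) / 2"
  have sf: "sigma_finite_measure \<mu>"
    by (rule sigma_finite_of_kballs[OF sets, of 0]) (use uniform_measureD(2,3)[OF \<mu>] in auto)
  have "(\<integral>\<^sup>+y. ennreal ((v \<bullet> y)\<^sup>2) * ennreal (exp (- 1 * (norm y)\<^sup>2)) \<partial>base_measure \<mu>)
    \<le> ennreal (exp 1) * (\<integral>\<^sup>+z. ennreal ((v \<bullet> fst z)\<^sup>2) * ennreal (exp (- 1 * sqrt (kdist4 z 0))) \<partial>\<mu>)"
    by (rule base_measure_gauss_le[OF sets]) measurable
  also have "(\<integral>\<^sup>+z. ennreal ((v \<bullet> fst z)\<^sup>2) * ennreal (exp (- 1 * sqrt (kdist4 z 0))) \<partial>\<mu>)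
    = ?I * ennreal (Gamma (?p + 1) * 1 powr (- ?p))"
  proof (rule nn_integral_exp_homogeneous[OF sf])
    fix Y :: real assume Y: "Y > 0"
    have "(\<integral>\<^sup>+z. ennreal ((v \<bullet> fst z)\<^sup>2) * indicator (kball (sqrt Y) 0) z \<partial>\<mu>)
      = ennreal (sqrt Y ^ ?m) * (\<integral>\<^sup>+z. ennreal ((v \<bullet> fst (dil (sqrt Y) z))\<^sup>2) * indicator (kball (sqrt Y) 0) (dil (sqrt Y) z) \<partial>\<mu>)"
      by (rule nn_integral_dil[OF sets _ cone]) (use Y in auto)
    also have "\<dots> = ennreal (sqrt Y ^ ?m) * (\<integral>\<^sup>+z. ennreal Y * (ennreal ((v \<bullet> fst z)\<^sup>2) * indicator (kball 1 0) z) \<partial>\<mu>)"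
    proof (rule arg_cong2[where f="(*)", OF refl nn_integral_cong])
      fix z :: "'n heis"
      have "koranyi_dist (dil (sqrt Y) z) 0 = sqrt Y * koranyi_dist z 0"
        using koranyi_dist_dil[of "sqrt Y" z 0] Y by (simp add: dil_def zero_prod_def)
      then have "dil (sqrt Y) z \<in> kball (sqrt Y) 0 \<longleftrightarrow> z \<in> kball 1 0"
        using Y by (simp add: kball_def)
      moreover have "(v \<bullet> fst (dil (sqrt Y) z))\<^sup>2 = Y * (v \<bullet> fst z)\<^sup>2"
        using Y by (simp add: dil_def power_mult_distrib)
      ultimately show "ennreal ((v \<bullet> fst (dil (sqrt Y) z))\<^sup>2) * indicator (kball (sqrt Y) 0) (dil (sqrt Y) z)
        = ennreal Y * (ennreal ((v \<bullet> fst z)\<^sup>2) * indicator (kball 1 0) z)"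
        using Y by (simp add: ennreal_mult' indicator_def)
    qed
    also have "\<dots> = ennreal (sqrt Y ^ ?m) * (ennreal Y * ?I)"
      by (subst nn_integral_cmult) auto
    also have "\<dots> = ?I * ennreal (sqrt Y ^ ?m * Y)"
      using Y by (simp add: ennreal_mult' mult_ac)
    also have "sqrt Y ^ ?m * Y = Y powr ?p"
    proof -
      have "sqrt Y ^ ?m = Y powr (?m / 2)"
        using Y by (rule sqrt_power_powr)
      then have "sqrt Y ^ ?m * Y = Y powr (?m / 2) * Y powr 1" using Y by simp
      also have "\<dots> = Y powr ?p" unfolding powr_add[symmetric]
        by (rule arg_cong[where f="\<lambda>e. Y powr e"]) (simp add: field_simps)
      finally show ?thesis .
    qed
    finally show "(\<integral>\<^sup>+z. ennreal ((v \<bullet> fst z)\<^sup>2) * indicator {z. sqrt (kdist4 z 0) \<le> Y} z \<partial>\<mu>) = ?I * ennreal (Y powr ?p)"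
      using Y by (simp add: kball_sqrt_kdist4)
  qed (auto simp: kdist4_nonneg)
  also have "ennreal (exp 1) * (?I * ennreal (Gamma (?p + 1) * 1 powr (- ?p)))
    = ennreal (exp 1 * Gamma ((2 * CARD('n) + 3) / 2 + 1)) * ?I"
    by (simp add: ennreal_mult' mult_ac)
  finally show ?thesis .
qed

section \<open>Rigidity of second and fourth moments\<close>

text \<open>
  The inner product of tensors of order four.
\<close>

definition ip4 :: "('k::finite \<Rightarrow> 'k \<Rightarrow> 'k \<Rightarrow> 'k \<Rightarrow> real) \<Rightarrow> ('k \<Rightarrow> 'k \<Rightarrow> 'k \<Rightarrow> 'k \<Rightarrow> real) \<Rightarrow> real" where
  "ip4 A B = (\<Sum>i\<in>UNIV. \<Sum>j\<in>UNIV. \<Sum>k\<in>UNIV. \<Sum>l\<in>UNIV. A i j k l * B i j k l)"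

lemma ip4_cartesian: "ip4 A B = (\<Sum>(i, j, k, l)\<in>UNIV. A i j k l * B i j k l)"
  by (simp add: ip4_def sum.cartesian_product UNIV_Times_UNIV[symmetric] case_prod_beta del: UNIV_Times_UNIV)

lemma ip4_Cauchy_Schwarz: "(ip4 A B)\<^sup>2 \<le> ip4 A A * ip4 B B"
proof -
  have "(\<Sum>q\<in>UNIV. (case q of (i, j, k, l) \<Rightarrow> A i j k l) * (case q of (i, j, k, l) \<Rightarrow> B i j k l))\<^sup>2
    \<le> (\<Sum>q\<in>UNIV. (case q of (i, j, k, l) \<Rightarrow> A i j k l)\<^sup>2) * (\<Sum>q\<in>UNIV. (case q of (i, j, k, l) \<Rightarrow> B i j k l)\<^sup>2)"
    by (rule Cauchy_Schwarz_ineq_sum)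
  then show ?thesis by (simp add: ip4_cartesian case_prod_beta power2_eq_square)
qed

lemma ip4_diff_left: "ip4 (\<lambda>i j k l. A i j k l - B i j k l) C = ip4 A C - ip4 B C"
  by (simp add: ip4_def left_diff_distrib sum_subtractf)

lemma ip4_commute: "ip4 A B = ip4 B A"
  by (simp add: ip4_def mult.commute)

lemma ip4_product:
  "ip4 (\<lambda>i j k l. a i j * b k l) (\<lambda>i j k l. c i j * e k l)
    = (\<Sum>i\<in>UNIV. \<Sum>j\<in>UNIV. a i j * c i j) * (\<Sum>k\<in>UNIV. \<Sum>l\<in>UNIV. b k l * e k l)"
proof -
  have "ip4 (\<lambda>i j k l. a i j * b k l) (\<lambda>i j k l. c i j * e k l)
    = (\<Sum>i\<in>UNIV. \<Sum>j\<in>UNIV. (a i j * c i j) * (\<Sum>k\<in>UNIV. \<Sum>l\<in>UNIV. b k l * e k l))"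
    unfolding ip4_def sum_distrib_left by (simp add: mult_ac)
  then show ?thesis by (simp add: sum_distrib_right)
qed

lemma ip4_swap_jk: "ip4 A B = ip4 (\<lambda>i k j l. A i j k l) (\<lambda>i k j l. B i j k l)"
  unfolding ip4_def by (rule sum.cong[OF refl]) (rule sum.swap)

lemma ip4_swap_jl: "ip4 A B = ip4 (\<lambda>i l k j. A i j k l) (\<lambda>i l k j. B i j k l)"
proof -
  have "(\<Sum>j\<in>UNIV. \<Sum>k\<in>UNIV. \<Sum>l\<in>UNIV. f j k l) = (\<Sum>l\<in>UNIV. \<Sum>k\<in>UNIV. \<Sum>j\<in>UNIV. f j k l)"
    for f :: "'a \<Rightarrow> 'a \<Rightarrow> 'a \<Rightarrow> real"
    by (subst sum.swap, subst (2) sum.swap, subst sum.swap) (rule refl)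
  then show ?thesis unfolding ip4_def by (rule sum.cong[OF refl])
qed

definition qf :: "('k::finite \<Rightarrow> 'k \<Rightarrow> real) \<Rightarrow> real ^ 'k \<Rightarrow> real" where
  "qf R y = (\<Sum>i\<in>UNIV. \<Sum>j\<in>UNIV. R i j * (y $ i * y $ j))"

lemma ip4_qf: "ip4 (\<lambda>i j k l. y $ i * y $ j * (y $ k * y $ l)) (\<lambda>i j k l. R i j * R k l) = (qf R y)\<^sup>2"
  using ip4_product[of "\<lambda>i j. y $ i * y $ j" "\<lambda>i j. y $ i * y $ j" R R]
  by (simp add: qf_def power2_eq_square mult.commute)

lemma qf_outer: "qf (\<lambda>i j. u $ i * u $ j) y = (u \<bullet> y)\<^sup>2"
  by (simp add: qf_def power2_eq_square inner_vec_def sum_product mult_ac)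

lemma qf_Cauchy_Schwarz: "(qf R y)\<^sup>2 \<le> (\<Sum>i\<in>UNIV. \<Sum>j\<in>UNIV. (R i j)\<^sup>2) * norm y ^ 4"
proof -
  have "(qf R y)\<^sup>2 = (\<Sum>(i, j)\<in>UNIV. R i j * (y $ i * y $ j))\<^sup>2"
    by (simp add: qf_def sum.cartesian_product)
  also have "\<dots> = (\<Sum>q\<in>UNIV. (case q of (i, j) \<Rightarrow> R i j) * (case q of (i, j) \<Rightarrow> y $ i * y $ j))\<^sup>2"
    by (simp add: case_prod_beta)
  also have "\<dots> \<le> (\<Sum>q\<in>UNIV. (case q of (i, j) \<Rightarrow> R i j)\<^sup>2) * (\<Sum>q\<in>UNIV. (case q of (i, j) \<Rightarrow> y $ i * y $ j)\<^sup>2)"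
    by (rule Cauchy_Schwarz_ineq_sum)
  also have "(\<Sum>q\<in>UNIV. (case q of (i, j) \<Rightarrow> R i j)\<^sup>2) = (\<Sum>i\<in>UNIV. \<Sum>j\<in>UNIV. (R i j)\<^sup>2)"
    by (simp add: sum.cartesian_product case_prod_beta)
  also have "(\<Sum>q\<in>UNIV. (case q of (i, j) \<Rightarrow> y $ i * y $ j)\<^sup>2) = norm y ^ 4"
  proof -
    have "(\<Sum>q\<in>UNIV. (case q of (i, j) \<Rightarrow> y $ i * y $ j)\<^sup>2) = (\<Sum>i\<in>UNIV. \<Sum>j\<in>UNIV. (y $ i * y $ j)\<^sup>2)"
      by (simp add: sum.cartesian_product case_prod_beta)
    also have "\<dots> = (y \<bullet> y)\<^sup>2"
      by (simp add: inner_vec_def power2_eq_square sum_product mult_ac)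
    also have "\<dots> = norm y ^ 4" by (simp add: dot_square_norm flip: power_mult)
    finally show ?thesis .
  qed
  finally show ?thesis .
qed

locale unit_normal =
  fixes m :: "real ^ 'k::finite"
  assumes unit: "m \<bullet> m = 1"
begin

text \<open>
  The orthogonal projection onto the hyperplane orthogonal to \<open>m\<close> and, built from it, the tensor of
  fourth moments of the normalised Gaussian weight on that hyperplane.
\<close>

definition P :: "'k \<Rightarrow> 'k \<Rightarrow> real" where "P i j = (if i = j then 1 else 0) - m $ i * m $ j"

definition F :: "'k \<Rightarrow> 'k \<Rightarrow> 'k \<Rightarrow> 'k \<Rightarrow> real" where
  "F i j k l = (P i j * P k l + P i k * P j l + P i l * P j k) / 4"

lemma P_sym: "P i j = P j i" by (simp add: P_def mult.commute)

lemma P_apply: "(\<Sum>j\<in>UNIV. P i j * f j) = f i - m $ i * (\<Sum>j\<in>UNIV. m $ j * f j)"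
proof -
  have "P i j * f j = (if i = j then f j else 0) - m $ i * (m $ j * f j)" for j
    by (simp add: P_def algebra_simps)
  then show ?thesis by (simp add: sum_subtractf sum_distrib_left)
qed

lemma m_P: "(\<Sum>j\<in>UNIV. m $ j * P k j) = 0"
proof -
  have "(\<Sum>j\<in>UNIV. P k j * m $ j) = m $ k - m $ k * (\<Sum>j\<in>UNIV. m $ j * m $ j)" by (rule P_apply)
  then show ?thesis using unit by (simp add: inner_vec_def mult.commute)
qed

lemma P_idem: "(\<Sum>j\<in>UNIV. P i j * P k j) = P i k"
  using P_apply[of i "\<lambda>j. P k j"] m_P[of k] by (simp add: P_sym[of i k])

lemma P_trace: "(\<Sum>i\<in>UNIV. P i i) = real CARD('k) - 1"
  using unit by (simp add: P_def sum_subtractf inner_vec_def)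

lemma P_square: "(\<Sum>i\<in>UNIV. \<Sum>j\<in>UNIV. P i j * P i j) = real CARD('k) - 1"
  by (simp add: P_idem P_trace)

lemma qf_P: "qf P y = (norm y)\<^sup>2 - (m \<bullet> y)\<^sup>2"
proof -
  have "qf P y = (\<Sum>i\<in>UNIV. y $ i * (\<Sum>j\<in>UNIV. P i j * y $ j))"
    by (simp add: qf_def sum_distrib_left mult_ac)
  also have "\<dots> = (\<Sum>i\<in>UNIV. y $ i * y $ i) - (\<Sum>i\<in>UNIV. m $ i * y $ i) * (m \<bullet> y)"
    unfolding P_apply by (simp add: right_diff_distrib sum_subtractf sum_distrib_right inner_vec_def mult_ac)
  also have "\<dots> = (norm y)\<^sup>2 - (m \<bullet> y)\<^sup>2"
    unfolding power2_norm_eq_inner by (simp add: inner_vec_def power2_eq_square)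
  finally show ?thesis .
qed

lemma ip4_F: "ip4 F A = (ip4 (\<lambda>i j k l. P i j * P k l) A + ip4 (\<lambda>i j k l. P i k * P j l) A
  + ip4 (\<lambda>i j k l. P i l * P j k) A) / 4"
  by (simp add: ip4_def F_def distrib_right sum.distrib sum_divide_distrib add_divide_distrib)

lemma ip4_F_product:
  assumes sym: "\<And>i j. R i j = R j i"
  shows "ip4 F (\<lambda>i j k l. R i j * R k l)
    = ((\<Sum>i\<in>UNIV. \<Sum>j\<in>UNIV. P i j * R i j)\<^sup>2 + 2 * ip4 (\<lambda>i j k l. P i k * P j l) (\<lambda>i j k l. R i j * R k l)) / 4"
proof -
  have 1: "ip4 (\<lambda>i j k l. P i j * P k l) (\<lambda>i j k l. R i j * R k l) = (\<Sum>i\<in>UNIV. \<Sum>j\<in>UNIV. P i j * R i j)\<^sup>2"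
    by (simp add: ip4_product power2_eq_square)
  have "ip4 (\<lambda>i j k l. P i l * P j k) (\<lambda>i j k l. R i j * R k l)
    = ip4 (\<lambda>i j k l. P i k * P j l) (\<lambda>i j k l. R i j * R k l)"
    unfolding ip4_def
  proof (rule sum.cong[OF refl], rule sum.cong[OF refl])
    fix i j
    show "(\<Sum>k\<in>UNIV. \<Sum>l\<in>UNIV. P i l * P j k * (R i j * R k l)) = (\<Sum>k\<in>UNIV. \<Sum>l\<in>UNIV. P i k * P j l * (R i j * R k l))"
      by (subst sum.swap) (simp add: sym)
  qed
  then show ?thesis by (simp add: ip4_F 1)
qed

lemma ip4_F_outer: "ip4 F (\<lambda>i j k l. y $ i * y $ j * (y $ k * y $ l)) = 3 / 4 * ((norm y)\<^sup>2 - (m \<bullet> y)\<^sup>2)\<^sup>2"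
proof -
  have q: "(\<Sum>i\<in>UNIV. \<Sum>j\<in>UNIV. P i j * (y $ i * y $ j)) = (norm y)\<^sup>2 - (m \<bullet> y)\<^sup>2"
    using qf_P[of y] by (simp add: qf_def)
  have "ip4 (\<lambda>i j k l. P i k * P j l) (\<lambda>i j k l. y $ i * y $ j * (y $ k * y $ l))
    = ip4 (\<lambda>i j k l. P i j * P k l) (\<lambda>i j k l. y $ i * y $ j * (y $ k * y $ l))"
    by (subst ip4_swap_jk) (simp add: mult_ac)
  moreover have "ip4 (\<lambda>i j k l. P i j * P k l) (\<lambda>i j k l. y $ i * y $ j * (y $ k * y $ l))
    = ((norm y)\<^sup>2 - (m \<bullet> y)\<^sup>2)\<^sup>2"
    by (simp add: ip4_product q power2_eq_square)
  ultimately show ?thesis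
    by (subst ip4_F_product[where R="\<lambda>i j. y $ i * y $ j"]) (auto simp: q mult.commute)
qed

lemma ip4_F_F: "ip4 F F = 3 / 16 * (real CARD('k) - 1) * (real CARD('k) + 1)"
proof -
  let ?d = "real CARD('k) - 1"
  let ?A = "\<lambda>i j k l. P i j * P k l" and ?B = "\<lambda>i j k l. P i k * P j l" and ?C = "\<lambda>i j k l. P i l * P j k"
  have AA: "ip4 ?A ?A = ?d\<^sup>2" by (simp add: ip4_product P_square power2_eq_square)
  have BB: "ip4 ?B ?B = ?d\<^sup>2" by (subst ip4_swap_jk) (rule AA)
  have CC: "ip4 ?C ?C = ?d\<^sup>2"
    by (subst ip4_swap_jl) (use AA in \<open>simp add: P_sym\<close>)
  have AB: "ip4 ?A ?B = ?d"
  proof -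
    have "ip4 ?A ?B = (\<Sum>i\<in>UNIV. \<Sum>j\<in>UNIV. \<Sum>k\<in>UNIV. P i j * P i k * (\<Sum>l\<in>UNIV. P k l * P j l))"
      unfolding ip4_def sum_distrib_left by (simp add: mult_ac)
    also have "\<dots> = (\<Sum>i\<in>UNIV. \<Sum>j\<in>UNIV. P i j * (\<Sum>k\<in>UNIV. P i k * P j k))"
    proof (intro sum.cong refl)
      fix i j
      have "(\<Sum>k\<in>UNIV. P i j * P i k * (\<Sum>l\<in>UNIV. P k l * P j l)) = (\<Sum>k\<in>UNIV. P i j * (P i k * P j k))"
        unfolding P_idem by (simp only: mult.assoc P_sym[of j])
      then show "(\<Sum>k\<in>UNIV. P i j * P i k * (\<Sum>l\<in>UNIV. P k l * P j l)) = P i j * (\<Sum>k\<in>UNIV. P i k * P j k)"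
        by (simp only: sum_distrib_left)
    qed
    also have "\<dots> = ?d" unfolding P_idem by (rule P_trace)
    finally show ?thesis .
  qed
  have AC: "ip4 ?A ?C = ?d"
  proof -
    have "ip4 ?A ?C = ip4 ?A ?B"
      unfolding ip4_def
    proof (rule sum.cong[OF refl], rule sum.cong[OF refl])
      fix i j
      show "(\<Sum>k\<in>UNIV. \<Sum>l\<in>UNIV. P i j * P k l * (P i l * P j k)) = (\<Sum>k\<in>UNIV. \<Sum>l\<in>UNIV. P i j * P k l * (P i k * P j l))"
        by (subst sum.swap) (simp add: P_sym)
    qed
    then show ?thesis by (simp only: AB)
  qed
  have BC: "ip4 ?B ?C = ?d"
    by (subst ip4_swap_jk) (use AC in \<open>simp add: P_sym\<close>)
  have "ip4 F F = (ip4 F ?A + ip4 F ?B + ip4 F ?C) / 4"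
    unfolding ip4_F[of F] by (simp add: ip4_commute[of F])
  also have "ip4 F ?A = (?d\<^sup>2 + ?d + ?d) / 4"
    unfolding ip4_F AA ip4_commute[of ?B ?A] ip4_commute[of ?C ?A] AB AC by simp
  also have "ip4 F ?B = (?d + ?d\<^sup>2 + ?d) / 4"
    unfolding ip4_F BB AB ip4_commute[of ?C ?B] BC by simp
  also have "ip4 F ?C = (?d + ?d + ?d\<^sup>2) / 4"
    unfolding ip4_F AC BC CC by simp
  finally show ?thesis by (simp add: power2_eq_square field_simps)
qed

end

lemma integrable_poly_growth:
  fixes f :: "real ^ 'k::finite \<Rightarrow> real"
  assumes "finite_measure \<rho>" "sets \<rho> = sets borel" and int: "integrable \<rho> (\<lambda>y. norm y ^ N)"
    and f: "continuous_on UNIV f" and le: "\<And>y. \<bar>f y\<bar> \<le> C * (1 + norm y ^ N)"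
  shows "integrable \<rho> f"
proof -
  interpret finite_measure \<rho> by fact
  note [measurable_cong] = assms(2)
  have [measurable]: "f \<in> borel_measurable borel" using f by (rule borel_measurable_continuous_onI)
  show ?thesis
  proof (rule Bochner_Integration.integrable_bound)
    show "integrable \<rho> (\<lambda>y. C * (1 + norm y ^ N))" using int by simp
    show "AE y in \<rho>. norm (f y) \<le> norm (C * (1 + norm y ^ N))" using le by (auto intro: order_trans[OF _ abs_ge_self])
  qed simp
qed

lemma power_le_1_add:
  fixes a :: real
  assumes "a \<ge> 0" "k \<le> N"
  shows "a ^ k \<le> 1 + a ^ N"
proof (cases "a \<le> 1")
  case True
  then have "a ^ k \<le> 1" using assms by (simp add: power_le_one)
  then show ?thesis using assms by (simp add: add_increasing2)
next
  case False
  then have "a ^ k \<le> a ^ N" using assms by (intro power_increasing) auto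
  then show ?thesis by simp
qed

text \<open>
  The measures \<open>\<rho>\<close> that share the radial moments of orders 2, 4, 6 and, at the points of their own support, the
  second and fourth directional moments with the normalised Gaussian weight on a hyperplane.
\<close>

locale rigid_moments =
  fixes \<rho> :: "(real ^ 'k::finite) measure" and d :: real
  assumes fin: "finite_measure \<rho>" and sets_rho: "sets \<rho> = sets borel"
    and d: "d = real CARD('k) - 1" "d > 0"
    and int6: "integrable \<rho> (\<lambda>y. norm y ^ 6)"
    and rad2: "(\<integral>y. (norm y)\<^sup>2 \<partial>\<rho>) = d / 2"
    and rad4: "(\<integral>y. norm y ^ 4 \<partial>\<rho>) = d * (d + 2) / 4"
    and rad6: "(\<integral>y. norm y ^ 6 \<partial>\<rho>) = d * (d + 2) * (d + 4) / 8"
    and mom2: "AE u in \<rho>. (\<integral>y. (u \<bullet> y)\<^sup>2 \<partial>\<rho>) = (norm u)\<^sup>2 / 2"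
    and mom4: "AE u in \<rho>. (\<integral>y. (u \<bullet> y) ^ 4 \<partial>\<rho>) = 3 / 4 * norm u ^ 4"
begin

sublocale finite_measure \<rho> by (rule fin)

lemma integrable_of_growth:
  assumes "continuous_on UNIV f" "\<And>y. \<bar>f y\<bar> \<le> C * norm y ^ k" "k \<le> 6" "C \<ge> 0"
  shows "integrable \<rho> f"
proof (rule integrable_poly_growth[OF finite_measure_axioms sets_rho int6 assms(1)])
  fix y
  have "\<bar>f y\<bar> \<le> C * norm y ^ k" by (rule assms)
  also have "\<dots> \<le> C * (1 + norm y ^ 6)" using assms by (intro mult_left_mono power_le_1_add) auto
  finally show "\<bar>f y\<bar> \<le> C * (1 + norm y ^ 6)" .
qed

lemma integrable_norm_power: "k \<le> 6 \<Longrightarrow> integrable \<rho> (\<lambda>y. norm y ^ k)"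
  by (rule integrable_of_growth[where C=1 and k=k]) (auto intro!: continuous_intros)

lemma abs_comp: "\<bar>y $ i\<bar> \<le> norm (y :: real ^ 'k)" by (rule component_le_norm_cart)

lemma integrable_coord2: "integrable \<rho> (\<lambda>y. y $ i * y $ j)"
proof (rule integrable_of_growth[where C=1 and k=2])
  show "\<bar>y $ i * y $ j\<bar> \<le> 1 * (norm y)\<^sup>2" for y
    using mult_mono[OF abs_comp[of y i] abs_comp[of y j]] by (simp add: abs_mult power2_eq_square)
qed (auto intro!: continuous_intros)

lemma integrable_coord4: "integrable \<rho> (\<lambda>y. y $ i * y $ j * (y $ k * y $ l))"
proof (rule integrable_of_growth[where C=1 and k=4])
  fix y :: "real ^ 'k"
  have "\<bar>y $ i * y $ j\<bar> \<le> (norm y)\<^sup>2" "\<bar>y $ k * y $ l\<bar> \<le> (norm y)\<^sup>2"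
    using mult_mono[OF abs_comp[of y i] abs_comp[of y j]] mult_mono[OF abs_comp[of y k] abs_comp[of y l]]
    by (simp_all add: abs_mult power2_eq_square)
  then have "\<bar>y $ i * y $ j\<bar> * \<bar>y $ k * y $ l\<bar> \<le> (norm y)\<^sup>2 * (norm y)\<^sup>2" by (intro mult_mono) auto
  then show "\<bar>y $ i * y $ j * (y $ k * y $ l)\<bar> \<le> 1 * norm y ^ 4"
    by (simp only: abs_mult[of "y $ i * y $ j"] mult_1_left power_add[symmetric]) simp
qed (auto intro!: continuous_intros)

definition M :: "'k \<Rightarrow> 'k \<Rightarrow> real" where "M i j = (\<integral>y. y $ i * y $ j \<partial>\<rho>)"

definition T :: "'k \<Rightarrow> 'k \<Rightarrow> 'k \<Rightarrow> 'k \<Rightarrow> real" where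
  "T i j k l = (\<integral>y. y $ i * y $ j * (y $ k * y $ l) \<partial>\<rho>)"

lemma M_sym: "M i j = M j i" by (simp add: M_def mult.commute)

lemma M_contract: "(\<Sum>i\<in>UNIV. \<Sum>j\<in>UNIV. R i j * M i j) = (\<integral>y. qf R y \<partial>\<rho>)"
  unfolding M_def qf_def by (simp add: integrable_coord2)

lemma T_contract: "ip4 A T = (\<integral>y. ip4 A (\<lambda>i j k l. y $ i * y $ j * (y $ k * y $ l)) \<partial>\<rho>)"
  unfolding T_def ip4_def by (simp add: integrable_coord4)

definition b :: "real ^ 'k \<Rightarrow> real" where "b u = (\<integral>y. (u \<bullet> y)\<^sup>2 \<partial>\<rho>)"

lemma qf_M: "qf M u = b u"
proof -
  have "qf M u = (\<Sum>i\<in>UNIV. \<Sum>j\<in>UNIV. (u $ i * u $ j) * M i j)" by (simp add: qf_def mult.commute)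
  also have "\<dots> = b u" unfolding M_contract qf_outer b_def ..
  finally show ?thesis .
qed

lemma continuous_b: "continuous_on A b"
  unfolding qf_M[symmetric] qf_def by (intro continuous_intros)

lemma M_trace: "(\<Sum>i\<in>UNIV. M i i) = d / 2"
proof -
  have "(\<Sum>i\<in>UNIV. M i i) = (\<integral>y. (\<Sum>i\<in>UNIV. y $ i * y $ i) \<partial>\<rho>)"
    unfolding M_def by (simp add: integrable_coord2)
  then show ?thesis using rad2 by (simp add: power2_norm_eq_inner inner_vec_def)
qed

lemma M_M: "(\<Sum>i\<in>UNIV. \<Sum>j\<in>UNIV. M i j * M i j) = d / 4"
proof -
  have "(\<Sum>i\<in>UNIV. \<Sum>j\<in>UNIV. M i j * M i j) = (\<integral>y. b y \<partial>\<rho>)" unfolding M_contract qf_M ..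
  also have "\<dots> = (\<integral>y. (norm y)\<^sup>2 / 2 \<partial>\<rho>)"
  proof (rule integral_cong_AE)
    have "b \<in> borel_measurable borel" by (rule borel_measurable_continuous_onI[OF continuous_b])
    then show "b \<in> borel_measurable \<rho>" using sets_rho by (simp cong: measurable_cong_sets)
    show "AE y in \<rho>. b y = (norm y)\<^sup>2 / 2" unfolding b_def by (rule mom2)
  qed (simp add: sets_rho cong: measurable_cong_sets)
  also have "\<dots> = d / 4" using rad2 by simp
  finally show ?thesis .
qed

text \<open>
  Contracting the moment tensor with \<open>u \<otimes> u \<otimes> u \<otimes> u\<close> gives the fourth moment in direction \<open>u\<close>, which
  is known on the support; its integral over \<open>u\<close> is the squared norm of the tensor.
\<close>

lemma T_T: "ip4 T T = 3 / 16 * (d * (d + 2))"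
proof -
  have "ip4 T T = (\<integral>u. ip4 T (\<lambda>i j k l. u $ i * u $ j * (u $ k * u $ l)) \<partial>\<rho>)" by (rule T_contract)
  also have "\<dots> = (\<integral>u. 3 / 4 * norm u ^ 4 \<partial>\<rho>)"
  proof (rule integral_cong_AE)
    have "(\<lambda>u. ip4 T (\<lambda>i j k l. u $ i * u $ j * (u $ k * u $ l))) \<in> borel_measurable borel"
      unfolding ip4_def by (intro borel_measurable_continuous_onI continuous_intros)
    then show "(\<lambda>u. ip4 T (\<lambda>i j k l. u $ i * u $ j * (u $ k * u $ l))) \<in> borel_measurable \<rho>"
      using sets_rho by (simp cong: measurable_cong_sets)
    have "ip4 T (\<lambda>i j k l. u $ i * u $ j * (u $ k * u $ l)) = (\<integral>y. (u \<bullet> y) ^ 4 \<partial>\<rho>)" for u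
    proof -
      have "ip4 T (\<lambda>i j k l. u $ i * u $ j * (u $ k * u $ l))
        = (\<integral>y. ip4 (\<lambda>i j k l. u $ i * u $ j * (u $ k * u $ l)) (\<lambda>i j k l. y $ i * y $ j * (y $ k * y $ l)) \<partial>\<rho>)"
        by (subst ip4_commute) (rule T_contract)
      moreover have "ip4 (\<lambda>i j k l. u $ i * u $ j * (u $ k * u $ l)) (\<lambda>i j k l. y $ i * y $ j * (y $ k * y $ l)) = (u \<bullet> y) ^ 4" for y
        using ip4_qf[of u "\<lambda>i j. y $ i * y $ j"] qf_outer[of y u] by (simp add: inner_commute flip: power_mult)
      ultimately show ?thesis by simp
    qed
    then show "AE u in \<rho>. ip4 T (\<lambda>i j k l. u $ i * u $ j * (u $ k * u $ l)) = 3 / 4 * norm u ^ 4"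
      using mom4 by simp
  qed (simp add: sets_rho cong: measurable_cong_sets)
  also have "\<dots> = 3 / 16 * (d * (d + 2))" using rad4 by simp
  finally show ?thesis .
qed

text \<open>
  A unit vector that minimises the quadratic form of second moments is an eigenvector of its matrix.
\<close>

lemma exists_min_direction:
  obtains m where "m \<bullet> m = 1" "\<And>u. u \<bullet> u = 1 \<Longrightarrow> b m \<le> b u" "\<And>i. (\<Sum>j\<in>UNIV. M i j * m $ j) = b m * m $ i"
proof -
  have "sphere (0 :: real ^ 'k) 1 \<noteq> {}" by simp
  then obtain m where m: "m \<in> sphere 0 1" "\<And>u. u \<in> sphere 0 1 \<Longrightarrow> b m \<le> b u"
    using continuous_attains_inf[OF compact_sphere _ continuous_b] by metis
  have sph: "u \<in> sphere 0 1 \<longleftrightarrow> u \<bullet> u = 1" for u :: "real ^ 'k"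
    by (simp add: norm_eq_sqrt_inner)
  have mm: "m \<bullet> m = 1" using m sph by blast
  define B where "B u v = (\<integral>y. (u \<bullet> y) * (v \<bullet> y) \<partial>\<rho>)" for u v
  have Bint: "integrable \<rho> (\<lambda>y. (u \<bullet> y) * (v \<bullet> y))" for u v
  proof (rule integrable_of_growth[where C="norm u * norm v" and k=2])
    fix y
    have "\<bar>u \<bullet> y\<bar> * \<bar>v \<bullet> y\<bar> \<le> (norm u * norm y) * (norm v * norm y)"
      by (intro mult_mono Cauchy_Schwarz_ineq2) auto
    then show "\<bar>u \<bullet> y * (v \<bullet> y)\<bar> \<le> norm u * norm v * (norm y)\<^sup>2"
      by (simp add: abs_mult power2_eq_square mult_ac)
  qed (auto intro!: continuous_intros)
  have bhom: "b m * (u \<bullet> u) \<le> b u" for u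
  proof (cases "u = 0")
    case False
    define n where "n = norm u"
    have n: "n > 0" using False by (simp add: n_def)
    have "b ((1 / n) *\<^sub>R u) = b u / n\<^sup>2" by (simp add: b_def power_divide)
    moreover have "(1 / n) *\<^sub>R u \<in> sphere 0 1" using n by (simp add: n_def)
    ultimately have "b m \<le> b u / n\<^sup>2" using m(2) by metis
    then show ?thesis using n by (simp add: n_def field_simps dot_square_norm)
  qed (simp add: b_def)
  have lin: "B m v = b m * (m \<bullet> v)" for v
  proof (rule ccontr)
    define c where "c = B m v - b m * (m \<bullet> v)"
    assume "B m v \<noteq> b m * (m \<bullet> v)"
    then have c: "c \<noteq> 0" by (simp add: c_def)
    have exp: "b (m + s *\<^sub>R v) = b m + 2 * s * B m v + s\<^sup>2 * b v" for s
    proof -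
      have "b (m + s *\<^sub>R v) = (\<integral>y. (m \<bullet> y) * (m \<bullet> y) + (2 * s) * ((m \<bullet> y) * (v \<bullet> y)) + s\<^sup>2 * ((v \<bullet> y) * (v \<bullet> y)) \<partial>\<rho>)"
        unfolding b_def by (intro Bochner_Integration.integral_cong refl)
          (simp add: inner_add_left power2_eq_square algebra_simps)
      also have "\<dots> = b m + 2 * s * B m v + s\<^sup>2 * b v"
        using Bint[of m m] Bint[of m v] Bint[of v v] by (simp add: b_def B_def power2_eq_square)
      finally show ?thesis .
    qed
    define q where "q = b v - b m * (v \<bullet> v)"
    have "0 \<le> 2 * s * c + s\<^sup>2 * q" for s
      using bhom[of "m + s *\<^sub>R v"] mm unfolding exp c_def q_def
      by (simp add: inner_add_left inner_add_right inner_commute power2_eq_square algebra_simps)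
    \<comment> \<open>A small step against the slope \<open>c\<close> would make the expression negative.\<close>
    from this[of "- c / (\<bar>q\<bar> + 1)"] have "0 \<le> - 2 * c\<^sup>2 / (\<bar>q\<bar> + 1) + c\<^sup>2 * q / (\<bar>q\<bar> + 1)\<^sup>2"
      by (simp add: power2_eq_square)
    also have "\<dots> = (c\<^sup>2 / (\<bar>q\<bar> + 1)\<^sup>2) * (q - 2 * (\<bar>q\<bar> + 1))"
    proof -
      have "- 2 * c\<^sup>2 / p + c\<^sup>2 * q / p\<^sup>2 = (c\<^sup>2 / p\<^sup>2) * (q - 2 * p)" if "p \<noteq> 0" for p
        using that by (simp add: field_simps power2_eq_square)
      moreover have "\<bar>q\<bar> + 1 \<noteq> 0" by linarith
      ultimately show ?thesis by blast
    qed
    finally have "0 \<le> (c\<^sup>2 / (\<bar>q\<bar> + 1)\<^sup>2) * (q - 2 * (\<bar>q\<bar> + 1))" .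
    moreover have "c\<^sup>2 / (\<bar>q\<bar> + 1)\<^sup>2 > 0" using c by (intro divide_pos_pos) (auto intro: add_nonneg_pos)
    moreover have "q - 2 * (\<bar>q\<bar> + 1) < 0" by (cases "q \<ge> 0") auto
    ultimately show False using mult_pos_neg by (metis not_le)
  qed
  have "(\<Sum>j\<in>UNIV. M i j * m $ j) = b m * m $ i" for i
  proof -
    have "(\<Sum>j\<in>UNIV. M i j * m $ j) = (\<integral>y. (\<Sum>j\<in>UNIV. (y $ i * y $ j) * m $ j) \<partial>\<rho>)"
      unfolding M_def by (simp add: integrable_coord2)
    also have "(\<lambda>y. (\<Sum>j\<in>UNIV. (y $ i * y $ j) * m $ j)) = (\<lambda>y. (m \<bullet> y) * (axis i 1 \<bullet> y))"
      by (rule ext) (simp add: inner_vec_def[of m] sum_distrib_right sum_distrib_left inner_axis' mult_ac)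
    also have "(\<integral>y. (m \<bullet> y) * (axis i 1 \<bullet> y) \<partial>\<rho>) = b m * (m \<bullet> axis i 1)" using lin[of "axis i 1"] by (simp add: B_def)
    finally show ?thesis by (simp add: inner_axis)
  qed
  then show thesis using that mm m(2) sph by blast
qed

text \<open>
  The matrix \<open>R\<close> has norm \<open>r = \<surd>(2\<epsilon>)\<close> and satisfies \<open>R(y) = - \<langle>m,y\<rangle>\<^sup>2\<close> on the support. The moment tensor
  \<open>T\<close> differs from \<open>F\<close> by at most \<open>\<surd>(3Y)\<close> in norm, where \<open>Y = \<integral> |y|\<^sup>2 \<langle>m,y\<rangle>\<^sup>2 d\<rho>\<close> is small, and \<open>F\<close> is
  positive on \<open>R \<otimes> R\<close>; therefore \<open>\<integral> R(y)\<^sup>2 d\<rho> \<ge> 3\<epsilon>/8\<close>. On the other hand this integral is at most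
  \<open>r Y\<close>, which is of smaller order than \<open>\<epsilon>\<close> because the moments \<open>\<integral> \<langle>m,y\<rangle>\<^sup>2 d\<rho> = \<epsilon>/2\<close> and \<open>\<integral> |y|\<^sup>6 d\<rho>\<close>
  control \<open>Y\<close>.
\<close>

lemma hyperplane_of_small_moment:
  assumes m0: "m0 \<bullet> m0 = 1" and small: "b m0 \<le> \<epsilon>0 / 2"
    and \<epsilon>0: "0 < \<epsilon>0" "\<epsilon>0 \<le> 1" "sqrt (2 * \<epsilon>0) * (d * (d + 2) * (d + 4)) \<le> 1 / 16"
      "sqrt (2 * \<epsilon>0) * (d * (d + 2)) \<le> 1 / 192"
  obtains m where "m \<bullet> m = 1" "AE y in \<rho>. m \<bullet> y = 0"
proof -
  obtain m where m: "m \<bullet> m = 1" and min: "\<And>u. u \<bullet> u = 1 \<Longrightarrow> b m \<le> b u"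
    and eigen: "\<And>i. (\<Sum>j\<in>UNIV. M i j * m $ j) = b m * m $ i"
    using exists_min_direction by metis
  interpret unit_normal m by unfold_locales (rule m)
  define \<epsilon> where "\<epsilon> = 2 * b m"
  have b0: "b u \<ge> 0" for u unfolding b_def by (rule integral_nonneg_AE) simp
  have \<epsilon>: "0 \<le> \<epsilon>" "\<epsilon> \<le> \<epsilon>0" using b0[of m] min[OF m0] small by (auto simp: \<epsilon>_def)
  define R where "R i j = (if i = j then 1 else 0) - 2 * M i j - m $ i * m $ j" for i j
  have Rsym: "R i j = R j i" for i j by (simp add: R_def M_sym mult.commute)
  have mm: "(\<Sum>j\<in>UNIV. m $ j * m $ j) = 1" using m by (simp add: inner_vec_def)
  have Rm: "(\<Sum>j\<in>UNIV. R i j * m $ j) = - \<epsilon> * m $ i" for i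
  proof -
    have "R i j * m $ j = (if i = j then m $ j else 0) - 2 * (M i j * m $ j) - m $ i * (m $ j * m $ j)" for j
      by (simp add: R_def algebra_simps)
    then have "(\<Sum>j\<in>UNIV. R i j * m $ j) = m $ i - 2 * (\<Sum>j\<in>UNIV. M i j * m $ j) - m $ i * (\<Sum>j\<in>UNIV. m $ j * m $ j)"
      by (simp add: sum_subtractf flip: sum_distrib_left)
    then show ?thesis unfolding eigen mm by (simp add: \<epsilon>_def)
  qed
  have RR: "(\<Sum>i\<in>UNIV. \<Sum>j\<in>UNIV. R i j * R i j) = 2 * \<epsilon>"
  proof -
    have e: "(\<Sum>j\<in>UNIV. R i j * R i j) = R i i - 2 * (\<Sum>j\<in>UNIV. R i j * M i j) + \<epsilon> * (m $ i * m $ i)" for i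
    proof -
      have "R i j * R i j = (if i = j then R i j else 0) - 2 * (R i j * M i j) - m $ i * (R i j * m $ j)" for j
      proof -
        have "x * ((if i = j then 1 else 0) - 2 * M i j - m $ i * m $ j)
          = (if i = j then x else 0) - 2 * (x * M i j) - m $ i * (x * m $ j)" for x
          by (simp add: algebra_simps)
        from this[of "R i j"] show ?thesis unfolding R_def[symmetric] .
      qed
      then have "(\<Sum>j\<in>UNIV. R i j * R i j) = R i i - 2 * (\<Sum>j\<in>UNIV. R i j * M i j) - m $ i * (\<Sum>j\<in>UNIV. R i j * m $ j)"
        by (simp add: sum_subtractf flip: sum_distrib_left)
      then show ?thesis unfolding Rm by simp
    qed
    have f: "(\<Sum>j\<in>UNIV. R i j * M i j) = M i i - 2 * (\<Sum>j\<in>UNIV. M i j * M i j) - b m * (m $ i * m $ i)" for i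
    proof -
      have "R i j * M i j = (if i = j then M i j else 0) - 2 * (M i j * M i j) - m $ i * (M i j * m $ j)" for j
        by (simp add: R_def algebra_simps)
      then have "(\<Sum>j\<in>UNIV. R i j * M i j) = M i i - 2 * (\<Sum>j\<in>UNIV. M i j * M i j) - m $ i * (\<Sum>j\<in>UNIV. M i j * m $ j)"
        by (simp add: sum_subtractf flip: sum_distrib_left)
      then show ?thesis unfolding eigen by simp
    qed
    have "(\<Sum>i\<in>UNIV. R i i) = real CARD('k) - 2 * (\<Sum>i\<in>UNIV. M i i) - (\<Sum>i\<in>UNIV. m $ i * m $ i)"
      by (simp add: R_def sum_subtractf sum_distrib_left)
    then have tr: "(\<Sum>i\<in>UNIV. R i i) = 0" unfolding M_trace mm using d by (simp add: field_simps)
    have "(\<Sum>i\<in>UNIV. \<Sum>j\<in>UNIV. R i j * M i j)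
      = (\<Sum>i\<in>UNIV. M i i) - 2 * (\<Sum>i\<in>UNIV. \<Sum>j\<in>UNIV. M i j * M i j) - b m * (\<Sum>i\<in>UNIV. m $ i * m $ i)"
      unfolding f by (simp add: sum_subtractf flip: sum_distrib_left)
    then have RM: "(\<Sum>i\<in>UNIV. \<Sum>j\<in>UNIV. R i j * M i j) = - b m" unfolding M_trace M_M mm by simp
    have "(\<Sum>i\<in>UNIV. \<Sum>j\<in>UNIV. R i j * R i j)
      = (\<Sum>i\<in>UNIV. R i i) - 2 * (\<Sum>i\<in>UNIV. \<Sum>j\<in>UNIV. R i j * M i j) + \<epsilon> * (\<Sum>i\<in>UNIV. m $ i * m $ i)"
      unfolding e by (simp add: sum_subtractf sum.distrib flip: sum_distrib_left)
    then show ?thesis unfolding tr RM mm by (simp add: \<epsilon>_def)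
  qed
  have qR: "qf R y = (norm y)\<^sup>2 - 2 * b y - (m \<bullet> y)\<^sup>2" for y
  proof -
    have "R i j * (y $ i * y $ j) = (if i = j then y $ i * y $ j else 0) - 2 * (M i j * (y $ i * y $ j)) - (m $ i * m $ j) * (y $ i * y $ j)" for i j
      by (simp add: R_def algebra_simps)
    then have "qf R y = (\<Sum>i\<in>UNIV. y $ i * y $ i) - 2 * qf M y - qf (\<lambda>i j. m $ i * m $ j) y"
      unfolding qf_def by (simp add: sum_subtractf flip: sum_distrib_left)
    then show ?thesis unfolding qf_M qf_outer by (simp add: power2_norm_eq_inner inner_vec_def)
  qed
  have on_supp: "AE y in \<rho>. qf R y = - (m \<bullet> y)\<^sup>2"
    using mom2 by eventually_elim (simp add: qR b_def)
  define r where "r = sqrt (2 * \<epsilon>)"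
  have r0: "r \<ge> 0" and r2: "r\<^sup>2 = 2 * \<epsilon>" using \<epsilon> by (simp_all add: r_def)
  have rle: "r \<le> sqrt (2 * \<epsilon>0)" using \<epsilon> by (simp add: r_def)
  have "\<bar>qf R y\<bar> \<le> r * (norm y)\<^sup>2" for y
  proof (rule power2_le_imp_le)
    have "(qf R y)\<^sup>2 \<le> (\<Sum>i\<in>UNIV. \<Sum>j\<in>UNIV. (R i j)\<^sup>2) * norm y ^ 4" by (rule qf_Cauchy_Schwarz)
    also have "\<dots> = (r * (norm y)\<^sup>2)\<^sup>2" using RR r2 by (simp add: power2_eq_square[of "R _ _"] power_mult_distrib)
    finally show "\<bar>qf R y\<bar>\<^sup>2 \<le> (r * (norm y)\<^sup>2)\<^sup>2" by simp
  qed (use r0 in simp)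
  then have narrow: "AE y in \<rho>. (m \<bullet> y)\<^sup>2 \<le> r * (norm y)\<^sup>2"
    using on_supp by (auto elim!: eventually_mono) (metis abs_minus_cancel abs_of_nonneg zero_le_power2)
  define X4 where "X4 = d * (d + 2) / 4"
  define X6 where "X6 = d * (d + 2) * (d + 4) / 8"
  have X: "X4 > 0" "X6 > 0" using d by (simp_all add: X4_def X6_def)
  have my: "(m \<bullet> y)\<^sup>2 \<le> (norm y)\<^sup>2" for y
    using Cauchy_Schwarz_ineq[of m y] m by (simp add: power2_norm_eq_inner)
  have intY: "integrable \<rho> (\<lambda>y. (norm y)\<^sup>2 * (m \<bullet> y)\<^sup>2)"
  proof (rule integrable_of_growth[where C=1 and k=4])
    show "\<bar>(norm y)\<^sup>2 * (m \<bullet> y)\<^sup>2\<bar> \<le> 1 * norm y ^ 4" for y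
      using mult_left_mono[OF my[of y], of "(norm y)\<^sup>2"] by (simp flip: power_add)
  qed (auto intro!: continuous_intros)
  have int2: "integrable \<rho> (\<lambda>y. (m \<bullet> y)\<^sup>2)"
    by (rule integrable_of_growth[where C=1 and k=2]) (use my in \<open>auto intro!: continuous_intros\<close>)
  define Y where "Y = (\<integral>y. (norm y)\<^sup>2 * (m \<bullet> y)\<^sup>2 \<partial>\<rho>)"
  have Y0: "Y \<ge> 0" unfolding Y_def by (rule integral_nonneg_AE) simp
  have Y1: "Y \<le> r * X4"
  proof -
    have "Y \<le> (\<integral>y. r * norm y ^ 4 \<partial>\<rho>)"
      unfolding Y_def
    proof (rule integral_mono_AE[OF intY])
      show "integrable \<rho> (\<lambda>y. r * norm y ^ 4)" using integrable_norm_power[of 4] by simp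
      show "AE y in \<rho>. (norm y)\<^sup>2 * (m \<bullet> y)\<^sup>2 \<le> r * norm y ^ 4"
        using narrow
      proof eventually_elim
        fix y assume "(m \<bullet> y)\<^sup>2 \<le> r * (norm y)\<^sup>2"
        then have "(norm y)\<^sup>2 * (m \<bullet> y)\<^sup>2 \<le> (norm y)\<^sup>2 * (r * (norm y)\<^sup>2)" by (rule mult_left_mono) simp
        also have "\<dots> = r * norm y ^ 4" by (simp add: mult_ac flip: power_add)
        finally show "(norm y)\<^sup>2 * (m \<bullet> y)\<^sup>2 \<le> r * norm y ^ 4" .
      qed
    qed
    also have "\<dots> = r * X4" using rad4 by (simp add: X4_def)
    finally show ?thesis .
  qed
  \<comment> \<open>\<open>|y|\<^sup>2 \<le> t + |y|\<^sup>4 / t\<close>; in the second term one factor \<open>\<langle>m,y\<rangle>\<^sup>2\<close> is at most \<open>r |y|\<^sup>2\<close>.\<close>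
  have Y2: "Y \<le> t * (\<epsilon> / 2) + r / t * X6" if t: "t > 0" for t
  proof -
    have "Y \<le> (\<integral>y. t * (m \<bullet> y)\<^sup>2 + r / t * norm y ^ 6 \<partial>\<rho>)"
      unfolding Y_def
    proof (rule integral_mono_AE[OF intY])
      show "integrable \<rho> (\<lambda>y. t * (m \<bullet> y)\<^sup>2 + r / t * norm y ^ 6)" using int2 int6 by simp
      show "AE y in \<rho>. (norm y)\<^sup>2 * (m \<bullet> y)\<^sup>2 \<le> t * (m \<bullet> y)\<^sup>2 + r / t * norm y ^ 6"
        using narrow
      proof eventually_elim
        fix y assume n: "(m \<bullet> y)\<^sup>2 \<le> r * (norm y)\<^sup>2"
        have "(norm y)\<^sup>2 \<le> t + norm y ^ 4 / t"
        proof -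
          have "0 \<le> (t - (norm y)\<^sup>2)\<^sup>2 + t * (norm y)\<^sup>2" using t by simp
          then have "t * (norm y)\<^sup>2 \<le> t * t + norm y ^ 4"
            by (simp add: power2_diff power2_eq_square[of t] flip: power_mult)
          then show ?thesis using t by (simp add: field_simps)
        qed
        then have "(norm y)\<^sup>2 * (m \<bullet> y)\<^sup>2 \<le> (t + norm y ^ 4 / t) * (m \<bullet> y)\<^sup>2" by (rule mult_right_mono) simp
        also have "\<dots> = t * (m \<bullet> y)\<^sup>2 + norm y ^ 4 / t * (m \<bullet> y)\<^sup>2" by (simp add: distrib_right)
        also have "norm y ^ 4 / t * (m \<bullet> y)\<^sup>2 \<le> norm y ^ 4 / t * (r * (norm y)\<^sup>2)"
          using n t by (intro mult_left_mono) auto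
        also have "norm y ^ 4 / t * (r * (norm y)\<^sup>2) = r / t * norm y ^ 6" by (simp flip: power_add)
        finally show "(norm y)\<^sup>2 * (m \<bullet> y)\<^sup>2 \<le> t * (m \<bullet> y)\<^sup>2 + r / t * norm y ^ 6" by simp
      qed
    qed
    also have "\<dots> = t * b m + r / t * (\<integral>y. norm y ^ 6 \<partial>\<rho>)" using int2 int6 by (simp add: b_def)
    also have "\<dots> = t * (\<epsilon> / 2) + r / t * X6" by (simp add: rad6 X6_def \<epsilon>_def)
    finally show ?thesis .
  qed
  define D where "D i j k l = T i j k l - F i j k l" for i j k l
  have D3Y: "ip4 D D \<le> 3 * Y"
  proof -
    have FT: "ip4 F T = 3 / 4 * (\<integral>y. ((norm y)\<^sup>2 - (m \<bullet> y)\<^sup>2)\<^sup>2 \<partial>\<rho>)"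
      unfolding T_contract ip4_F_outer by simp
    have "(\<integral>y. norm y ^ 4 - 2 * ((norm y)\<^sup>2 * (m \<bullet> y)\<^sup>2) \<partial>\<rho>) \<le> (\<integral>y. ((norm y)\<^sup>2 - (m \<bullet> y)\<^sup>2)\<^sup>2 \<partial>\<rho>)"
    proof (rule integral_mono)
      show "integrable \<rho> (\<lambda>y. norm y ^ 4 - 2 * ((norm y)\<^sup>2 * (m \<bullet> y)\<^sup>2))" using intY integrable_norm_power[of 4] by simp
      show "integrable \<rho> (\<lambda>y. ((norm y)\<^sup>2 - (m \<bullet> y)\<^sup>2)\<^sup>2)"
      proof (rule integrable_of_growth[where C=1 and k=4])
        fix y
        have "((norm y)\<^sup>2 - (m \<bullet> y)\<^sup>2)\<^sup>2 \<le> ((norm y)\<^sup>2)\<^sup>2" by (rule power_mono) (use my[of y] in auto)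
        then show "\<bar>((norm y)\<^sup>2 - (m \<bullet> y)\<^sup>2)\<^sup>2\<bar> \<le> 1 * norm y ^ 4" by (simp flip: power_mult)
      qed (auto intro!: continuous_intros)
      fix y
      show "norm y ^ 4 - 2 * ((norm y)\<^sup>2 * (m \<bullet> y)\<^sup>2) \<le> ((norm y)\<^sup>2 - (m \<bullet> y)\<^sup>2)\<^sup>2"
        by (simp add: power2_diff flip: power_mult)
    qed
    also have "(\<integral>y. norm y ^ 4 - 2 * ((norm y)\<^sup>2 * (m \<bullet> y)\<^sup>2) \<partial>\<rho>) = X4 - 2 * Y"
      using intY integrable_norm_power[of 4] by (simp add: Y_def rad4 X4_def)
    finally have "3 / 4 * (X4 - 2 * Y) \<le> ip4 F T" unfolding FT by simp
    moreover have "ip4 D D = ip4 T T - 2 * ip4 F T + ip4 F F"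
    proof -
      have 1: "ip4 D C = ip4 T C - ip4 F C" for C unfolding D_def[abs_def] by (rule ip4_diff_left)
      show ?thesis using 1[of D] 1[of T] 1[of F] ip4_commute[of T D] ip4_commute[of F D] ip4_commute[of T F] by linarith
    qed
    moreover have "ip4 F F = 3 / 4 * X4" unfolding ip4_F_F X4_def d(1) by (simp add: field_simps)
    moreover have "ip4 T T = 3 / 4 * X4" unfolding T_T X4_def by simp
    ultimately show ?thesis by simp
  qed
  let ?RR = "\<lambda>i j k l. R i j * R k l"
  have RRRR: "ip4 ?RR ?RR = (2 * \<epsilon>)\<^sup>2" unfolding ip4_product RR by (simp add: power2_eq_square)
  have FRR: "\<epsilon> / 2 \<le> ip4 F ?RR"
  proof -
    have PR: "(\<Sum>k\<in>UNIV. P i k * R k l) = R i l + \<epsilon> * (m $ i * m $ l)" for i l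
      using Rm[of l] unfolding P_apply by (simp add: Rsym[of _ l] mult_ac)
    have "ip4 (\<lambda>i j k l. P i k * P j l) ?RR = (\<Sum>i\<in>UNIV. \<Sum>j\<in>UNIV. R i j * (\<Sum>l\<in>UNIV. P j l * (\<Sum>k\<in>UNIV. P i k * R k l)))"
      unfolding ip4_def sum_distrib_left
      by (rule sum.cong[OF refl], rule sum.cong[OF refl]) (subst sum.swap, simp add: mult_ac)
    also have "\<dots> = (\<Sum>i\<in>UNIV. \<Sum>j\<in>UNIV. R i j * (R i j + \<epsilon> * (m $ i * m $ j)))"
    proof (intro sum.cong refl)
      fix i j
      have "(\<Sum>l\<in>UNIV. P j l * (R i l + \<epsilon> * (m $ i * m $ l)))
        = (R i j + \<epsilon> * (m $ i * m $ j)) - m $ j * (\<Sum>l\<in>UNIV. m $ l * (R i l + \<epsilon> * (m $ i * m $ l)))"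
        by (rule P_apply)
      moreover have "(\<Sum>l\<in>UNIV. m $ l * (R i l + \<epsilon> * (m $ i * m $ l))) = (\<Sum>l\<in>UNIV. R i l * m $ l) + \<epsilon> * m $ i * (\<Sum>l\<in>UNIV. m $ l * m $ l)"
        by (simp add: distrib_left sum.distrib sum_distrib_left mult_ac)
      ultimately show "R i j * (\<Sum>l\<in>UNIV. P j l * (\<Sum>k\<in>UNIV. P i k * R k l)) = R i j * (R i j + \<epsilon> * (m $ i * m $ j))"
        unfolding PR Rm mm by simp
    qed
    also have "\<dots> = (\<Sum>i\<in>UNIV. \<Sum>j\<in>UNIV. R i j * R i j) + \<epsilon> * (\<Sum>i\<in>UNIV. m $ i * (\<Sum>j\<in>UNIV. R i j * m $ j))"
      by (simp add: distrib_left sum.distrib sum_distrib_left mult_ac)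
    also have "\<dots> = 2 * \<epsilon> - \<epsilon>\<^sup>2"
    proof -
      have "(\<Sum>i\<in>UNIV. m $ i * (- \<epsilon> * m $ i)) = - \<epsilon> * (\<Sum>i\<in>UNIV. m $ i * m $ i)"
        by (simp add: sum_distrib_left sum_negf mult_ac)
      then show ?thesis unfolding RR Rm mm by (simp add: power2_eq_square)
    qed
    finally have PP: "ip4 (\<lambda>i j k l. P i k * P j l) ?RR = 2 * \<epsilon> - \<epsilon>\<^sup>2" .
    have "(2 * (2 * \<epsilon> - \<epsilon>\<^sup>2)) / 4 \<le> ip4 F ?RR"
      unfolding ip4_F_product[OF Rsym] PP by simp
    moreover have "\<epsilon>\<^sup>2 \<le> \<epsilon>" using \<epsilon> \<epsilon>0 by (simp add: power2_eq_square mult_left_le_one_le)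
    ultimately show ?thesis by simp
  qed
  have TRR: "ip4 T ?RR = (\<integral>y. (m \<bullet> y) ^ 4 \<partial>\<rho>)"
  proof -
    have "ip4 T ?RR = (\<integral>y. (qf R y)\<^sup>2 \<partial>\<rho>)"
    proof -
      have "ip4 ?RR (\<lambda>i j k l. y $ i * y $ j * (y $ k * y $ l)) = (qf R y)\<^sup>2" for y
        by (subst ip4_commute) (rule ip4_qf)
      then show ?thesis by (subst ip4_commute) (simp add: T_contract)
    qed
    also have "\<dots> = (\<integral>y. (m \<bullet> y) ^ 4 \<partial>\<rho>)"
    proof (rule integral_cong_AE)
      have "(\<lambda>y. (qf R y)\<^sup>2) \<in> borel_measurable borel"
        unfolding qf_def by (intro borel_measurable_continuous_onI continuous_intros)
      then show "(\<lambda>y. (qf R y)\<^sup>2) \<in> borel_measurable \<rho>" using sets_rho by (simp cong: measurable_cong_sets)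
      show "AE y in \<rho>. (qf R y)\<^sup>2 = (m \<bullet> y) ^ 4"
        using on_supp by eventually_elim (simp flip: power_mult)
    qed (simp add: sets_rho cong: measurable_cong_sets)
    finally show ?thesis .
  qed
  have upper: "ip4 T ?RR \<le> r * Y"
  proof -
    have "(\<integral>y. (m \<bullet> y) ^ 4 \<partial>\<rho>) \<le> (\<integral>y. r * ((norm y)\<^sup>2 * (m \<bullet> y)\<^sup>2) \<partial>\<rho>)"
    proof (rule integral_mono_AE)
      show "integrable \<rho> (\<lambda>y. (m \<bullet> y) ^ 4)"
      proof (rule integrable_of_growth[where C=1 and k=4])
        fix y
        have "((m \<bullet> y)\<^sup>2)\<^sup>2 \<le> ((norm y)\<^sup>2)\<^sup>2" by (rule power_mono[OF my]) simp
        then show "\<bar>(m \<bullet> y) ^ 4\<bar> \<le> 1 * norm y ^ 4" by (simp flip: power_mult)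
      qed (auto intro!: continuous_intros)
      show "integrable \<rho> (\<lambda>y. r * ((norm y)\<^sup>2 * (m \<bullet> y)\<^sup>2))" using intY by simp
      show "AE y in \<rho>. (m \<bullet> y) ^ 4 \<le> r * ((norm y)\<^sup>2 * (m \<bullet> y)\<^sup>2)"
        using narrow
      proof eventually_elim
        fix y assume "(m \<bullet> y)\<^sup>2 \<le> r * (norm y)\<^sup>2"
        then have "(m \<bullet> y)\<^sup>2 * (m \<bullet> y)\<^sup>2 \<le> r * (norm y)\<^sup>2 * (m \<bullet> y)\<^sup>2" by (rule mult_right_mono) simp
        then show "(m \<bullet> y) ^ 4 \<le> r * ((norm y)\<^sup>2 * (m \<bullet> y)\<^sup>2)" by (simp add: mult_ac flip: power_add)
      qed
    qed
    then show ?thesis unfolding TRR by (simp add: Y_def)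
  qed
  have lower: "\<epsilon> / 2 - \<epsilon> / 8 \<le> ip4 T ?RR"
  proof -
    have "(ip4 D ?RR)\<^sup>2 \<le> ip4 D D * (2 * \<epsilon>)\<^sup>2" using ip4_Cauchy_Schwarz[of D ?RR] unfolding RRRR .
    also have "\<dots> \<le> (1 / 16)\<^sup>2 * (2 * \<epsilon>)\<^sup>2"
    proof (rule mult_right_mono)
      have "r * (d * (d + 2)) \<le> sqrt (2 * \<epsilon>0) * (d * (d + 2))"
        using rle d by (intro mult_right_mono) auto
      then have "3 * Y \<le> 1 / 256" using Y1 \<epsilon>0(4) by (simp add: X4_def)
      then show "ip4 D D \<le> (1 / 16)\<^sup>2" using D3Y by (simp add: power2_eq_square)
    qed simp
    also have "\<dots> = (\<epsilon> / 8)\<^sup>2" by (simp add: power2_eq_square)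
    finally have "\<bar>ip4 D ?RR\<bar> \<le> \<bar>\<epsilon> / 8\<bar>" unfolding abs_le_square_iff .
    then have "\<bar>ip4 D ?RR\<bar> \<le> \<epsilon> / 8" using \<epsilon> by (simp only: abs_of_nonneg divide_nonneg_nonneg zero_le_numeral)
    moreover have "ip4 D ?RR = ip4 T ?RR - ip4 F ?RR" unfolding D_def[abs_def] by (rule ip4_diff_left)
    ultimately show ?thesis using FRR by linarith
  qed
  have "\<epsilon> = 0"
  proof (rule ccontr)
    assume "\<epsilon> \<noteq> 0"
    then have \<epsilon>p: "\<epsilon> > 0" using \<epsilon> by simp
    \<comment> \<open>With \<open>t = 16 X6\<close> the term of \<open>Y2\<close> that is not of smaller order becomes \<open>\<epsilon> / 8\<close>.\<close>
    have "r * Y \<le> r * (16 * X6 * (\<epsilon> / 2) + r / (16 * X6) * X6)"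
      using Y2[of "16 * X6"] X r0 by (intro mult_left_mono) auto
    also have "\<dots> = r * X6 * 8 * \<epsilon> + r\<^sup>2 / 16" using X by (simp add: field_simps power2_eq_square)
    also have "\<dots> = (r * X6 * 8 + 1 / 8) * \<epsilon>" by (simp add: r2 algebra_simps)
    also have "\<dots> \<le> (1 / 16 + 1 / 8) * \<epsilon>"
    proof (rule mult_right_mono)
      have "r * (d * (d + 2) * (d + 4)) \<le> sqrt (2 * \<epsilon>0) * (d * (d + 2) * (d + 4))"
        using rle d by (intro mult_right_mono) auto
      then show "r * X6 * 8 + 1 / 8 \<le> 1 / 16 + 1 / 8" using \<epsilon>0(3) by (simp add: X6_def)
    qed (use \<epsilon> in simp)
    finally show False using lower upper \<epsilon>p by simp
  qed
  then have "r = 0" by (simp add: r_def)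
  then have "AE y in \<rho>. m \<bullet> y = 0" using narrow by (auto elim!: eventually_mono)
  then show thesis using that m by blast
qed

end

section \<open>Measures supported in a vertical hyperplane\<close>

lemma msupp_dil:
  fixes \<mu> :: "'n::finite heis measure"
  assumes cone: "\<forall>l>0. \<forall>A\<in>sets borel. ennreal (1 / l ^ m) * emeasure \<mu> (dil l ` A) = emeasure \<mu> A"
    and p: "p \<in> msupp \<mu>" and l: "l > 0"
  shows "dil l p \<in> msupp \<mu>"
  unfolding msupp_def
proof (intro CollectI allI impI)
  fix U :: "'n heis set" assume U: "open U \<and> dil l p \<in> U"
  have cont: "continuous_on UNIV (dil l :: 'n heis \<Rightarrow> 'n heis)"
    unfolding dil_def by (intro continuous_intros)
  have "open (dil l -` U)" using U by (intro open_vimage cont) auto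
  then have pos: "emeasure \<mu> (dil l -` U) > 0" using p U by (auto simp: msupp_def)
  have dd: "dil l (dil (1 / l) z) = z" for z :: "'n heis"
    using l by (simp add: dil_def power_divide)
  have "dil l ` (dil l -` U) = U"
  proof (intro set_eqI iffI)
    fix z assume "z \<in> U"
    then have "dil (1 / l) z \<in> dil l -` U" by (simp add: dd)
    then show "z \<in> dil l ` (dil l -` U)" using dd[of z] by (metis imageI)
  qed auto
  then have "ennreal (1 / l ^ m) * emeasure \<mu> U = emeasure \<mu> (dil l -` U)"
    using cone l \<open>open (dil l -` U)\<close> by (metis borel_open)
  then show "emeasure \<mu> U > 0" using pos by (metis mult_zero_right not_gr_zero)
qed

text \<open>
  Lebesgue measure of a hyperplane, realised as the push-forward of Lebesgue measure on a slab of
  height 1 along the projection; \<open>f\<close> rotates a coordinate direction onto the normal.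
\<close>

definition slab_measure :: "(real ^ 'k \<Rightarrow> real ^ 'k) \<Rightarrow> 'k \<Rightarrow> (real ^ 'k::finite) measure" where
  "slab_measure f k = distr (density lborel (\<lambda>y. indicator {0..1} (y $ k))) borel (\<lambda>y. f (y - (y $ k) *\<^sub>R axis k 1))"

lemma nn_integral_slab_measure:
  fixes f :: "real ^ 'k::finite \<Rightarrow> real ^ 'k"
  assumes f: "linear f" and [measurable]: "g \<in> borel_measurable borel"
  shows "(\<integral>\<^sup>+y. g y \<partial>slab_measure f k) = (\<integral>\<^sup>+y. indicator {0..1} (y $ k) * g (f (y - (y $ k) *\<^sub>R axis k 1)) \<partial>lborel)"
proof -
  have [measurable]: "f \<in> borel_measurable borel"
    by (rule borel_measurable_continuous_onI[OF linear_continuous_on]) (use f in \<open>simp add: linear_conv_bounded_linear\<close>)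
  have [measurable]: "(\<lambda>y :: real ^ 'k. y $ k) \<in> borel_measurable borel"
    by (intro borel_measurable_continuous_onI continuous_intros)
  show ?thesis
    unfolding slab_measure_def by (subst nn_integral_distr) (auto simp: nn_integral_density)
qed

text \<open>
  The substitution \<open>Tr\<close> is the dilation by \<open>r\<close> and the translation to the centre, except that it fixes
  the height above the hyperplane; so its determinant is \<open>r\<^bsup>2n-1\<^esup>\<close>. The fibre length contributes the
  remaining \<open>r\<^sup>2\<close>.
\<close>

lemma slab_ball_scaling:
  fixes f :: "real ^ ('n::finite + 'n) \<Rightarrow> real ^ ('n + 'n)" and k :: "'n + 'n"
  assumes f: "orthogonal_transformation f" and x: "x \<bullet> f (axis k 1) = 0" and r: "r > 0"
  defines "g \<equiv> \<lambda>r a. ennreal (2 * sqrt (max 0 (r ^ 4 - a ^ 4)))"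
  shows "(\<integral>\<^sup>+y. g r (norm (y - x)) \<partial>slab_measure f k)
    = ennreal (r ^ (2 * CARD('n) + 1)) * (\<integral>\<^sup>+y. g 1 (norm y) \<partial>slab_measure f k)"
proof -
  have lin: "linear f" using f by (simp add: orthogonal_transformation_def)
  have gm [measurable]: "(\<lambda>y :: real ^ ('n + 'n). g r (norm (y - x))) \<in> borel_measurable borel" for r x
    unfolding g_def by measurable
  have km [measurable]: "(\<lambda>y :: real ^ ('n + 'n). y $ k) \<in> borel_measurable borel"
    by (intro borel_measurable_continuous_onI continuous_intros)
  define p where "p y = y - (y $ k) *\<^sub>R axis k 1" for y :: "real ^ ('n + 'n)"
  have pm [measurable]: "p \<in> borel_measurable borel"
    unfolding p_def by (intro borel_measurable_continuous_onI continuous_intros)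
  have G: "(\<integral>\<^sup>+y. g s (norm (y - w)) \<partial>slab_measure f k) = (\<integral>\<^sup>+y. indicator {0..1} (y $ k) * g s (norm (f (p y) - w)) \<partial>lborel)" for s w
    unfolding p_def by (rule nn_integral_slab_measure[OF lin gm])
  obtain x' where x': "f x' = x" using orthogonal_transformation_surj[OF f] by (metis surjD)
  have x'k: "x' $ k = 0"
    using x f unfolding x'[symmetric] by (simp add: orthogonal_transformation_def inner_axis)
  have n: "norm (f (p y) - x) = norm (p y - x')" for y
    unfolding x'[symmetric] linear_diff[OF lin, symmetric] by (rule orthogonal_transformation_norm[OF f])
  define c where "c j = (if j = axis k 1 then 1 else r)" for j :: "real ^ ('n + 'n)"
  define Tr where "Tr y = x' + (\<Sum>j\<in>Basis. (c j * (y \<bullet> j)) *\<^sub>R j)" for y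
  have Trm [measurable]: "Tr \<in> borel_measurable borel"
    unfolding Tr_def by (intro borel_measurable_continuous_onI continuous_intros)
  have Tr: "Tr y $ i = x' $ i + (if i = k then 1 else r) * y $ i" for y i
  proof -
    have ax: "axis i 1 \<in> (Basis :: (real ^ ('n + 'n)) set)" by (simp add: axis_in_Basis_iff)
    have "(\<Sum>j\<in>Basis. (c j * (y \<bullet> j)) *\<^sub>R j) \<bullet> axis i 1 = c (axis i 1) * (y \<bullet> axis i 1)"
      using ax by (simp add: inner_sum_left inner_Basis if_distrib cong: if_cong)
    then have "(\<Sum>j\<in>Basis. (c j * (y \<bullet> j)) *\<^sub>R j) $ i = c (axis i 1) * y $ i"
      by (simp add: inner_axis)
    then show ?thesis by (simp add: Tr_def c_def axis_eq_axis)
  qed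
  have pTr: "p (Tr y) - x' = r *\<^sub>R p y" for y
    by (auto simp: vec_eq_iff p_def Tr axis_def x'k)
  have prodc: "(\<Prod>j\<in>(Basis :: (real ^ ('n + 'n)) set). \<bar>c j\<bar>) = r ^ (2 * CARD('n) - 1)"
  proof -
    have ax: "axis k 1 \<in> (Basis :: (real ^ ('n + 'n)) set)" by (simp add: axis_in_Basis_iff)
    have "(\<Prod>j\<in>(Basis :: (real ^ ('n + 'n)) set). \<bar>c j\<bar>)
      = \<bar>c (axis k 1)\<bar> * (\<Prod>j\<in>(Basis :: (real ^ ('n + 'n)) set) - {axis k 1}. \<bar>c j\<bar>)"
      using ax by (intro prod.remove) auto
    also have "(\<Prod>j\<in>(Basis :: (real ^ ('n + 'n)) set) - {axis k 1}. \<bar>c j\<bar>) = (\<Prod>j\<in>(Basis :: (real ^ ('n + 'n)) set) - {axis k 1}. r)"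
      using r by (intro prod.cong) (auto simp: c_def)
    also have "\<dots> = r ^ (2 * CARD('n) - 1)"
      using ax by (simp add: card_Diff_singleton mult_2)
    finally show ?thesis by (simp add: c_def)
  qed
  have "(\<integral>\<^sup>+y. g r (norm (y - x)) \<partial>slab_measure f k) = (\<integral>\<^sup>+y. indicator {0..1} (y $ k) * g r (norm (p y - x')) \<partial>lborel)"
    unfolding G n ..
  also have "\<dots> = (\<integral>\<^sup>+y. ennreal (r ^ (2 * CARD('n) - 1)) * (indicator {0..1} (Tr y $ k) * g r (norm (p (Tr y) - x'))) \<partial>lborel)"
  proof -
    have "lborel = density (distr lborel borel Tr) (\<lambda>_. ennreal (r ^ (2 * CARD('n) - 1)))"
      using lborel_affine_euclidean[of c x'] r unfolding Tr_def[symmetric, abs_def] prodc by (auto simp: c_def)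
    then have "(\<integral>\<^sup>+y. indicator {0..1} (y $ k) * g r (norm (p y - x')) \<partial>lborel)
      = (\<integral>\<^sup>+y. indicator {0..1} (y $ k) * g r (norm (p y - x')) \<partial>density (distr lborel borel Tr) (\<lambda>_. ennreal (r ^ (2 * CARD('n) - 1))))"
      by (rule arg_cong)
    also have "\<dots> = (\<integral>\<^sup>+y. ennreal (r ^ (2 * CARD('n) - 1)) * (indicator {0..1} (y $ k) * g r (norm (p y - x'))) \<partial>distr lborel borel Tr)"
      by (rule nn_integral_density) (auto simp: g_def)
    also have "\<dots> = (\<integral>\<^sup>+y. ennreal (r ^ (2 * CARD('n) - 1)) * (indicator {0..1} (Tr y $ k) * g r (norm (p (Tr y) - x'))) \<partial>lborel)"
      by (rule nn_integral_distr) (auto simp: g_def)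
    finally show ?thesis .
  qed
  also have "\<dots> = (\<integral>\<^sup>+y. ennreal (r ^ (2 * CARD('n) + 1)) * (indicator {0..1} (y $ k) * g 1 (norm (f (p y) - 0))) \<partial>lborel)"
  proof (rule nn_integral_cong)
    fix y :: "real ^ ('n + 'n)"
    note fibre_length_scale[of r "norm (p y)"]
    then have gr: "g r (norm (p (Tr y) - x')) = ennreal (r\<^sup>2) * g 1 (norm (f (p y) - 0))"
      unfolding pTr using r orthogonal_transformation_norm[OF f, of "p y"] by (simp add: g_def ennreal_mult' mult_ac)
    have "2 * CARD('n) + 1 = (2 * CARD('n) - 1) + 2"
      using zero_less_card_finite[where 'a='n] by linarith
    then have "r ^ (2 * CARD('n) + 1) = r ^ (2 * CARD('n) - 1) * r\<^sup>2" by (simp only: power_add)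
    moreover have "ennreal (r ^ (2 * CARD('n) - 1) * r\<^sup>2) = ennreal (r ^ (2 * CARD('n) - 1)) * ennreal (r\<^sup>2)"
      using r by (intro ennreal_mult') simp
    ultimately have "ennreal (r ^ (2 * CARD('n) + 1)) = ennreal (r ^ (2 * CARD('n) - 1)) * ennreal (r\<^sup>2)"
      by (simp only:)
    then show "ennreal (r ^ (2 * CARD('n) - 1)) * (indicator {0..1} (Tr y $ k) * g r (norm (p (Tr y) - x')))
      = ennreal (r ^ (2 * CARD('n) + 1)) * (indicator {0..1} (y $ k) * g 1 (norm (f (p y) - 0)))"
      unfolding gr by (simp add: Tr x'k mult_ac)
  qed
  also have "\<dots> = ennreal (r ^ (2 * CARD('n) + 1)) * (\<integral>\<^sup>+y. indicator {0..1} (y $ k) * g 1 (norm (f (p y) - 0)) \<partial>lborel)"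
  proof (rule nn_integral_cmult)
    have "continuous_on UNIV f" using lin by (simp add: linear_conv_bounded_linear linear_continuous_on)
    then have [measurable]: "f \<in> borel_measurable borel" by (rule borel_measurable_continuous_onI)
    show "(\<lambda>y. indicator {0..1} (y $ k) * g 1 (norm (f (p y) - 0))) \<in> borel_measurable lborel"
      unfolding g_def by measurable
  qed
  also have "(\<integral>\<^sup>+y. indicator {0..1} (y $ k) * g 1 (norm (f (p y) - 0)) \<partial>lborel) = (\<integral>\<^sup>+y. g 1 (norm (y - 0)) \<partial>slab_measure f k)"
    by (rule G[symmetric])
  finally show ?thesis by simp
qed

lemma slab_unit_mass:
  fixes f :: "real ^ ('n::finite + 'n) \<Rightarrow> real ^ ('n + 'n)" and k :: "'n + 'n"
  assumes f: "orthogonal_transformation f"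
  obtains c where "c > 0" "(\<integral>\<^sup>+y. ennreal (2 * sqrt (max 0 (1 - norm y ^ 4))) \<partial>slab_measure f k) = ennreal c"
proof -
  have lin: "linear f" using f by (simp add: orthogonal_transformation_def)
  define p where "p y = y - (y $ k) *\<^sub>R axis k 1" for y :: "real ^ ('n + 'n)"
  let ?I = "\<integral>\<^sup>+y. ennreal (2 * sqrt (max 0 (1 - norm y ^ 4))) \<partial>slab_measure f k"
  have I: "?I = (\<integral>\<^sup>+y. indicator {0..1} (y $ k) * ennreal (2 * sqrt (max 0 (1 - norm (p y) ^ 4))) \<partial>lborel)"
    using nn_integral_slab_measure[OF lin, of "\<lambda>y. ennreal (2 * sqrt (max 0 (1 - norm y ^ 4)))" k]
    by (simp add: p_def orthogonal_transformation_norm[OF f])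
  have tri: "norm y \<le> norm (p y) + \<bar>y $ k\<bar>" "norm (p y) \<le> norm (y - a *\<^sub>R axis k 1) + \<bar>y $ k - a\<bar>" for y a
  proof -
    have "y = p y + (y $ k) *\<^sub>R axis k 1" by (simp add: p_def)
    then show "norm y \<le> norm (p y) + \<bar>y $ k\<bar>"
      using norm_triangle_ineq[of "p y" "(y $ k) *\<^sub>R axis k 1"] by simp
    have "p y = (y - a *\<^sub>R axis k 1) + (a - y $ k) *\<^sub>R axis k 1" by (simp add: p_def algebra_simps)
    then show "norm (p y) \<le> norm (y - a *\<^sub>R axis k 1) + \<bar>y $ k - a\<bar>"
      using norm_triangle_ineq[of "y - a *\<^sub>R axis k 1" "(a - y $ k) *\<^sub>R axis k 1"] by (simp add: abs_minus_commute)
  qed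
  have "?I \<le> (\<integral>\<^sup>+y. 2 * indicator (cball 0 2) y \<partial>(lborel :: (real ^ ('n + 'n)) measure))"
    unfolding I
  proof (rule nn_integral_mono)
    fix y :: "real ^ ('n + 'n)"
    show "indicator {0..1} (y $ k) * ennreal (2 * sqrt (max 0 (1 - norm (p y) ^ 4))) \<le> 2 * indicator (cball 0 2) y"
    proof (cases "y \<in> cball 0 2")
      case True
      have "2 * sqrt (max 0 (1 - norm (p y) ^ 4)) \<le> 2 * 1" by (intro mult_left_mono) auto
      then have "ennreal (2 * sqrt (max 0 (1 - norm (p y) ^ 4))) \<le> ennreal 2" by (intro ennreal_leI) simp
      then show ?thesis using True by (auto simp: indicator_def)
    next
      case False
      then have "\<bar>y $ k\<bar> > 1 \<or> norm (p y) > 1" using tri(1)[of y] by auto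
      moreover have "1 - norm (p y) ^ 4 \<le> 0" if "norm (p y) > 1" using that by (simp add: one_le_power)
      ultimately have "y $ k \<notin> {0..1} \<or> max 0 (1 - norm (p y) ^ 4) = 0" by auto
      then show ?thesis by (elim disjE) simp_all
    qed
  qed
  also have "\<dots> = 2 * emeasure lborel (cball (0 :: real ^ ('n + 'n)) 2)" by (simp add: nn_integral_cmult_indicator)
  also have "\<dots> < \<infinity>" using emeasure_lborel_cball_finite[of "0 :: real ^ ('n + 'n)" 2] by (simp add: ennreal_mult_less_top)
  finally have fin: "?I < \<infinity>" .
  let ?B = "ball ((1 / 2) *\<^sub>R axis k 1) (1 / 4) :: (real ^ ('n + 'n)) set"
  have "0 < emeasure lborel ?B"
    using content_ball_pos[of "1/4" "(1 / 2) *\<^sub>R axis k 1 :: real ^ ('n + 'n)"] by (auto simp: measure_def enn2real_positive_iff)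
  also have "emeasure lborel ?B = (\<integral>\<^sup>+y. indicator ?B y \<partial>lborel)" by simp
  also have "\<dots> \<le> ?I"
    unfolding I
  proof (rule nn_integral_mono)
    fix y :: "real ^ ('n + 'n)"
    show "indicator ?B y \<le> indicator {0..1} (y $ k) * ennreal (2 * sqrt (max 0 (1 - norm (p y) ^ 4)))"
    proof (cases "y \<in> ?B")
      case True
      then have n: "norm (y - (1 / 2) *\<^sub>R axis k 1) < 1 / 4" by (simp add: dist_norm norm_minus_commute)
      moreover have yk: "\<bar>y $ k - 1 / 2\<bar> \<le> norm (y - (1 / 2) *\<^sub>R axis k 1)"
        using component_le_norm_cart[of "y - (1 / 2) *\<^sub>R axis k 1" k] by (simp add: axis_def)
      ultimately have "norm (p y) \<le> 1 / 2" using tri(2)[of y "1/2"] by linarith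
      then have "norm (p y) ^ 4 \<le> (1 / 2) ^ 4" by (intro power_mono) auto
      then have "sqrt (1 / 4) \<le> sqrt (max 0 (1 - norm (p y) ^ 4))" by (simp add: power_divide)
      then have "1 \<le> 2 * sqrt (max 0 (1 - norm (p y) ^ 4))" by (simp add: real_sqrt_divide)
      then have "ennreal 1 \<le> ennreal (2 * sqrt (max 0 (1 - norm (p y) ^ 4)))" by (rule ennreal_leI)
      moreover have "y $ k \<in> {0..1}" using n yk unfolding atLeastAtMost_iff by linarith
      ultimately show ?thesis using True by simp
    qed simp
  qed
  finally have pos: "0 < ?I" .
  show thesis
  proof (rule that)
    show "?I = ennreal (enn2real ?I)" using fin by simp
    show "0 < enn2real ?I" using fin pos by (simp only: enn2real_positive_iff) simp
  qed
qed

lemma vplane_haar_measure: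
  fixes \<nn> :: "real ^ ('n::finite + 'n)"
  assumes "\<nn> \<noteq> 0"
  obtains \<mu>0 :: "'n heis measure" where "sets \<mu>0 = sets borel"
    "\<And>p r. p \<in> vplane \<nn> \<Longrightarrow> r > 0 \<Longrightarrow> emeasure \<mu>0 (kball r p) = ennreal (r ^ (2 * CARD('n) + 1))"
proof -
  fix k :: "'n + 'n"
  have "\<exists>f :: real ^ ('n + 'n) \<Rightarrow> real ^ ('n + 'n). orthogonal_transformation f \<and> f (axis k 1) = (1 / norm \<nn>) *\<^sub>R \<nn>"
  proof -
    have a: "norm (axis k (1::real)) = 1" by simp
    have b: "norm ((1 / norm \<nn>) *\<^sub>R \<nn>) = 1" using assms by simp
    show ?thesis
    proof (rule orthogonal_transformation_exists_1[OF a b])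
      fix f :: "real ^ ('n + 'n) \<Rightarrow> real ^ ('n + 'n)"
      assume "orthogonal_transformation f" "f (axis k 1) = (1 / norm \<nn>) *\<^sub>R \<nn>"
      then show ?thesis by (intro exI[of _ f] conjI)
    qed
  qed
  then obtain f :: "real ^ ('n + 'n) \<Rightarrow> real ^ ('n + 'n)" where f: "orthogonal_transformation f" "f (axis k 1) = (1 / norm \<nn>) *\<^sub>R \<nn>"
    by (elim exE conjE)
  obtain c where c: "c > 0" "(\<integral>\<^sup>+y. ennreal (2 * sqrt (max 0 (1 - norm y ^ 4))) \<partial>slab_measure f k) = ennreal c"
    using slab_unit_mass[OF f(1), of k] by metis
  have s: "sets (slab_measure f k) = sets borel" by (simp add: slab_measure_def)
  have s2: "sets (slab_measure f k \<Otimes>\<^sub>M (lborel :: real measure)) = sets borel"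
    unfolding borel_prod[symmetric] by (intro sets_pair_measure_cong s) simp
  show thesis
  proof (rule that[of "scale_measure (ennreal (1 / c)) (slab_measure f k \<Otimes>\<^sub>M lborel)"])
    show "sets (scale_measure (ennreal (1 / c)) (slab_measure f k \<Otimes>\<^sub>M (lborel :: real measure))) = sets borel"
      by (simp only: sets_scale_measure s2)
    fix p :: "'n heis" and r :: real assume p: "p \<in> vplane \<nn>" and r: "r > 0"
    have x: "fst p \<bullet> f (axis k 1) = 0" using p by (simp add: f(2) vplane_def inner_commute)
    have "emeasure (slab_measure f k \<Otimes>\<^sub>M lborel) (kball r p) = ennreal (r ^ (2 * CARD('n) + 1)) * ennreal c"
      using slab_ball_scaling[OF f(1) x r] c(2) by (simp add: emeasure_kball_pair[OF s r])
    then show "emeasure (scale_measure (ennreal (1 / c)) (slab_measure f k \<Otimes>\<^sub>M lborel)) (kball r p) = ennreal (r ^ (2 * CARD('n) + 1))"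
      using c(1) r by (simp flip: ennreal_mult' ennreal_mult'')
  qed
qed

lemma emeasure_outer_compact:
  fixes M :: "'a::{heine_borel, second_countable_topology, complete_space} measure"
  assumes sets [measurable_cong]: "sets M = sets borel" and A: "compact A"
    and O: "open O'" "A \<subseteq> O'" "emeasure M O' < \<infinity>"
  shows "emeasure M A = (INF U\<in>{U. open U \<and> A \<subseteq> U}. emeasure M U)"
proof (rule antisym)
  have Ab: "A \<in> sets borel" using A by (rule borel_compact)
  show "emeasure M A \<le> (INF U\<in>{U. open U \<and> A \<subseteq> U}. emeasure M U)"
    using Ab by (auto intro!: INF_greatest emeasure_mono simp: sets)
  let ?M = "density M (indicator O')"
  have em: "emeasure ?M B = emeasure M (O' \<inter> B)" if "B \<in> sets borel" for B
    using that O(1) by (subst emeasure_density) (auto simp: sets nn_integral_indicator[symmetric] indicator_inter_arith intro!: borel_measurable_indicator simp del: nn_integral_indicator)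
  have "emeasure M A = emeasure ?M A" using em[OF Ab] O(2) by (simp add: Int_absorb1)
  also have "\<dots> = (INF U\<in>{U. A \<subseteq> U \<and> open U}. emeasure ?M U)"
  proof (rule outer_regular)
    show "emeasure ?M (space ?M) \<noteq> \<infinity>"
      using em[of UNIV] O sets_eq_imp_space_eq[OF sets] by simp
  qed (use Ab sets in auto)
  finally have eq: "emeasure M A = (INF U\<in>{U. A \<subseteq> U \<and> open U}. emeasure ?M U)" .
  show "(INF U\<in>{U. open U \<and> A \<subseteq> U}. emeasure M U) \<le> emeasure M A"
    unfolding eq
  proof (rule INF_greatest)
    fix U assume U: "U \<in> {U. A \<subseteq> U \<and> open U}"
    then have "emeasure ?M U = emeasure M (O' \<inter> U)" by (intro em) auto
    moreover have "O' \<inter> U \<in> {U. open U \<and> A \<subseteq> U}" using U O by auto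
    ultimately show "(INF U\<in>{U. open U \<and> A \<subseteq> U}. emeasure M U) \<le> emeasure ?M U"
      by (metis INF_lower)
  qed
qed

text \<open>
  The Haar measure \<open>\<mu>0\<close> of the hyperplane coincides with \<open>\<mu>\<close> on the support, and both give mass 1 to
  the unit ball. So \<open>\<mu>0\<close> does not charge the part of the unit ball outside the support. As the support
  is a closed cone, it must then be the whole hyperplane, and \<open>csph_eq_emeasure\<close> identifies \<open>\<mu>\<close>.
\<close>

lemma flat_of_msupp_subset_vplane:
  fixes \<mu> :: "'n::finite heis measure"
  assumes \<mu>: "uniform_cone (2 * CARD('n) + 1) \<mu>" and \<nn>: "\<nn> \<noteq> 0" and sub: "msupp \<mu> \<subseteq> vplane \<nn>"
  shows "flat \<mu>"
proof -
  let ?m = "2 * CARD('n) + 1" and ?S = "msupp \<mu>"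
  have u: "uniform_measure ?m \<mu>" and cone: "\<forall>l>0. \<forall>A\<in>sets borel. ennreal (1 / l ^ ?m) * emeasure \<mu> (dil l ` A) = emeasure \<mu> A"
    using \<mu> by (auto simp: uniform_cone_def)
  note sets = uniform_measureD(1)[OF u]
  have csph: "csph ?m A = emeasure \<mu> A" if "A \<in> sets borel" "A \<subseteq> ?S" for A
    by (rule csph_eq_emeasure[OF sets that(1)]) (use uniform_measureD(3,4)[OF u] that in auto)
  obtain \<mu>0 :: "'n heis measure" where \<mu>0: "sets \<mu>0 = sets borel"
    "\<And>p r. p \<in> vplane \<nn> \<Longrightarrow> r > 0 \<Longrightarrow> emeasure \<mu>0 (kball r p) = ennreal (r ^ ?m)"
    using vplane_haar_measure[OF \<nn>] by blast
  have 0: "0 \<in> vplane \<nn>" by (simp add: vplane_def)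
  let ?K = "kball 1 (0 :: 'n heis)"
  have SK: "compact (?K \<inter> ?S)" by (intro compact_Int_closed compact_kball closed_msupp)
  have "emeasure \<mu>0 (?K \<inter> ?S) = csph ?m (?K \<inter> ?S)"
  proof (rule csph_eq_emeasure[symmetric, OF \<mu>0(1)])
    show "?K \<inter> ?S \<in> sets borel" using SK by (rule borel_compact)
    show "emeasure \<mu>0 (kball r x) = ennreal (r ^ ?m)" if "x \<in> ?K \<inter> ?S" "r > 0" for x r
      using \<mu>0(2) sub that by blast
    show "emeasure \<mu>0 (?K \<inter> ?S) = (INF U\<in>{U. open U \<and> ?K \<inter> ?S \<subseteq> U}. emeasure \<mu>0 U)"
    proof (rule emeasure_outer_compact[OF \<mu>0(1) SK open_koranyi_dist_less[of 0 2]])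
      show "?K \<inter> ?S \<subseteq> {z. koranyi_dist z 0 < 2}" by (auto simp: kball_def)
      have "emeasure \<mu>0 {z. koranyi_dist z 0 < 2} \<le> emeasure \<mu>0 (kball 2 0)"
        by (intro emeasure_mono) (auto simp: kball_def \<mu>0(1) intro: borel_closed[OF closed_kball, unfolded kball_def])
      also have "\<dots> < \<infinity>" using \<mu>0(2)[OF 0, of 2] by simp
      finally show "emeasure \<mu>0 {z. koranyi_dist z 0 < 2} < \<infinity>" .
    qed
  qed
  also have "\<dots> = emeasure \<mu> (?K \<inter> ?S)" by (rule csph) (use SK borel_compact in auto)
  also have "\<dots> = emeasure \<mu> ?K" by (rule emeasure_Int_msupp[OF sets kball_borel])
  also have "\<dots> = 1" using uniform_measureD(3)[OF u uniform_measureD(2)[OF u], of 1] by simp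
  finally have one: "emeasure \<mu>0 (?K \<inter> ?S) = 1" .
  have oneK: "emeasure \<mu>0 ?K = 1" using \<mu>0(2)[OF 0, of 1] by simp
  have rest: "emeasure \<mu>0 (?K - ?S) = 0"
  proof -
    have "emeasure \<mu>0 (?K - (?K \<inter> ?S)) = emeasure \<mu>0 ?K - emeasure \<mu>0 (?K \<inter> ?S)"
      by (rule emeasure_Diff) (use one SK borel_compact in \<open>auto simp: \<mu>0(1)\<close>)
    then show ?thesis by (simp add: one oneK Diff_Int)
  qed
  have "vplane \<nn> \<subseteq> ?S"
  proof
    fix p :: "'n heis" assume p: "p \<in> vplane \<nn>"
    show "p \<in> ?S"
    proof (rule ccontr)
      assume "p \<notin> ?S"
      define l where "l = 1 / (koranyi_dist p 0 + 2)"
      have l: "l > 0" unfolding l_def by (intro divide_pos_pos add_nonneg_pos) auto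
      have "koranyi_dist (dil l p) 0 = l * koranyi_dist p 0"
        using koranyi_dist_dil[of l p 0] l by (simp add: dil_def zero_prod_def)
      also have "\<dots> < 1" by (simp add: l_def divide_less_eq add_nonneg_pos)
      finally have near: "koranyi_dist (dil l p) 0 < 1" .
      have "dil l p \<notin> ?S"
      proof
        assume "dil l p \<in> ?S"
        then have "dil (1 / l) (dil l p) \<in> ?S" using msupp_dil[OF cone] l by simp
        then show False using \<open>p \<notin> ?S\<close> l by (simp add: dil_def power_divide)
      qed
      then have "dil l p \<in> {z. koranyi_dist z 0 < 1} - ?S" using near by simp
      moreover have "open ({z. koranyi_dist z (0 :: 'n heis) < 1} - ?S)"
        by (intro open_Diff open_koranyi_dist_less closed_msupp)
      ultimately obtain s where s: "s > 0" "kball s (dil l p) \<subseteq> {z. koranyi_dist z 0 < 1} - ?S"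
        using kball_subset_open by blast
      have "dil l p \<in> vplane \<nn>" using p by (simp add: vplane_def dil_def)
      then have "0 < emeasure \<mu>0 (kball s (dil l p))" using \<mu>0(2) s(1) by simp
      also have "\<dots> \<le> emeasure \<mu>0 (?K - ?S)"
      proof (rule emeasure_mono)
        show "kball s (dil l p) \<subseteq> ?K - ?S" using s(2) by (auto simp: kball_def[of 1])
        show "?K - ?S \<in> sets \<mu>0" unfolding \<mu>0(1) using closed_msupp[of \<mu>] by (intro sets.Diff kball_borel borel_closed)
      qed
      finally show False using rest by simp
    qed
  qed
  then have S: "?S = vplane \<nn>" using sub by blast
  have "emeasure \<mu> A = csph ?m (A \<inter> vplane \<nn>)" if A: "A \<in> sets borel" for A
  proof -
    have "A \<inter> ?S \<in> sets borel" using A closed_msupp[of \<mu>] by auto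
    then show ?thesis using csph[of "A \<inter> ?S"] emeasure_Int_msupp[OF sets A] S by simp
  qed
  then show ?thesis unfolding flat_def using sets \<nn> by blast
qed

section \<open>Moments of the base measure\<close>

lemma base_measure_gauss:
  fixes \<mu> :: "'n::finite heis measure"
  assumes \<mu>: "uniform_measure (2 * CARD('n) + 1) \<mu>" and inv: "vertically_invariant (msupp \<mu>)"
    and K: "K > 0" "gauss_mass CARD('n) = ennreal K"
    and x: "(x, 0) \<in> msupp \<mu>" and s: "s > 0"
  shows "integrable (base_measure \<mu>) (\<lambda>y. exp (- s * (norm (y - x))\<^sup>2))"
    and "(\<integral>y. exp (- s * (norm (y - x))\<^sup>2) \<partial>base_measure \<mu>) = K * s powr (- ((2 * real CARD('n) - 1) / 2))"
proof -
  have "(\<integral>\<^sup>+y. ennreal (exp (- s * (norm (y - x))\<^sup>2)) \<partial>base_measure \<mu>)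
    = ennreal K * ennreal (s powr (- ((2 * real CARD('n) - 1) / 2)))"
    using base_measure_gauss_nn[OF \<mu> inv x s] K(2) by simp
  also have "\<dots> = ennreal (K * s powr (- ((2 * real CARD('n) - 1) / 2)))"
    using K(1) by (intro ennreal_mult'[symmetric]) simp
  finally have nn: "(\<integral>\<^sup>+y. ennreal (exp (- s * (norm (y - x))\<^sup>2)) \<partial>base_measure \<mu>)
    = ennreal (K * s powr (- ((2 * real CARD('n) - 1) / 2)))" .
  have "integrable (base_measure \<mu>) (\<lambda>y. exp (- s * (norm (y - x))\<^sup>2)) \<and>
    (\<integral>y. exp (- s * (norm (y - x))\<^sup>2) \<partial>base_measure \<mu>) = K * s powr (- ((2 * real CARD('n) - 1) / 2))"
    using nn K(1) by (intro nn_integral_eq_integrable[THEN iffD1]) auto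
  then show "integrable (base_measure \<mu>) (\<lambda>y. exp (- s * (norm (y - x))\<^sup>2))"
    and "(\<integral>y. exp (- s * (norm (y - x))\<^sup>2) \<partial>base_measure \<mu>) = K * s powr (- ((2 * real CARD('n) - 1) / 2))"
    by blast+
qed

text \<open>
  Compare the expansion of the integral of \<open>exp (- (1 + t) |y|\<^sup>2)\<close> in powers of \<open>t\<close> with the binomial
  series of \<open>K (1 + t)\<^bsup>-d/2\<^esup>\<close>.
\<close>

lemma base_measure_radial_moment:
  fixes \<mu> :: "'n::finite heis measure"
  assumes \<mu>: "uniform_measure (2 * CARD('n) + 1) \<mu>" and inv: "vertically_invariant (msupp \<mu>)"
    and K: "K > 0" "gauss_mass CARD('n) = ennreal K"
  defines "a \<equiv> - ((2 * real CARD('n) - 1) / 2)"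
  shows "integrable (base_measure \<mu>) (\<lambda>y. exp (- (norm y)\<^sup>2) * norm y ^ (2 * k))"
    and "(\<integral>y. exp (- (norm y)\<^sup>2) * norm y ^ (2 * k) \<partial>base_measure \<mu>) = K * ((- 1) ^ k * fact k * (a gchoose k))"
proof -
  let ?\<nu> = "base_measure \<mu>"
  have 0: "(0, 0) \<in> msupp \<mu>" using uniform_measureD(2)[OF \<mu>] by (simp add: zero_prod_def)
  note G = base_measure_gauss[OF \<mu> inv K 0]
  define w where "w y = exp (- (norm y)\<^sup>2)" for y :: "real ^ ('n + 'n)"
  define h where "h y = - (norm y)\<^sup>2" for y :: "real ^ ('n + 'n)"
  have m [measurable]: "w \<in> borel_measurable ?\<nu>" "h \<in> borel_measurable ?\<nu>" unfolding w_def h_def by measurable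
  have we: "w y * exp (t * h y) = exp (- (1 + t) * (norm (y - 0))\<^sup>2)" for y t
    by (simp add: w_def h_def algebra_simps flip: exp_add)
  have int: "integrable ?\<nu> (\<lambda>y. w y * exp (1/2 * \<bar>h y\<bar>))"
  proof -
    have "w y * exp (1/2 * \<bar>h y\<bar>) = exp (- (1/2) * (norm (y - 0))\<^sup>2)" for y
      by (simp add: w_def h_def flip: exp_add)
    then show ?thesis using G(1)[where s="1/2"] by simp
  qed
  have w0: "w z \<ge> 0" for z by (simp add: w_def)
  have "(\<lambda>k. (\<integral>y. w y * h y ^ k \<partial>?\<nu>) / fact k) = (\<lambda>k. K * (a gchoose k))"
  proof (rule powser_eq_coeff[of "1/2"])
    fix t :: real assume t: "\<bar>t\<bar> < 1/2"
    show "(\<lambda>n. (\<integral>y. w y * h y ^ n \<partial>?\<nu>) / fact n * t ^ n) sums (\<integral>y. w y * exp (t * h y) \<partial>?\<nu>)"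
      by (rule exp_moments(2)[OF m w0 int]) (use t in simp)
    show "(\<lambda>n. K * (a gchoose n) * t ^ n) sums (K * (1 + t) powr a)"
      using sums_mult[OF gen_binomial_real[of t a], of K] t by (simp add: mult.assoc)
  next
    fix e :: real assume e: "e > 0"
    define t where "t = min (e / 2) (1/4)"
    have t: "t > 0" "\<bar>t\<bar> < e" "t < 1" using e by (auto simp: t_def)
    have "(\<integral>y. w y * exp (t * h y) \<partial>?\<nu>) = K * (1 + t) powr a"
      unfolding we using G(2)[where s="1 + t"] t by (simp add: a_def)
    then show "\<exists>t. t \<noteq> 0 \<and> \<bar>t\<bar> < e \<and> (\<integral>y. w y * exp (t * h y) \<partial>?\<nu>) = K * (1 + t) powr a"
      using t by (intro exI[of _ t]) auto
  qed simp
  then have "(\<integral>y. w y * h y ^ k \<partial>?\<nu>) / fact k = K * (a gchoose k)" by (rule fun_cong)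
  then have wh: "(\<integral>y. w y * h y ^ k \<partial>?\<nu>) = K * (fact k * (a gchoose k))" by (simp add: field_simps)
  have hk: "exp (- (norm y)\<^sup>2) * norm y ^ (2 * k) = (- 1) ^ k * (w y * h y ^ k)" for y
  proof -
    have "h y ^ k = (- 1) ^ k * norm y ^ (2 * k)"
      unfolding h_def by (simp add: power_minus[of "(norm y)\<^sup>2"] power_mult)
    then show ?thesis by (simp add: w_def flip: power_add mult_2)
  qed
  have "integrable ?\<nu> (\<lambda>y. w y * h y ^ k)"
    by (rule exp_moments(1)[OF m w0 int, of "1/2"]) auto
  then show "integrable ?\<nu> (\<lambda>y. exp (- (norm y)\<^sup>2) * norm y ^ (2 * k))" unfolding hk by simp
  show "(\<integral>y. exp (- (norm y)\<^sup>2) * norm y ^ (2 * k) \<partial>?\<nu>) = K * ((- 1) ^ k * fact k * (a gchoose k))"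
    unfolding hk by (simp add: wh)
qed

text \<open>
  With \<open>x\<close> all points \<open>t x\<close>, \<open>t > 0\<close>, belong to the support. Completing the square at these points
  shows that the exponential transform of \<open>2 \<langle>x,y\<rangle>\<close> is \<open>K exp (t\<^sup>2 |x|\<^sup>2)\<close>.
\<close>

lemma base_measure_directional_moments:
  fixes \<mu> :: "'n::finite heis measure"
  assumes \<mu>: "uniform_measure (2 * CARD('n) + 1) \<mu>" and inv: "vertically_invariant (msupp \<mu>)"
    and dil: "\<And>z l. z \<in> msupp \<mu> \<Longrightarrow> l > 0 \<Longrightarrow> dil l z \<in> msupp \<mu>"
    and K: "K > 0" "gauss_mass CARD('n) = ennreal K" and x: "(x, 0) \<in> msupp \<mu>"
  shows "(\<integral>y. exp (- (norm y)\<^sup>2) * (x \<bullet> y)\<^sup>2 \<partial>base_measure \<mu>) = K * (norm x)\<^sup>2 / 2"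
    and "(\<integral>y. exp (- (norm y)\<^sup>2) * (x \<bullet> y) ^ 4 \<partial>base_measure \<mu>) = K * (3 / 4 * norm x ^ 4)"
proof -
  let ?\<nu> = "base_measure \<mu>"
  have 0: "(0, 0) \<in> msupp \<mu>" using uniform_measureD(2)[OF \<mu>] by (simp add: zero_prod_def)
  note G = base_measure_gauss[OF \<mu> inv K]
  define w where "w y = exp (- (norm y)\<^sup>2)" for y :: "real ^ ('n + 'n)"
  define h where "h y = 2 * (x \<bullet> y)" for y :: "real ^ ('n + 'n)"
  have m [measurable]: "w \<in> borel_measurable ?\<nu>" "h \<in> borel_measurable ?\<nu>" unfolding w_def h_def by measurable
  have we: "w y * exp (t * h y) = exp ((norm x)\<^sup>2 * t\<^sup>2) * exp (- 1 * (norm (y - t *\<^sub>R x))\<^sup>2)" for y t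
  proof -
    have "(norm (y - t *\<^sub>R x))\<^sup>2 = (norm y)\<^sup>2 - 2 * t * (x \<bullet> y) + t\<^sup>2 * (norm x)\<^sup>2"
      unfolding power2_norm_eq_inner by (simp add: inner_diff_left inner_diff_right inner_commute power2_eq_square algebra_simps)
    then show ?thesis by (simp add: w_def h_def algebra_simps flip: exp_add)
  qed
  have w0: "w z \<ge> 0" for z by (simp add: w_def)
  have int: "integrable ?\<nu> (\<lambda>y. w y * exp (t * h y))" for t
  proof (rule Bochner_Integration.integrable_bound)
    show "integrable ?\<nu> (\<lambda>y. exp (2 * t\<^sup>2 * (norm x)\<^sup>2) * exp (- (1/2) * (norm (y - 0))\<^sup>2))"
      using G(1)[OF 0, where s="1/2"] by simp
    show "AE y in ?\<nu>. norm (w y * exp (t * h y)) \<le> norm (exp (2 * t\<^sup>2 * (norm x)\<^sup>2) * exp (- (1/2) * (norm (y - 0))\<^sup>2))"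
    proof (rule AE_I2)
      fix y
      have "0 \<le> (norm (y - (2 * t) *\<^sub>R x))\<^sup>2" by simp
      also have "\<dots> = (norm y)\<^sup>2 - 4 * t * (x \<bullet> y) + 4 * t\<^sup>2 * (norm x)\<^sup>2"
        unfolding power2_norm_eq_inner by (simp add: inner_diff_left inner_diff_right inner_commute power2_eq_square algebra_simps)
      finally have "- (norm y)\<^sup>2 + t * (2 * (x \<bullet> y)) \<le> 2 * t\<^sup>2 * (norm x)\<^sup>2 + - (1/2) * (norm y)\<^sup>2" by simp
      then have "exp (- (norm y)\<^sup>2 + t * (2 * (x \<bullet> y))) \<le> exp (2 * t\<^sup>2 * (norm x)\<^sup>2 + - (1/2) * (norm y)\<^sup>2)" by simp
      then show "norm (w y * exp (t * h y)) \<le> norm (exp (2 * t\<^sup>2 * (norm x)\<^sup>2) * exp (- (1/2) * (norm (y - 0))\<^sup>2))"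
        unfolding w_def h_def exp_add by simp
    qed
  qed simp
  have acc: "\<exists>t. t \<noteq> 0 \<and> \<bar>t\<bar> < e \<and> (\<integral>y. w y * exp (t * h y) \<partial>?\<nu>) = K * exp ((norm x)\<^sup>2 * t\<^sup>2)" if e: "e > 0" for e
  proof (intro exI conjI)
    have "(e / 2) *\<^sub>R x = fst (dil (e / 2) (x, 0))" by (simp add: dil_def)
    then have "((e / 2) *\<^sub>R x, 0) \<in> msupp \<mu>" using dil[OF x, of "e / 2"] e by (simp add: dil_def)
    from G(2)[OF this, where s=1] show "(\<integral>y. w y * exp (e / 2 * h y) \<partial>?\<nu>) = K * exp ((norm x)\<^sup>2 * (e / 2)\<^sup>2)"
      unfolding we by simp
  qed (use e in auto)
  note mom = gaussian_transform(2)[OF m w0 int acc]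
  have "(\<integral>y. w y * h y ^ 2 \<partial>?\<nu>) = K * (norm x)\<^sup>2 * 2"
    using mom[of 2] by (simp add: fact_numeral)
  moreover have "(\<lambda>y. w y * h y ^ 2) = (\<lambda>y. 4 * (exp (- (norm y)\<^sup>2) * (x \<bullet> y)\<^sup>2))"
    by (simp add: w_def h_def power_mult_distrib mult_ac)
  ultimately have "4 * (\<integral>y. exp (- (norm y)\<^sup>2) * (x \<bullet> y)\<^sup>2 \<partial>?\<nu>) = K * (norm x)\<^sup>2 * 2" by simp
  then show "(\<integral>y. exp (- (norm y)\<^sup>2) * (x \<bullet> y)\<^sup>2 \<partial>base_measure \<mu>) = K * (norm x)\<^sup>2 / 2" by simp
  have "(\<integral>y. w y * h y ^ 4 \<partial>?\<nu>) = K * norm x ^ 4 * 12"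
    using mom[of 4] by (simp add: fact_numeral flip: power_mult)
  moreover have "(\<lambda>y. w y * h y ^ 4) = (\<lambda>y. 16 * (exp (- (norm y)\<^sup>2) * (x \<bullet> y) ^ 4))"
    by (simp add: w_def h_def power_mult_distrib mult_ac)
  ultimately have "16 * (\<integral>y. exp (- (norm y)\<^sup>2) * (x \<bullet> y) ^ 4 \<partial>?\<nu>) = K * norm x ^ 4 * 12" by simp
  then show "(\<integral>y. exp (- (norm y)\<^sup>2) * (x \<bullet> y) ^ 4 \<partial>base_measure \<mu>) = K * (3 / 4 * norm x ^ 4)" by simp
qed

definition gauss_measure :: "real \<Rightarrow> 'n::finite heis measure \<Rightarrow> (real ^ ('n + 'n)) measure" where
  "gauss_measure K \<mu> = density (base_measure \<mu>) (\<lambda>y. ennreal (exp (- (norm y)\<^sup>2) / K))"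

lemma gauss_measure_integral:
  fixes f :: "real ^ ('n::finite + 'n) \<Rightarrow> real"
  assumes K: "K > 0" and [measurable]: "f \<in> borel_measurable borel"
  shows "(\<integral>y. f y \<partial>gauss_measure K \<mu>) = (\<integral>y. exp (- (norm y)\<^sup>2) * f y \<partial>base_measure \<mu>) / K"
    and "integrable (gauss_measure K \<mu>) f \<longleftrightarrow> integrable (base_measure \<mu>) (\<lambda>y. exp (- (norm y)\<^sup>2) * f y)"
proof -
  have eq: "(\<lambda>y. (exp (- (norm y)\<^sup>2) / K) *\<^sub>R f y) = (\<lambda>y. (1 / K) * (exp (- (norm y)\<^sup>2) * f y))" by auto
  show "(\<integral>y. f y \<partial>gauss_measure K \<mu>) = (\<integral>y. exp (- (norm y)\<^sup>2) * f y \<partial>base_measure \<mu>) / K"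
    unfolding gauss_measure_def using K by (subst integral_density) (auto simp: eq)
  show "integrable (gauss_measure K \<mu>) f \<longleftrightarrow> integrable (base_measure \<mu>) (\<lambda>y. exp (- (norm y)\<^sup>2) * f y)"
  proof -
    have "integrable (gauss_measure K \<mu>) f \<longleftrightarrow> integrable (base_measure \<mu>) (\<lambda>y. (exp (- (norm y)\<^sup>2) / K) *\<^sub>R f y)"
      unfolding gauss_measure_def using K by (intro integrable_density) auto
    also have "\<dots> \<longleftrightarrow> integrable (base_measure \<mu>) (\<lambda>y. exp (- (norm y)\<^sup>2) * f y)"
      unfolding eq integrable_mult_left_iff integrable_mult_right_iff using K by simp
    finally show ?thesis .
  qed
qed

lemma gchoose_small:
  fixes a :: real
  shows "a gchoose 2 = a * (a - 1) / 2" "a gchoose 3 = a * (a - 1) * (a - 2) / 6"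
  by (simp_all add: gbinomial_prod_rev numeral_2_eq_2 numeral_3_eq_3)

lemma rigid_gauss_measure:
  fixes \<mu> :: "'n::finite heis measure"
  assumes \<mu>: "uniform_measure (2 * CARD('n) + 1) \<mu>" and inv: "vertically_invariant (msupp \<mu>)"
    and dil: "\<And>z l. z \<in> msupp \<mu> \<Longrightarrow> l > 0 \<Longrightarrow> dil l z \<in> msupp \<mu>"
    and K: "K > 0" "gauss_mass CARD('n) = ennreal K"
  shows "rigid_moments (gauss_measure K \<mu>) (2 * real CARD('n) - 1)"
proof -
  let ?\<nu> = "base_measure \<mu>" and ?\<rho> = "gauss_measure K \<mu>" and ?d = "2 * real CARD('n) - 1"
  note sets [measurable_cong] = uniform_measureD(1)[OF \<mu>]
  have sr: "sets ?\<rho> = sets borel" by (simp add: gauss_measure_def)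
  note R = base_measure_radial_moment[OF \<mu> inv K]
  note GI = gauss_measure_integral[OF K(1), where \<mu>=\<mu>]
  have int_even: "integrable ?\<rho> (\<lambda>y. norm y ^ (2 * k))" for k
    by (subst GI(2)) (use R(1)[where k=k] in auto)
  have val: "(\<integral>y. norm y ^ (2 * k) \<partial>?\<rho>) = (- 1) ^ k * fact k * (- (?d / 2) gchoose k)" for k
    by (subst GI(1)) (use R(2)[where k=k] K(1) in auto)
  have supp: "AE y in ?\<nu>. (y, 0) \<in> msupp \<mu>"
  proof (rule AE_I)
    let ?N = "{y. (y, 0) \<notin> msupp \<mu>}"
    have "open ?N"
    proof -
      have "?N = (\<lambda>y. (y, 0)) -` (- msupp \<mu>)" by auto
      moreover have "open \<dots>" by (intro open_vimage continuous_intros) (simp add: closed_msupp open_Compl)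
      ultimately show ?thesis by simp
    qed
    then show "?N \<in> sets ?\<nu>" by simp
    then have "emeasure ?\<nu> ?N = (\<integral>\<^sup>+y. indicator ?N y \<partial>?\<nu>)" by simp
    also have "\<dots> = (\<integral>\<^sup>+z. indicator {0..<1} (snd z) * indicator ?N (fst z) \<partial>\<mu>)"
      using \<open>open ?N\<close> by (intro nn_integral_base_measure[OF sets] borel_measurable_indicator) simp
    also have "\<dots> \<le> (\<integral>\<^sup>+z. indicator (- msupp \<mu>) z \<partial>\<mu>)"
      using inv by (intro nn_integral_mono) (auto simp: indicator_def vertically_invariant_def)
    also have "\<dots> = emeasure \<mu> (- msupp \<mu>)"
      using closed_msupp[of \<mu>] by (intro nn_integral_indicator) (auto simp: sets)
    also have "\<dots> = 0" by (rule emeasure_compl_msupp[OF sets])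
    finally show "emeasure ?\<nu> ?N = 0" by simp
  qed auto
  have AE_rho: "AE u in ?\<rho>. Q u" if "\<And>u. (u, 0) \<in> msupp \<mu> \<Longrightarrow> Q u" for Q
    unfolding gauss_measure_def using supp that by (subst AE_density) (auto elim!: eventually_mono)
  note D = base_measure_directional_moments[OF \<mu> inv dil K]
  show ?thesis
  proof (rule rigid_moments.intro)
    show "finite_measure ?\<rho>"
    proof (rule finite_measureI)
      have "integrable ?\<rho> (\<lambda>y. norm y ^ (2 * 0))" by (rule int_even)
      then have "integrable ?\<rho> (\<lambda>y. 1 :: real)" by simp
      then show "emeasure ?\<rho> (space ?\<rho>) \<noteq> \<infinity>" by (simp add: integrable_iff_bounded less_top)
    qed
    show "sets ?\<rho> = sets borel" by (rule sr)
    show "?d = real CARD('n + 'n) - 1" by simp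
    show "?d > 0" using zero_less_card_finite[where 'a='n] by linarith
    show "integrable ?\<rho> (\<lambda>y. norm y ^ 6)" using int_even[of 3] by simp
    show "(\<integral>y. (norm y)\<^sup>2 \<partial>?\<rho>) = ?d / 2" 
    proof -
      have "(- 1) ^ 1 * fact 1 * (- (?d / 2) gchoose 1) = ?d / 2" by simp (simp add: field_simps)
      then show ?thesis using val[of 1] by simp
    qed
    show "(\<integral>y. norm y ^ 4 \<partial>?\<rho>) = ?d * (?d + 2) / 4"
      using val[of 2] by (simp add: gchoose_small field_simps)
    show "(\<integral>y. norm y ^ 6 \<partial>?\<rho>) = ?d * (?d + 2) * (?d + 4) / 8"
      using val[of 3] by (simp add: gchoose_small fact_numeral field_simps)
    show "AE u in ?\<rho>. (\<integral>y. (u \<bullet> y)\<^sup>2 \<partial>?\<rho>) = (norm u)\<^sup>2 / 2"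
    proof (rule AE_rho)
      fix u assume "(u, 0) \<in> msupp \<mu>"
      then show "(\<integral>y. (u \<bullet> y)\<^sup>2 \<partial>?\<rho>) = (norm u)\<^sup>2 / 2"
        using K(1) by (subst GI(1)) (auto simp: D(1))
    qed
    show "AE u in ?\<rho>. (\<integral>y. (u \<bullet> y) ^ 4 \<partial>?\<rho>) = 3 / 4 * norm u ^ 4"
    proof (rule AE_rho)
      fix u assume "(u, 0) \<in> msupp \<mu>"
      then show "(\<integral>y. (u \<bullet> y) ^ 4 \<partial>?\<rho>) = 3 / 4 * norm u ^ 4"
        using K(1) by (subst GI(1)) (auto simp: D(2))
    qed
  qed
qed

section \<open>Flatness\<close>

text \<open>
  On a cone the homogeneous parts of the equation vanish separately.
\<close>

lemma quadric_homogeneous: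
  assumes dil: "\<And>z l. z \<in> S \<Longrightarrow> l > 0 \<Longrightarrow> dil l z \<in> S" and S: "S \<subseteq> quadric b Q" and z: "z \<in> S"
  shows "fst z \<bullet> (Q *v fst z) = 0"
proof -
  have eq: "l * (b \<bullet> fst z) + l\<^sup>2 * (fst z \<bullet> (Q *v fst z)) = 0" if "l > 0" for l
  proof -
    have "dil l z \<in> quadric b Q" using dil[OF z that] S by blast
    then show ?thesis
      by (simp add: quadric_def dil_def matrix_vector_mult_scaleR power2_eq_square mult.assoc)
  qed
  show ?thesis using eq[of 1] eq[of 2] by simp
qed

lemma ball_second_moment_nn:
  fixes \<mu> :: "'n::finite heis measure"
  assumes \<mu>: "uniform_measure m \<mu>" and v: "norm v = 1"
  shows "(\<integral>\<^sup>+z. ennreal ((v \<bullet> fst z)\<^sup>2) * indicator (kball 1 0) z \<partial>\<mu>)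
    = ennreal (set_lebesgue_integral \<mu> (kball 1 0) (\<lambda>z. (v \<bullet> fst z)\<^sup>2))"
proof -
  note sets [measurable_cong] = uniform_measureD(1)[OF \<mu>]
  have fin: "emeasure \<mu> (kball 1 0) < \<infinity>" using uniform_measureD(2,3)[OF \<mu>] by simp
  have int: "integrable \<mu> (\<lambda>z. indicator (kball 1 0) z *\<^sub>R (v \<bullet> fst z)\<^sup>2)"
  proof (rule Bochner_Integration.integrable_bound)
    show "integrable \<mu> (indicator (kball 1 0) :: 'n heis \<Rightarrow> real)"
      using fin by (simp add: integrable_indicator_iff sets)
    show "AE z in \<mu>. norm (indicator (kball 1 0) z *\<^sub>R (v \<bullet> fst z)\<^sup>2) \<le> norm (indicator (kball 1 0) z :: real)"
    proof (rule AE_I2)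
      fix z :: "'n heis"
      show "norm (indicator (kball 1 0) z *\<^sub>R (v \<bullet> fst z)\<^sup>2) \<le> norm (indicator (kball 1 0) z :: real)"
      proof (cases "z \<in> kball 1 0")
        case True
        then have "norm (fst z) \<le> 1" using kball_components(1)[OF True] by simp
        then have "\<bar>v \<bullet> fst z\<bar> \<le> 1" using Cauchy_Schwarz_ineq2[of v "fst z"] v by simp
        then have "(v \<bullet> fst z)\<^sup>2 \<le> 1" by (simp add: abs_square_le_1)
        then show ?thesis using True by simp
      qed simp
    qed
  qed measurable
  have "(\<integral>\<^sup>+z. ennreal ((v \<bullet> fst z)\<^sup>2) * indicator (kball 1 0) z \<partial>\<mu>)
    = (\<integral>\<^sup>+z. ennreal (indicator (kball 1 0) z *\<^sub>R (v \<bullet> fst z)\<^sup>2) \<partial>\<mu>)"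
    by (intro nn_integral_cong) (auto simp: indicator_def)
  also have "\<dots> = ennreal (\<integral>z. indicator (kball 1 0) z *\<^sub>R (v \<bullet> fst z)\<^sup>2 \<partial>\<mu>)"
    by (intro nn_integral_eq_integral int) auto
  finally show ?thesis by (simp add: set_lebesgue_integral_def)
qed

lemma small_threshold:
  fixes A B :: real
  assumes "A > 0" "B > 0"
  obtains \<epsilon> where "0 < \<epsilon>" "\<epsilon> \<le> 1" "sqrt (2 * \<epsilon>) * A \<le> 1 / 16" "sqrt (2 * \<epsilon>) * B \<le> 1 / 192"
proof -
  define \<theta> where "\<theta> = min 1 (min (1 / (16 * A)) (1 / (192 * B)))"
  have th: "0 < \<theta>" "\<theta> \<le> 1" "\<theta> \<le> 1 / (16 * A)" "\<theta> \<le> 1 / (192 * B)" using assms by (auto simp: \<theta>_def)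
  have "\<theta>\<^sup>2 \<le> 1" using th by (simp add: power_le_one)
  show thesis
  proof (rule that[of "\<theta>\<^sup>2 / 2"])
    show "0 < \<theta>\<^sup>2 / 2" "\<theta>\<^sup>2 / 2 \<le> 1" using th \<open>\<theta>\<^sup>2 \<le> 1\<close> by auto
    show "sqrt (2 * (\<theta>\<^sup>2 / 2)) * A \<le> 1 / 16" "sqrt (2 * (\<theta>\<^sup>2 / 2)) * B \<le> 1 / 192"
      using th assms by (simp_all add: field_simps)
  qed
qed

text \<open>
  Here \<open>K\<close> has to be the Gaussian mass only if the latter is a positive real number: the constant of
  the theorem is chosen before \<open>\<mu>\<close>, but the finiteness of this mass is deduced from \<open>\<mu>\<close>.
\<close>

lemma flat_of_small_moment:
  fixes \<mu> :: "'n::finite heis measure"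
  assumes \<mu>: "uniform_cone (2 * CARD('n) + 1) \<mu>" and vert: "vertical \<mu>"
    and K: "\<And>K'. gauss_mass CARD('n) = ennreal K' \<Longrightarrow> K' > 0 \<Longrightarrow> K = K'"
    and \<epsilon>: "0 < \<epsilon>" "\<epsilon> \<le> 1"
      "sqrt (2 * \<epsilon>) * ((2 * real CARD('n) - 1) * (2 * real CARD('n) - 1 + 2) * (2 * real CARD('n) - 1 + 4)) \<le> 1 / 16"
      "sqrt (2 * \<epsilon>) * ((2 * real CARD('n) - 1) * (2 * real CARD('n) - 1 + 2)) \<le> 1 / 192"
    and v: "norm v = 1"
    and small: "exp 1 * Gamma ((2 * CARD('n) + 3) / 2 + 1) * set_lebesgue_integral \<mu> (kball 1 0) (\<lambda>z. (v \<bullet> fst z)\<^sup>2) \<le> K * \<epsilon> / 2"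
  shows "flat \<mu>"
proof (cases "\<exists>\<nn>. \<nn> \<noteq> 0 \<and> msupp \<mu> \<subseteq> vplane \<nn>")
  case True
  then show ?thesis using flat_of_msupp_subset_vplane[OF \<mu>] by blast
next
  case False
  have u: "uniform_measure (2 * CARD('n) + 1) \<mu>"
    and cone: "\<forall>l>0. \<forall>A\<in>sets borel. ennreal (1 / l ^ (2 * CARD('n) + 1)) * emeasure \<mu> (dil l ` A) = emeasure \<mu> A"
    using \<mu> by (auto simp: uniform_cone_def)
  note sets [measurable_cong] = uniform_measureD(1)[OF u]
  note dil = msupp_dil[OF cone]
  obtain b0 Q where Q: "Q \<noteq> 0" "transpose Q = Q" "msupp \<mu> \<subseteq> quadric b0 Q"
    using vert by (auto simp: vertical_def)
  have inv: "vertically_invariant (msupp \<mu>)"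
    unfolding vertically_invariant_def
    using msupp_vertical_dichotomy[OF u Q(1,2) quadric_homogeneous[OF dil Q(3)] False] by blast
  obtain K' where K': "K' > 0" "gauss_mass CARD('n) = ennreal K'"
    using gauss_mass_finite[OF u inv] by metis
  have "K = K'" using K K' by blast
  then have K0: "K > 0" "gauss_mass CARD('n) = ennreal K" using K' by auto
  let ?\<rho> = "gauss_measure K \<mu>" and ?d = "2 * real CARD('n) - 1"
  interpret rigid_moments ?\<rho> ?d by (rule rigid_gauss_measure[OF u inv dil K0])
  let ?I = "set_lebesgue_integral \<mu> (kball 1 0) (\<lambda>z. (v \<bullet> fst z)\<^sup>2)"
  let ?G = "exp 1 * Gamma ((2 * CARD('n) + 3) / 2 + 1)"
  have G0: "0 < ?G" by (intro mult_pos_pos Gamma_real_pos add_nonneg_pos) auto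
  have "b v \<le> \<epsilon> / 2"
  proof -
    have "(\<integral>\<^sup>+y. ennreal (exp (- (norm y)\<^sup>2) * (v \<bullet> y)\<^sup>2) \<partial>base_measure \<mu>) \<le> ennreal ?G * ennreal ?I"
      using base_measure_second_moment_le[OF u cone, of v] ball_second_moment_nn[OF u v]
      by (simp add: ennreal_mult' mult.commute)
    also have "\<dots> = ennreal (?G * ?I)" using G0 by (intro ennreal_mult'[symmetric]) simp
    also have "\<dots> \<le> ennreal (K * \<epsilon> / 2)" using small by (rule ennreal_leI)
    finally have "(\<integral>y. exp (- (norm y)\<^sup>2) * (v \<bullet> y)\<^sup>2 \<partial>base_measure \<mu>) \<le> K * \<epsilon> / 2"
      using K0 \<epsilon> by (intro integral_real_bounded) auto
    then have "(\<integral>y. exp (- (norm y)\<^sup>2) * (v \<bullet> y)\<^sup>2 \<partial>base_measure \<mu>) / K \<le> \<epsilon> / 2"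
      using K0 by (simp add: field_simps)
    then show ?thesis unfolding b_def by (subst gauss_measure_integral(1)[OF K0(1)]) auto
  qed
  moreover have "v \<bullet> v = 1" using v by (simp add: norm_eq_1)
  ultimately obtain m where m: "m \<bullet> m = 1" and AE: "AE y in ?\<rho>. m \<bullet> y = 0"
    using hyperplane_of_small_moment[of v \<epsilon>] \<epsilon> by blast
  have "m \<noteq> 0" using m by auto
  have "msupp \<mu> \<subseteq> vplane m"
  proof
    fix z assume z: "z \<in> msupp \<mu>"
    show "z \<in> vplane m"
    proof (rule ccontr)
      assume nz: "z \<notin> vplane m"
      let ?U = "{w :: 'n heis. m \<bullet> fst w \<noteq> 0 \<and> 0 < snd w \<and> snd w < 1}"
      have "open ?U" by (intro open_Collect_conj open_Collect_less open_Collect_neq continuous_intros)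
      moreover have "(fst z, 1/2) \<in> ?U" using nz by (simp add: vplane_def)
      moreover have "(fst z, 1/2) \<in> msupp \<mu>" using vertically_invariantD[OF inv, of "fst z" "snd z"] z by simp
      ultimately have pos: "emeasure \<mu> ?U > 0" unfolding msupp_def by blast
      have "AE y in base_measure \<mu>. m \<bullet> y = 0"
        using AE K0(1) unfolding gauss_measure_def by (subst (asm) AE_density) (auto elim!: eventually_mono)
      then have "(\<integral>\<^sup>+y. indicator {y. m \<bullet> y \<noteq> 0} y \<partial>base_measure \<mu>) = 0"
        by (subst nn_integral_0_iff_AE) (auto elim!: eventually_mono)
      then have "(\<integral>\<^sup>+w. indicator {0..<1} (snd w) * indicator {y. m \<bullet> y \<noteq> 0} (fst w) \<partial>\<mu>) = 0"
        by (subst (asm) nn_integral_base_measure[OF sets]) auto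
      moreover have "(\<integral>\<^sup>+w. indicator ?U w \<partial>\<mu>) \<le> (\<integral>\<^sup>+w. indicator {0..<1} (snd w) * indicator {y. m \<bullet> y \<noteq> 0} (fst w) \<partial>\<mu>)"
        by (intro nn_integral_mono) (auto simp: indicator_def)
      moreover have "(\<integral>\<^sup>+w. indicator ?U w \<partial>\<mu>) = emeasure \<mu> ?U"
        using \<open>open ?U\<close> by (intro nn_integral_indicator) (simp add: sets)
      ultimately show False using pos by simp
    qed
  qed
  then show ?thesis using False \<open>m \<noteq> 0\<close> by blast
qed

theorem theorem1p8:
  "\<exists>C>0. \<forall>\<mu> :: 'n::finite heis measure.
     uniform_cone (2 * CARD('n) + 1) \<mu> \<longrightarrow> vertical \<mu> \<longrightarrow>
     (INF \<mm>\<in>sphere (0 :: real ^ ('n + 'n)) 1.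
        set_lebesgue_integral \<mu> (kball 1 0) (\<lambda>z. (\<mm> \<bullet> fst z)\<^sup>2)) \<le> C \<longrightarrow>
     flat \<mu>"
proof -
  let ?d = "2 * real CARD('n) - 1"
  have d: "?d > 0" using zero_less_card_finite[where 'a='n] by linarith
  obtain \<epsilon> where \<epsilon>: "0 < \<epsilon>" "\<epsilon> \<le> 1" "sqrt (2 * \<epsilon>) * (?d * (?d + 2) * (?d + 4)) \<le> 1 / 16"
    "sqrt (2 * \<epsilon>) * (?d * (?d + 2)) \<le> 1 / 192"
    using small_threshold[of "?d * (?d + 2) * (?d + 4)" "?d * (?d + 2)"] d
    by (metis add_pos_pos mult_pos_pos zero_less_numeral)
  \<comment> \<open>The alternative 1 only serves to make \<open>K\<close> positive in any case; once the support of some \<open>\<mu>\<close> is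
    vertically invariant, \<open>gauss_mass_finite\<close> shows that the first case applies.\<close>
  define K where "K = (if \<exists>K'>0. gauss_mass CARD('n) = ennreal K' then enn2real (gauss_mass CARD('n)) else 1)"
  have K0: "K > 0" by (auto simp: K_def)
  have K: "K = K'" if "gauss_mass CARD('n) = ennreal K'" "K' > 0" for K'
    using that by (auto simp: K_def)
  let ?G = "exp 1 * Gamma ((2 * CARD('n) + 3) / 2 + 1) :: real"
  have G0: "0 < ?G" by (intro mult_pos_pos Gamma_real_pos add_nonneg_pos) auto
  define C where "C = K * \<epsilon> / (4 * ?G)"
  have C: "C > 0" using K0 \<epsilon> G0 by (simp add: C_def)
  have "flat \<mu>" if \<mu>: "uniform_cone (2 * CARD('n) + 1) \<mu>" "vertical \<mu>"
    and inf: "(INF \<mm>\<in>sphere (0 :: real ^ ('n + 'n)) 1.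
        set_lebesgue_integral \<mu> (kball 1 0) (\<lambda>z. (\<mm> \<bullet> fst z)\<^sup>2)) \<le> C" for \<mu> :: "'n heis measure"
  proof -
    have "(INF \<mm>\<in>sphere (0 :: real ^ ('n + 'n)) 1.
        set_lebesgue_integral \<mu> (kball 1 0) (\<lambda>z. (\<mm> \<bullet> fst z)\<^sup>2)) < 2 * C" using inf C by linarith
    moreover have "bdd_below ((\<lambda>\<mm>. set_lebesgue_integral \<mu> (kball 1 0) (\<lambda>z. (\<mm> \<bullet> fst z)\<^sup>2)) ` sphere (0 :: real ^ ('n + 'n)) 1)"
      by (intro bdd_belowI2[of _ 0]) (auto simp: set_lebesgue_integral_def intro!: integral_nonneg_AE)
    moreover have "sphere (0 :: real ^ ('n + 'n)) 1 \<noteq> {}" by simp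
    ultimately obtain v where v: "v \<in> sphere (0 :: real ^ ('n + 'n)) 1"
      and less: "set_lebesgue_integral \<mu> (kball 1 0) (\<lambda>z. (v \<bullet> fst z)\<^sup>2) < 2 * C"
      by (subst (asm) cINF_less_iff) auto
    have "?G * set_lebesgue_integral \<mu> (kball 1 0) (\<lambda>z. (v \<bullet> fst z)\<^sup>2) \<le> ?G * (2 * C)"
      using less G0 by (intro mult_left_mono) auto
    also have "\<dots> = K * \<epsilon> / 2"
    proof -
      have "g * (2 * (K * \<epsilon> / (4 * g))) = K * \<epsilon> / 2" if "g > 0" for g
        using that by (simp add: field_simps)
      then show ?thesis unfolding C_def using G0 by blast
    qed
    finally show ?thesis
      using v by (intro flat_of_small_moment[OF \<mu> K \<epsilon>, of v]) auto
  qed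
  then show ?thesis using C by blast
qed

end
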